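(* For every positive integer $m$ let $\mathfrak{P}_m$ be a prime ideal of $\mathcal{O}_{K_m}$, where $K_m=\mathbb{Q}[\zeta_m]$, lying over a prime number that does not divide $m$, and let $q_m=|\mathcal{O}_{K_m}/\mathfrak{P}_m|$. Let $\mathcal{L}_{\mathcal{C},m}$ be the associated family of lattices in $(K_m\otimes_{\mathbb{Q}}\mathbb{R})^2\cong\mathbb{R}^{2\phi(m)}$ defined in the context. Assume that $\phi(m)^2 m=o\big(q_m^{1/\phi(m)}\big)$ as $m\to\infty$. Then for infinitely many dimensions $n$ there is an $m$ with $n=2\phi(m)$ such that the family $\mathcal{L}_{\mathcal{C},m}$ contains a lattice $\Lambda\subset\mathbb{R}^n$ satisfying $$\Delta(\Lambda)\geq\frac{0.89\,n\log\log n}{2^n}.$$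
   Context: $\phi$ is Euler's totient function, $\zeta_m$ a primitive $m$-th root of unity, $K=\mathbb{Q}[\zeta_m]$ with ring of integers $\mathcal{O}_K$, and $K_{\mathbb{R}}=K\otimes_{\mathbb{Q}}\mathbb{R}$ is a Euclidean space of dimension $\phi(m)$ for the scalar product $\langle x,y\rangle=\mathrm{tr}(x\overline{y})$ induced by the trace form of $K/\mathbb{Q}$ and complex conjugation. $E=K_{\mathbb{R}}^2$ carries the scalar product $\langle x,y\rangle=\langle x_1,y_1\rangle+\langle x_2,y_2\rangle$ and is identified isometrically with $\mathbb{R}^{2\phi(m)}$. Let $\mathfrak{P}$ be a prime ideal of $\mathcal{O}_K$ over a prime number not dividing $m$, $F=\mathcal{O}_K/\mathfrak{P}$, $q=|F|$. Put $\Lambda_0=\mathcal{O}_K^2\subset E$ and let $\pi:\Lambda_0\to\Lambda_0/\mathfrak{P}\Lambda_0= F^2$ be the canonical surjection. $\mathcal{C}$ is the set of the $q+1$ one-dimensional $F$-subspaces of $F^2$; for $C\in\mathcal{C}$, $\Lambda_C=\pi^{-1}(C)$; and $\mathcal{L}_{\mathcal{C}}=\{\Lambda_C : C\in\mathcal{C}\}$. $\mathcal{L}_{\mathcal{C},m}$ denotes this family for the given $m$ and $\mathfrak{P}=\mathfrak{P}_m$. For a lattice $\Lambda$ in an $n$-dimensional Euclidean space, $\mathrm{Vol}(\Lambda)$ is the volume of a fundamental region, $\mu_\Lambda=\min\{\|x\|:x\in\Lambda\setminus\{0\}\}$, $B(r)$ is the closed ball of radius $r$ centered at $0$, and $\Delta(\Lambda)=\frac{\mathrm{Vol}(B(\mu_\Lambda))}{2^n\mathrm{Vol}(\Lambda)}$.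 *)

theory Defs
  imports
    "HOL-Analysis.Analysis"
    "HOL-Algebra.QuotRing"
    "HOL-Number_Theory.Totient"
    "HOL-Library.Landau_Symbols"
    "HOL-Library.Poly_Mapping"
begin

section \<open>Volume, covolume and density in a Euclidean space\<close>

text \<open>A Euclidean space is a finite-dimensional real subspace \<open>V\<close> of a real vector space together
  with a function \<open>ip\<close> that is a scalar product on \<open>V\<close>. Its Lebesgue measure is transported from
  \<open>\<real>\<^sup>n\<close>, \<open>n = dim V\<close>, along the isometric identification given by an orthonormal basis; it does not
  depend on which orthonormal basis the choice operator returns.\<close>

definition orthonormal_basis ::
    "'a::real_vector set \<Rightarrow> ('a \<Rightarrow> 'a \<Rightarrow> real) \<Rightarrow> (nat \<Rightarrow> 'a) \<Rightarrow> bool" where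
  "orthonormal_basis V ip e \<longleftrightarrow>
     span (e ` {..<dim V}) = V \<and>
     (\<forall>i<dim V. \<forall>j<dim V. ip (e i) (e j) = (if i = j then 1 else 0))"

definition euclid_lebesgue :: "'a::real_vector set \<Rightarrow> ('a \<Rightarrow> 'a \<Rightarrow> real) \<Rightarrow> 'a measure" where
  "euclid_lebesgue V ip =
     (let e = (SOME e. orthonormal_basis V ip e)
      in embed_measure (\<Pi>\<^sub>M i\<in>{..<dim V}. (lborel :: real measure))
           (\<lambda>t. \<Sum>i<dim V. t i *\<^sub>R e i))"

definition fundamental_region ::
    "'a::real_vector set \<Rightarrow> ('a \<Rightarrow> 'a \<Rightarrow> real) \<Rightarrow> 'a set \<Rightarrow> 'a set \<Rightarrow> bool" where
  "fundamental_region V ip L R \<longleftrightarrow>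
     R \<in> sets (euclid_lebesgue V ip) \<and> (\<forall>x\<in>V. \<exists>!l. l \<in> L \<and> x - l \<in> R)"

text \<open>All measurable fundamental regions of a lattice have the same volume.\<close>

definition covolume :: "'a::real_vector set \<Rightarrow> ('a \<Rightarrow> 'a \<Rightarrow> real) \<Rightarrow> 'a set \<Rightarrow> real" where
  "covolume V ip L = measure (euclid_lebesgue V ip) (SOME R. fundamental_region V ip L R)"

text \<open>For a nonzero lattice the infimum is attained.\<close>

definition min_norm :: "('a::real_vector \<Rightarrow> 'a \<Rightarrow> real) \<Rightarrow> 'a set \<Rightarrow> real" where
  "min_norm ip L = Inf ((\<lambda>x. sqrt (ip x x)) ` (L - {0}))"

definition euclid_cball ::
    "'a::real_vector set \<Rightarrow> ('a \<Rightarrow> 'a \<Rightarrow> real) \<Rightarrow> real \<Rightarrow> 'a set" where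
  "euclid_cball V ip r = {x \<in> V. sqrt (ip x x) \<le> r}"

definition lattice_density :: "'a::real_vector set \<Rightarrow> ('a \<Rightarrow> 'a \<Rightarrow> real) \<Rightarrow> 'a set \<Rightarrow> real" where
  "lattice_density V ip L =
     measure (euclid_lebesgue V ip) (euclid_cball V ip (min_norm ip L)) /
       (2 ^ dim V * covolume V ip L)"


section \<open>The tensor product of the complex and the real numbers over the rationals\<close>

text \<open>The symbol \<open>a \<otimes> s\<close> is represented by the finitely supported function
  \<open>Poly_Mapping.single a s\<close>, which makes additivity in \<open>s\<close> automatic. The other defining relations
  generate the following additive subgroup.\<close>

inductive_set tensor_relations :: "(complex \<Rightarrow>\<^sub>0 real) set" where
  zero: "0 \<in> tensor_relations"
| plus: "f \<in> tensor_relations \<Longrightarrow> g \<in> tensor_relations \<Longrightarrow> f + g \<in> tensor_relations"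
| uminus: "f \<in> tensor_relations \<Longrightarrow> - f \<in> tensor_relations"
| additive: "Poly_Mapping.single (a + b) s - Poly_Mapping.single a s - Poly_Mapping.single b s
               \<in> tensor_relations"
| balanced: "Poly_Mapping.single (of_rat r * a) s - Poly_Mapping.single a (of_rat r * s)
               \<in> tensor_relations"

lemma tensor_relations_minus:
  "f \<in> tensor_relations \<Longrightarrow> g \<in> tensor_relations \<Longrightarrow> f - g \<in> tensor_relations"
  using tensor_relations.plus[OF _ tensor_relations.uminus, of f g] by simp

lemma lookup_map_times:
  "Poly_Mapping.lookup (Poly_Mapping.map ((*) (r::real)) f) a = r * Poly_Mapping.lookup f a"
  by (simp add: Poly_Mapping.map.rep_eq when_def)

lemma map_times_simps:
  fixes r :: real and f g :: "complex \<Rightarrow>\<^sub>0 real"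
  shows "Poly_Mapping.map ((*) r) 0 = (0 :: complex \<Rightarrow>\<^sub>0 real)"
    and "Poly_Mapping.map ((*) r) (f + g) = Poly_Mapping.map ((*) r) f + Poly_Mapping.map ((*) r) g"
    and "Poly_Mapping.map ((*) r) (f - g) = Poly_Mapping.map ((*) r) f - Poly_Mapping.map ((*) r) g"
    and "Poly_Mapping.map ((*) r) (- f) = - Poly_Mapping.map ((*) r) f"
    and "Poly_Mapping.map ((*) r) (Poly_Mapping.single a s) = Poly_Mapping.single a (r * s)"
  by (intro poly_mapping_eqI;
      simp add: lookup_map_times lookup_add lookup_minus lookup_single when_def algebra_simps)+

lemma tensor_relations_map_times:
  "f \<in> tensor_relations \<Longrightarrow> Poly_Mapping.map ((*) r) f \<in> tensor_relations"
proof (induction rule: tensor_relations.induct)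
  case (balanced q a s)
  then show ?case
    using tensor_relations.balanced[of q a "r * s"]
    by (simp add: map_times_simps mult.left_commute)
qed (auto simp: map_times_simps intro: tensor_relations.intros)

quotient_type ctensor = "complex \<Rightarrow>\<^sub>0 real" / "\<lambda>f g. f - g \<in> tensor_relations"
proof (rule equivpI)
  show "reflp (\<lambda>f g. f - g \<in> tensor_relations)"
    by (auto intro!: reflpI tensor_relations.zero)
  show "symp (\<lambda>f g. f - g \<in> tensor_relations)"
    by (auto intro!: sympI dest: tensor_relations.uminus)
  show "transp (\<lambda>f g. f - g \<in> tensor_relations)"
    by (auto intro!: transpI dest: tensor_relations.plus)
qed

instantiation ctensor :: real_vector
begin

lift_definition zero_ctensor :: ctensor is 0 .

lift_definition plus_ctensor :: "ctensor \<Rightarrow> ctensor \<Rightarrow> ctensor" is "(+)"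
  by (metis add_diff_add tensor_relations.plus)

lift_definition uminus_ctensor :: "ctensor \<Rightarrow> ctensor" is uminus
  by (metis minus_diff_minus tensor_relations.uminus)

lift_definition minus_ctensor :: "ctensor \<Rightarrow> ctensor \<Rightarrow> ctensor" is "(-)"
  by (metis diff_diff_eq2 diff_add_eq add.commute diff_diff_eq tensor_relations_minus)

lift_definition scaleR_ctensor :: "real \<Rightarrow> ctensor \<Rightarrow> ctensor"
  is "\<lambda>r. Poly_Mapping.map ((*) r)"
  by (metis map_times_simps(3) tensor_relations_map_times)

instance
proof
  fix x y z :: ctensor and r s :: real
  have eqI: "f = g \<Longrightarrow> f - g \<in> tensor_relations" for f g
    by (simp add: tensor_relations.zero)
  show "x + y + z = x + (y + z)" by transfer (rule eqI, simp add: add.assoc)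
  show "x + y = y + x" by transfer (rule eqI, simp add: add.commute)
  show "0 + x = x" by transfer (rule eqI, simp)
  show "- x + x = 0" by transfer (rule eqI, simp)
  show "x - y = x + - y" by transfer (rule eqI, simp)
  show "r *\<^sub>R (x + y) = r *\<^sub>R x + r *\<^sub>R y"
    by transfer (rule eqI, simp add: map_times_simps)
  show "(r + s) *\<^sub>R x = r *\<^sub>R x + s *\<^sub>R x"
    by transfer
      (rule eqI, rule poly_mapping_eqI, simp add: lookup_map_times lookup_add algebra_simps)
  show "r *\<^sub>R s *\<^sub>R x = (r * s) *\<^sub>R x"
    by transfer (rule eqI, rule poly_mapping_eqI, simp add: lookup_map_times)
  show "1 *\<^sub>R x = x"
    by transfer (rule eqI, rule poly_mapping_eqI, simp add: lookup_map_times)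
qed

end

lift_definition tensor :: "complex \<Rightarrow> real \<Rightarrow> ctensor" is Poly_Mapping.single .

lemma tensor_add_left: "tensor (a + b) s = tensor a s + tensor b s"
  by transfer (metis diff_diff_eq tensor_relations.additive)

lemma tensor_add_right: "tensor a (s + t) = tensor a s + tensor a t"
  by transfer (simp add: single_add tensor_relations.zero)

lemma tensor_of_rat_left: "tensor (of_rat r * a) s = tensor a (of_rat r * s)"
  by transfer (rule tensor_relations.balanced)

lemma scaleR_tensor: "r *\<^sub>R tensor a s = tensor a (r * s)"
  by transfer (simp add: map_times_simps tensor_relations.zero)


section \<open>Scalar extension and trace form of a number field\<close>

global_interpretation ratvs: vector_space "\<lambda>(r::rat) (x::complex). of_rat r * x"
  defines rat_independent = ratvs.independent
    and rat_span = ratvs.span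
    and rat_representation = ratvs.representation
  by unfold_locales (simp_all add: algebra_simps of_rat_add of_rat_mult)

definition rat_basis :: "complex set \<Rightarrow> complex set \<Rightarrow> bool" where
  "rat_basis K B \<longleftrightarrow> rat_independent B \<and> rat_span B = K"

text \<open>The trace over the rationals of the multiplication by \<open>x\<close> on \<open>K\<close>, read off from its matrix
  in some basis.\<close>

definition field_trace :: "complex set \<Rightarrow> complex \<Rightarrow> rat" where
  "field_trace K x = (let B = (SOME B. rat_basis K B) in \<Sum>b\<in>B. rat_representation B (x * b) b)"

text \<open>By flatness the tensor product of \<open>K\<close> with the reals embeds into that of the complex numbers
  with the reals; its image is the real span of the elements \<open>a \<otimes> 1\<close>.\<close>

definition real_extension :: "complex set \<Rightarrow> ctensor set" where
  "real_extension K = span ((\<lambda>a. tensor a 1) ` K)"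

text \<open>The real bilinear form on \<^term>\<open>real_extension K\<close> that extends
  \<open>(a, b) \<mapsto> field_trace K (a * cnj b)\<close>, computed on expansions
  \<open>x = (\<Sum>a. a \<otimes> f a)\<close> and \<open>y = (\<Sum>b. b \<otimes> g b)\<close> with \<open>a, b\<close> in \<open>K\<close>. The value does not depend
  on the expansions.\<close>

definition trace_form :: "complex set \<Rightarrow> ctensor \<Rightarrow> ctensor \<Rightarrow> real" where
  "trace_form K x y =
     (THE v. \<exists>A B f g. finite A \<and> A \<subseteq> K \<and> finite B \<and> B \<subseteq> K \<and>
        x = (\<Sum>a\<in>A. tensor a (f a)) \<and> y = (\<Sum>b\<in>B. tensor b (g b)) \<and>
        v = (\<Sum>a\<in>A. \<Sum>b\<in>B. f a * g b * of_rat (field_trace K (a * cnj b))))"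

definition integers_ring :: "complex set \<Rightarrow> complex ring" where
  "integers_ring K = \<lparr>carrier = {x \<in> K. algebraic_int x}, mult = (*), one = 1, zero = 0, add = (+)\<rparr>"

definition lies_over :: "complex set \<Rightarrow> nat \<Rightarrow> bool" where
  "lies_over P p \<longleftrightarrow> {k::int. of_int k \<in> P} = {k. int p dvd k}"


section \<open>Lattices obtained from codes\<close>

definition code_space :: "complex set \<Rightarrow> (ctensor \<times> ctensor) set" where
  "code_space K = real_extension K \<times> real_extension K"

definition code_form :: "complex set \<Rightarrow> ctensor \<times> ctensor \<Rightarrow> ctensor \<times> ctensor \<Rightarrow> real" where
  "code_form K x y = trace_form K (fst x) (fst y) + trace_form K (snd x) (snd y)"

definition lines :: "('a, 'b) ring_scheme \<Rightarrow> ('a \<times> 'a) set set" where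
  "lines F = {{(c \<otimes>\<^bsub>F\<^esub> v, c \<otimes>\<^bsub>F\<^esub> w) |c. c \<in> carrier F} |v w.
     v \<in> carrier F \<and> w \<in> carrier F \<and> (v, w) \<noteq> (\<zero>\<^bsub>F\<^esub>, \<zero>\<^bsub>F\<^esub>)}"

text \<open>The preimage of a code \<open>C\<close> under the reduction of both coordinates modulo \<open>P\<close>.\<close>

definition code_lattice ::
    "complex set \<Rightarrow> complex set \<Rightarrow> (complex set \<times> complex set) set \<Rightarrow> (ctensor \<times> ctensor) set" where
  "code_lattice K P C =
     (let R = integers_ring K
      in {(tensor x 1, tensor y 1) |x y.
           x \<in> carrier R \<and> y \<in> carrier R \<and> (P +>\<^bsub>R\<^esub> x, P +>\<^bsub>R\<^esub> y) \<in> C})"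

definition code_lattices :: "complex set \<Rightarrow> complex set \<Rightarrow> (ctensor \<times> ctensor) set set" where
  "code_lattices K P = code_lattice K P ` lines (integers_ring K Quot P)"

definition cyclotomic_field :: "nat \<Rightarrow> complex set" where
  "cyclotomic_field m =
     {poly (map_poly of_rat p) (cis (2 * pi / real m)) |p :: rat poly. True}"

end

theory Submission
  imports
    Defs
    "HOL-Real_Asymp.Real_Asymp"
    "HOL-Computational_Algebra.Fundamental_Theorem_Algebra"
begin

text \<open>Write \<open>d = \<phi>(m)\<close> and \<open>n = 2d\<close>. If \<open>r\<close> is smaller than \<open>q\<^bsup>1/d\<^esup>\<close>, no nonzero vector of norm at
  most \<open>r\<close> lies in \<open>\<PP>\<Lambda>\<^sub>0\<close>, so such a vector of \<open>\<Lambda>\<^sub>0\<close> lies in at most one \<open>\<Lambda>\<^sub>C\<close>; and the short vectors of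
  \<open>\<Lambda>\<^sub>C\<close> come in orbits of length \<open>m\<close> under the \<open>m\<close>-th roots of unity. Hence if \<open>\<Lambda>\<^sub>0\<close> has at most
  \<open>m q\<close> vectors of norm at most \<open>r\<close>, some \<open>\<Lambda>\<^sub>C\<close> has no nonzero one. The number of vectors is at most
  \<open>Vol(B(r + \<tau>)) / Vol(\<Lambda>\<^sub>0)\<close>, where \<open>\<tau>\<close> bounds the covering radius of \<open>\<Lambda>\<^sub>0\<close>, and the growth of \<open>q\<close> makes
  \<open>(r / (r + \<tau>))\<^sup>n\<close> tend to \<open>1\<close>. This gives the density \<open>(1 - o(1)) m / 2\<^sup>n\<close>.

  For the product \<open>m\<close> of the primes up to \<open>exp N\<close>, \<open>m / \<phi>(m)\<close> is compared with \<open>log log n\<close> by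
  Mertens' third theorem: the ratio comes arbitrarily close to \<open>exp \<gamma>\<close>, and \<open>exp \<gamma> / 2 > 0.89\<close>. Only
  infinitely many \<open>N\<close> are needed.

  The minimal norm of \<open>\<PP>\<close> is bounded by comparing the index of \<open>x\<^sup>k \<O>\<close> in \<open>\<O>\<close>, at least \<open>q\<^sup>k\<close> for
  \<open>x \<in> \<PP>\<close>, with the volume of a ball that covers modulo \<open>x\<^sup>k \<O>\<close>, and letting \<open>k\<close> grow.\<close>

section \<open>Mertens' third theorem in the limsup form\<close>

text \<open>Let s be the radius of the ball of volume m q Vol(Lambda_0). Passing from s to r = s -
  \<tau> costs a factor close to 1 only if d \<tau> is small against s. Here \<tau> = d / sqrt 2,
  and s is at least sqrt d / 3 times q^(1/(2d)), so what is needed is d^3 = o(q^(1/d)); this follows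
  from the growth hypothesis because d \<le> m.

  The discriminant of K never enters. Vol(Lambda_0) is only enclosed between the volumes of two
  balls: one of radius sqrt d / 3, since a nonzero integer of K has norm at least 1 in absolute
  value, and one of radius \<tau>, by rounding coefficients in the basis of powers of
  \<open>\<zeta>\<close>. The gap is a factor (9 d / 2)^d, which the size of q absorbs.

  The minimal norm of the prime ideal demands r^(2d) < q^2. With the upper bound for Vol(Lambda_0)
  this reduces to m (d^2 / 2)^d \<le> q. Primorials satisfy m \<le> 2 d^2, so d^3 \<le> q^(1/d) is
  enough once d \<ge> 2. The same inequality forces the dimensions to be unbounded.\<close>

lemma sum_completely_multiplicative_le_euler_product:
  fixes f :: "nat \<Rightarrow> real"
  assumes mult: "\<And>a b. a > 0 \<Longrightarrow> b > 0 \<Longrightarrow> f (a * b) = f a * f b"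
    and one: "f 1 = 1" and nonneg: "\<And>n. f n \<ge> 0"
    and less: "\<And>p. prime p \<Longrightarrow> f p < 1"
    and S: "finite S" "\<And>p. p \<in> S \<Longrightarrow> prime p"
    and A: "finite A" "\<And>n. n \<in> A \<Longrightarrow> n > 0 \<and> prime_factors n \<subseteq> S"
  shows "(\<Sum>n\<in>A. f n) \<le> (\<Prod>p\<in>S. 1 / (1 - f p))"
  using S A
proof (induction S arbitrary: A rule: finite_induct)
  case empty
  have "n = 1" if "n \<in> A" for n
    using empty.prems(3)[OF that] by (auto simp: prime_factorization_empty_iff)
  then have "A \<subseteq> {1}" by auto
  then show ?case using one by (auto simp: subset_singleton_iff)
next
  case (insert p S)
  have p: "prime p" using insert.prems by auto
  \<comment> \<open>Splitting n into its p-part and its p-free cofactor embeds \<open>A\<close> into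
    exponents times integers over \<open>S\<close>. The sum is then at most a truncated geometric
    series times a sum covered by the induction hypothesis.\<close>
  define g where "g n = (multiplicity p n, n div p ^ multiplicity p n)" for n
  define A' where "A' = snd ` g ` A"
  define J where "J = Max (insert 0 (fst ` g ` A))"
  have fA: "finite A'" using insert.prems by (auto simp: A'_def)
  have pf: "f (p ^ j) = f p ^ j" for j
    using mult[of p "p ^ _"] one prime_gt_0_nat[OF p] by (induction j) auto
  have dec: "n = p ^ fst (g n) * snd (g n)" if "n > 0" for n
    using that by (simp add: g_def multiplicity_dvd)
  have inj: "inj_on g A"
    using dec insert.prems(3) by (metis inj_onI)
  have "(\<Sum>n\<in>A. f n) = (\<Sum>(j, a)\<in>g ` A. f p ^ j * f a)"
    unfolding sum.reindex[OF inj] comp_def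
  proof (intro sum.cong refl)
    fix n assume "n \<in> A"
    then have "n > 0" using insert.prems by auto
    then have n: "n = p ^ fst (g n) * snd (g n)" by (rule dec)
    then have "snd (g n) > 0" using \<open>n > 0\<close> by (metis gr0I mult_0_right)
    then have "f n = f p ^ fst (g n) * f (snd (g n))"
      using n mult[of "p ^ fst (g n)" "snd (g n)"] pf prime_gt_0_nat[OF p] by simp
    then show "f n = (case g n of (j, a) \<Rightarrow> f p ^ j * f a)" by (simp add: case_prod_beta)
  qed
  also have "\<dots> \<le> (\<Sum>(j, a)\<in>{..J} \<times> A'. f p ^ j * f a)"
  proof (rule sum_mono2)
    show "g ` A \<subseteq> {..J} \<times> A'"
      using insert.prems by (force simp: J_def A'_def g_def image_image intro!: Max_ge)
  qed (use fA nonneg in auto)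
  also have "\<dots> = (\<Sum>j\<le>J. f p ^ j) * (\<Sum>a\<in>A'. f a)"
    by (simp add: sum_product sum.cartesian_product)
  also have "\<dots> \<le> (1 / (1 - f p)) * (\<Prod>p\<in>S. 1 / (1 - f p))"
  proof (intro mult_mono sum_nonneg)
    show "(\<Sum>j\<le>J. f p ^ j) \<le> 1 / (1 - f p)"
      using less[OF p] nonneg[of p]
      by (subst sum_gp0) (auto simp: divide_simps)
    show "(\<Sum>a\<in>A'. f a) \<le> (\<Prod>p\<in>S. 1 / (1 - f p))"
    proof (rule insert.IH)
      fix a assume "a \<in> A'"
      then obtain n where n: "n \<in> A" "a = n div p ^ multiplicity p n" by (auto simp: A'_def g_def)
      then have n0: "n > 0" "prime_factors n \<subseteq> insert p S" using insert.prems by auto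
      have a: "n = p ^ multiplicity p n * a" using n by (simp add: multiplicity_dvd)
      then have a0: "a > 0" using n0 by (metis gr0I mult_0_right)
      have "\<not> p dvd a" using multiplicity_decompose[of n p] n n0 p by (auto simp: prime_nat_iff)
      then have "p \<notin> prime_factors a" by (auto simp: in_prime_factors_iff)
      moreover have "prime_factors a \<subseteq> prime_factors n"
        using a n0 by (intro dvd_prime_factors) (auto intro: dvdI[of _ _ "p ^ multiplicity p n"] simp: mult.commute)
      ultimately show "a > 0 \<and> prime_factors a \<subseteq> S" using n0 a0 by auto
    qed (use insert fA in auto)
  qed (use less[OF p] nonneg in \<open>auto\<close>)
  also have "\<dots> = (\<Prod>p\<in>insert p S. 1 / (1 - f p))" using insert by simp
  finally show ?case .
qed

text \<open>Convexity of -ln (1 - x) along the chord from 0 to x. With x = 1/p and t = p^(-d) it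
  compares the logarithms of the Euler factors at the exponents 1 + d and 1.\<close>

lemma neg_ln_one_minus_mult_le:
  fixes x t :: real
  assumes "0 \<le> x" "x < 1" "0 \<le> t" "t \<le> 1"
  shows "- ln (1 - t * x) \<le> t * (- ln (1 - x))"
proof -
  have "t * ln (1 - x) + (1 - t) * ln 1 \<le> ln (t * (1 - x) + (1 - t) * 1)"
    using concave_onD[OF ln_concave, of "1-t" "1-x" 1] assms by (simp add: algebra_simps)
  then show ?thesis by (simp add: algebra_simps)
qed

text \<open>Comparison with the integral of x^(-1-s) from 1 to N + 1, interval by interval, by the
  mean value theorem for x^(-s).\<close>

lemma sum_powr_ge:
  fixes s :: real
  assumes "s > 0"
  shows "(\<Sum>n=1..N. real n powr (-1 - s)) \<ge> (1 - real (N + 1) powr (- s)) / s"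
proof -
  have step: "real n powr (-1 - s) \<ge> (real n powr (- s) - real (n + 1) powr (- s)) / s" if "n \<ge> 1" for n
  proof -
    have "\<exists>z>real n. z < real n + 1 \<and>
        (real n + 1) powr (- s) - real n powr (- s) = (real n + 1 - real n) * (- s * z powr (- s - 1))"
      using that by (intro MVT2) (auto intro!: derivative_eq_intros)
    then obtain z where z: "z > real n" "(real n + 1) powr (- s) - real n powr (- s) = - s * z powr (- s - 1)"
      by auto
    have zle: "z powr (- s - 1) \<le> real n powr (- s - 1)"
      using z that assms by (intro powr_mono2') auto
    have "real n powr (-s) - (real n + 1) powr (-s) \<le> s * real n powr (- s - 1)"
    proof -
      have "s * z powr (- s - 1) \<le> s * real n powr (- s - 1)"
        using zle assms by (intro mult_left_mono) auto
      then show ?thesis using z(2) by linarith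
    qed
    moreover have "- s - 1 = -1 - s" by simp
    ultimately show ?thesis using assms by (simp add: field_simps add.commute)
  qed
  have "(\<Sum>n=1..N. real n powr (-1 - s)) \<ge> (\<Sum>n=1..N. (real n powr (- s) - real (n + 1) powr (- s)) / s)"
    by (intro sum_mono step) auto
  also have "(\<Sum>n=1..N. (real n powr (- s) - real (n + 1) powr (- s)) / s) = (1 - real (N + 1) powr (- s)) / s"
    by (induction N) (auto simp: add_divide_distrib[symmetric] algebra_simps)
  finally show ?thesis .
qed

section \<open>Primes up to exp N, compared with the harmonic series\<close>

definition primes_exp :: "nat \<Rightarrow> nat set" where
  "primes_exp N = {p. prime p \<and> real p \<le> exp (real N)}"

text \<open>The logarithm of the product of the 1 / (1 - 1/p). With the cut-off at exp N, Mertens'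
  third theorem says that it grows like ln N + \<gamma>, that is, like
  \<open>harm N\<close>.\<close>

definition mertens_sum :: "nat \<Rightarrow> real" where
  "mertens_sum N = (\<Sum>p\<in>primes_exp N. - ln (1 - 1 / real p))"

lemma finite_primes_exp: "finite (primes_exp N)"
proof (rule finite_subset)
  show "primes_exp N \<subseteq> {..nat \<lfloor>exp (real N)\<rfloor>}"
    by (auto simp: primes_exp_def le_nat_floor)
qed simp

lemma primes_exp_0: "primes_exp 0 = {}"
  by (auto simp: primes_exp_def dest!: prime_gt_1_nat)

text \<open>For exp K < p \<le> exp (K + 1) the weight p^(-d) is at most exp (-d)^K. Writing it with
  the exponent K + 1 of its block costs the factor exp d, which tends to 1 as d -> 0.\<close>

lemma euler_product_le_weighted_mertens_sum:
  fixes d :: real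
  assumes d: "d > 0"
  shows "(\<Sum>p\<in>primes_exp K. - ln (1 - real p powr (-1 - d))) \<le>
    exp d * (\<Sum>k=1..K. (mertens_sum k - mertens_sum (k - 1)) * exp (- d) ^ k)"
proof (induction K)
  case 0
  then show ?case by (simp add: primes_exp_0)
next
  case (Suc K)
  define Q where "Q = primes_exp (Suc K) - primes_exp K"
  have Q: "primes_exp (Suc K) = primes_exp K \<union> Q" "primes_exp K \<inter> Q = {}" "finite Q"
  proof -
    have "exp (real K) \<le> exp (real (Suc K))" by simp
    then have "primes_exp K \<subseteq> primes_exp (Suc K)"
      unfolding primes_exp_def using order.trans by blast
    then show "primes_exp (Suc K) = primes_exp K \<union> Q" "primes_exp K \<inter> Q = {}" "finite Q"
      using finite_primes_exp[of "Suc K"] by (auto simp: Q_def)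
  qed
  have "- ln (1 - real p powr (-1 - d)) \<le> exp (- d * real K) * (- ln (1 - 1 / real p))" if "p \<in> Q" for p
  proof -
    have p: "real p > exp (real K)" "prime p" using that by (auto simp: Q_def primes_exp_def)
    have p1: "real p > 1" using prime_gt_1_nat[OF p(2)] by simp
    have "- ln (1 - real p powr (-1 - d)) = - ln (1 - real p powr (- d) * (1 / real p))"
      using p1 by (simp add: powr_diff powr_minus divide_inverse mult.commute)
    also have "\<dots> \<le> real p powr (- d) * (- ln (1 - 1 / real p))"
      using p1 d powr_mono[of "- d" 0 "real p"] by (intro neg_ln_one_minus_mult_le) auto
    also have "\<dots> \<le> exp (- d * real K) * (- ln (1 - 1 / real p))"
    proof (rule mult_right_mono)
      have "real p powr (- d) \<le> exp (real K) powr (- d)"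
        using p d by (intro powr_mono2') auto
      then show "real p powr (- d) \<le> exp (- d * real K)"
        by (simp add: powr_def)
      have "ln (1 - 1 / real p) \<le> ln 1" using p1 by (subst ln_le_cancel_iff) auto
      then show "0 \<le> - ln (1 - 1 / real p)" by simp
    qed
    finally show ?thesis .
  qed
  then have "(\<Sum>p\<in>Q. - ln (1 - real p powr (-1 - d))) \<le> (\<Sum>p\<in>Q. exp (- d * real K) * (- ln (1 - 1 / real p)))"
    by (rule sum_mono)
  also have "\<dots> = exp (- d * real K) * (mertens_sum (Suc K) - mertens_sum K)"
    using Q finite_primes_exp by (simp add: mertens_sum_def sum.union_disjoint sum_distrib_left)
  also have "exp (- d * real K) = exp d * exp (- d) ^ Suc K"
    by (simp add: exp_of_nat_mult[symmetric] flip: exp_add)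
  finally show ?case using Suc Q finite_primes_exp
    by (simp add: sum.union_disjoint algebra_simps)
qed

lemma abel_summation_powers:
  fixes g :: "nat \<Rightarrow> real"
  assumes "g 0 = 0"
  shows "(\<Sum>k=1..K. (g k - g (k - 1)) * y ^ k) = g K * y ^ K + (1 - y) * (\<Sum>k<K. g k * y ^ k)"
  using assms by (induction K) (auto simp: algebra_simps)

lemma harm_ge_ln_plus_euler_mascheroni:
  assumes "n > 0"
  shows "harm n \<ge> ln (real n) + euler_mascheroni"
proof -
  have "(\<lambda>k. harm (Suc k) - ln (real (Suc k))) \<longlonglongrightarrow> euler_mascheroni"
    using euler_mascheroni_LIMSEQ by (subst filterlim_sequentially_Suc)
  then show ?thesis
    using decseq_ge[OF decseq_harm_diff_ln, of euler_mascheroni "n - 1"] assms by simp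
qed

lemma sum_powers_over_le_ln:
  fixes y :: real
  assumes "0 \<le> y" "y < 1"
  shows "(\<Sum>k=1..K. y ^ k / real k) \<le> - ln (1 - y)"
proof -
  have "(\<lambda>n. - (y ^ n) / real n) sums ln (1 - y)"
    using ln_series'[of "-y"] assms by simp
  then have s: "(\<lambda>n. y ^ n / real n) sums (- ln (1 - y))"
    using sums_minus by fastforce
  have "(\<Sum>k=1..K. y ^ k / real k) \<le> suminf (\<lambda>k. y ^ k / real k)"
    using s assms by (intro sum_le_suminf) (auto simp: sums_iff)
  then show ?thesis using s by (simp add: sums_iff)
qed

text \<open>An Abelian argument: an upper
  bound \<open>ln N + c\<close> for the partial sums makes the weighted sums smaller than those of the
  harmonic series by \<open>\<gamma> - c\<close>, whereas both are equal to \<open>ln (1 / d) + o(1)\<close>.\<close>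

lemma mertens_sum_frequently_ge:
  assumes c: "c < (euler_mascheroni :: real)"
  shows "\<exists>N\<ge>N0. mertens_sum N \<ge> ln (real N) + c"
proof (rule ccontr)
  assume "\<not> ?thesis"
  then have less: "mertens_sum N < ln (real N) + c" if "N \<ge> N0" for N
    using that by force
  define N1 where "N1 = Suc N0"
  define \<eta> where "\<eta> = euler_mascheroni - c"
  have \<eta>: "\<eta> > 0" using c by (simp add: \<eta>_def)
  \<comment> \<open>The increments of \<open>harm\<close> contribute the sum of y^k / k, bounded by
    -ln (1 - y). What remains is \<open>g\<close>, which the assumption pushes below -\<eta> from
    \<open>N1\<close> on.\<close>
  define g where "g k = mertens_sum k - harm k" for k
  have g0: "g 0 = 0" by (simp add: g_def mertens_sum_def primes_exp_0 harm_def)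
  have g: "g k \<le> - \<eta>" if "k \<ge> N1" for k
    using less[of k] harm_ge_ln_plus_euler_mascheroni[of k] that by (simp add: g_def \<eta>_def N1_def)
  \<comment> \<open>Bounds the excess over -\<eta> of the finitely many k < N1. It enters with the
    factor 1 - y, hence disappears as d -> 0.\<close>
  define C where "C = (\<Sum>k<N1. \<bar>g k\<bar> + \<eta>)"
  have bound: "ln (1 / d) \<le> exp d * (- ln (1 - exp (- d)) - \<eta> + (1 - exp (- d)) * C)" if d: "d > 0" for d
  proof -
    define y where "y = exp (- d)"
    have y: "0 < y" "y < 1" using d by (auto simp: y_def)
    have main: "ln ((1 - y ^ K) / d) \<le> exp d * (- ln (1 - y) - \<eta> + (1 - y) * C)" if K: "K \<ge> N1" for K
    proof -
      have "(\<Sum>k<K. g k * y ^ k) \<le> (\<Sum>k<K. (- \<eta>) * y ^ k + (if k < N1 then \<bar>g k\<bar> + \<eta> else 0))"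
      proof (rule sum_mono)
        fix k
        have "(g k + \<eta>) * y ^ k \<le> (\<bar>g k\<bar> + \<eta>) * 1"
          using y \<eta> by (intro mult_mono power_le_one) auto
        moreover have "k \<ge> N1 \<Longrightarrow> g k * y ^ k \<le> - \<eta> * y ^ k"
          using g[of k] y by (intro mult_right_mono) auto
        ultimately show "g k * y ^ k \<le> (- \<eta>) * y ^ k + (if k < N1 then \<bar>g k\<bar> + \<eta> else 0)"
          by (auto simp: algebra_simps)
      qed
      also have "\<dots> = - \<eta> * (\<Sum>k<K. y ^ k) + (\<Sum>k<K. if k < N1 then \<bar>g k\<bar> + \<eta> else 0)"
        by (simp only: sum.distrib sum_distrib_left)
      also have "(\<Sum>k<K. if k < N1 then \<bar>g k\<bar> + \<eta> else 0) = (\<Sum>k\<in>{..<K} \<inter> {k. k < N1}. \<bar>g k\<bar> + \<eta>)"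
        by (subst sum.inter_restrict) auto
      also have "{..<K} \<inter> {k. k < N1} = {..<N1}" using K by auto
      also have "(\<Sum>k<N1. \<bar>g k\<bar> + \<eta>) = C" by (simp add: C_def)
      finally have "(1 - y) * (\<Sum>k<K. g k * y ^ k) \<le> (1 - y) * (- \<eta> * (\<Sum>k<K. y ^ k) + C)"
        using y by (intro mult_left_mono) auto
      also have "\<dots> = - \<eta> * ((1 - y) * (\<Sum>k<K. y ^ k)) + (1 - y) * C"
        by (simp add: algebra_simps)
      also have "\<dots> = - \<eta> * (1 - y ^ K) + (1 - y) * C"
        by (simp only: one_diff_power_eq)
      finally have 1: "(1 - y) * (\<Sum>k<K. g k * y ^ k) \<le> - \<eta> * (1 - y ^ K) + (1 - y) * C" .
      \<comment> \<open>The boundary term of the summation by parts supplies exactly the -\<eta> y^K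
        that the previous bound lacks.\<close>
      have "g K * y ^ K \<le> - \<eta> * y ^ K" using g[OF K] y by (intro mult_right_mono) auto
      with 1 have "(\<Sum>k=1..K. (g k - g (k - 1)) * y ^ k) \<le> - \<eta> + (1 - y) * C"
        unfolding abel_summation_powers[of g, OF g0] by (simp add: algebra_simps)
      moreover have "(\<Sum>k=1..K. (g k - g (k - 1)) * y ^ k) =
          (\<Sum>k=1..K. (mertens_sum k - mertens_sum (k - 1)) * y ^ k) - (\<Sum>k=1..K. y ^ k / real k)"
        unfolding sum_subtractf[symmetric]
      proof (rule sum.cong)
        fix k assume "k \<in> {1..K}"
        then obtain j where "k = Suc j" by (cases k) auto
        then show "(g k - g (k - 1)) * y ^ k = (mertens_sum k - mertens_sum (k - 1)) * y ^ k - y ^ k / real k"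
          by (simp add: g_def harm_Suc inverse_eq_divide algebra_simps)
      qed simp
      ultimately have w: "(\<Sum>k=1..K. (mertens_sum k - mertens_sum (k - 1)) * y ^ k) \<le> - ln (1 - y) - \<eta> + (1 - y) * C"
        using sum_powers_over_le_ln[of y K] y by simp
      \<comment> \<open>Integers up to exp K have all their prime factors in
        \<open>primes_exp K\<close>, and M + 1 \<ge> exp K makes the truncation term of
        \<open>sum_powr_ge\<close> at most y^K.\<close>
      define M where "M = nat \<lfloor>exp (real K)\<rfloor>"
      define f where "f n = real n powr (-1 - d)" for n
      have M: "real (M + 1) \<ge> exp (real K)" "real M \<le> exp (real K)"
        unfolding M_def by linarith (simp add: of_nat_floor)
      have K1: "K \<ge> 1" using K by (simp add: N1_def)
      have f1: "f p < 1" if "prime p" for p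
        using prime_gt_1_nat[OF that] d powr_less_mono[of "-1 - d" 0 "real p"] by (simp add: f_def)
      have "(1 - y ^ K) / d \<le> (1 - real (M + 1) powr (- d)) / d"
      proof -
        have "real (M + 1) powr (- d) \<le> exp (real K) powr (- d)"
          using M d by (intro powr_mono2') auto
        also have "\<dots> = y ^ K" by (simp add: y_def powr_def exp_of_nat_mult[symmetric] mult.commute)
        finally show ?thesis using d by (simp add: divide_right_mono)
      qed
      also have "\<dots> \<le> (\<Sum>n=1..M. f n)" unfolding f_def by (rule sum_powr_ge[OF d])
      also have "\<dots> \<le> (\<Prod>p\<in>primes_exp K. 1 / (1 - f p))"
      proof (rule sum_completely_multiplicative_le_euler_product)
        fix n assume n: "n \<in> {1..M}"
        have "p \<in> primes_exp K" if "p \<in> prime_factors n" for p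
        proof -
          have "prime p" "p \<le> n" using that n by (auto simp: in_prime_factors_iff dvd_imp_le)
          then show ?thesis using n M by (auto simp: primes_exp_def)
        qed
        then show "n > 0 \<and> prime_factors n \<subseteq> primes_exp K" using n by auto
      qed (use f1 finite_primes_exp in \<open>auto simp: f_def powr_mult\<close>, simp add: primes_exp_def)
      also have "\<dots> = exp (\<Sum>p\<in>primes_exp K. - ln (1 - f p))"
      proof -
        have "1 / (1 - f p) = exp (- ln (1 - f p))" if "p \<in> primes_exp K" for p
          using f1[of p] that by (simp add: exp_minus primes_exp_def divide_inverse)
        then show ?thesis by (simp add: exp_sum[OF finite_primes_exp])
      qed
      also have "\<dots> \<le> exp (exp d * (- ln (1 - y) - \<eta> + (1 - y) * C))"
      proof -
        have "(\<Sum>p\<in>primes_exp K. - ln (1 - f p)) \<le>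
            exp d * (\<Sum>k=1..K. (mertens_sum k - mertens_sum (k - 1)) * y ^ k)"
          using euler_product_le_weighted_mertens_sum[OF d, of K] by (simp add: f_def y_def)
        also have "\<dots> \<le> exp d * (- ln (1 - y) - \<eta> + (1 - y) * C)"
          by (intro mult_left_mono w) simp
        finally show ?thesis by simp
      qed
      finally have "(1 - y ^ K) / d \<le> exp (exp d * (- ln (1 - y) - \<eta> + (1 - y) * C))" .
      moreover have "(1 - y ^ K) / d > 0"
        using y K1 d power_Suc_less_one[of y "K - 1"] by simp
      ultimately show ?thesis by (metis ln_le_cancel_iff exp_gt_zero ln_exp)
    qed
    have "(\<lambda>K. ln ((1 - y ^ K) / d)) \<longlonglongrightarrow> ln ((1 - 0) / d)"
      using y d by (intro tendsto_intros LIMSEQ_power_zero) auto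
    then have "ln ((1 - 0) / d) \<le> exp d * (- ln (1 - y) - \<eta> + (1 - y) * C)"
      by (rule tendsto_upperbound) (use main in \<open>auto simp: eventually_sequentially\<close>)
    then show ?thesis by (simp add: y_def)
  qed
  \<comment> \<open>Since 1 - exp (-d) is asymptotic to d, the two logarithms cancel in
    \<open>u\<close>. In the limit d -> 0 the inequality \<open>bound\<close> reduces to 0 \<le>
    -\<eta>.\<close>
  define u :: "real \<Rightarrow> real" where "u d = exp d * (- ln (1 - exp (- d))) + ln d" for d
  have lim_u: "(u \<longlongrightarrow> 0) (at_right 0)" unfolding u_def by real_asymp
  have lim_v: "((\<lambda>d::real. exp d * (1 - exp (- d))) \<longlongrightarrow> 0) (at_right 0)" by real_asymp
  have lim_exp: "((\<lambda>d::real. exp d) \<longlongrightarrow> 1) (at_right 0)" by real_asymp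
  have "((\<lambda>d. u d - \<eta> * exp d + C * (exp d * (1 - exp (- d)))) \<longlongrightarrow> 0 - \<eta> * 1 + C * 0) (at_right 0)"
    by (intro tendsto_intros lim_u lim_v lim_exp)
  moreover have "0 \<le> u d - \<eta> * exp d + C * (exp d * (1 - exp (- d)))" if "d > 0" for d
    using bound[OF that] that by (simp add: u_def ln_div algebra_simps)
  ultimately have "- \<eta> \<ge> 0"
    by (intro tendsto_lowerbound[where F = "at_right (0::real)"])
      (auto intro!: eventually_at_rightI[of 0 1])
  then show False using \<eta> by simp
qed

section \<open>Primorials with small totient\<close>

lemma prod_primes_pos: "(\<And>p. p \<in> S \<Longrightarrow> prime p) \<Longrightarrow> 0 < \<Prod>(S::nat set)"
  by (rule prod_pos) (auto dest: prime_gt_0_nat)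

lemma totient_prod_primes:
  fixes S :: "nat set"
  assumes "finite S" "\<And>p. p \<in> S \<Longrightarrow> prime p"
  shows "totient (\<Prod>S) = (\<Prod>p\<in>S. p - 1)"
  using assms
proof (induction S rule: finite_induct)
  case (insert p S)
  have "coprime p (\<Prod>S)"
  proof (rule prod_coprime_right)
    fix r assume "r \<in> S"
    then show "coprime p r" using insert by (intro primes_coprime) auto
  qed
  then show ?case using insert by (simp add: totient_mult_coprime totient_prime)
qed simp

text \<open>Every prime p other than 2 satisfies p \<le> (p - 1)^2; the prime 2 accounts for the
  factor 2. The bound makes the totients of primorials unbounded and later keeps m below (2d)^d in
  the choice of the radius.\<close>

lemma prod_primes_le_totient_squared:
  fixes S :: "nat set"
  assumes "finite S" "\<And>p. p \<in> S \<Longrightarrow> prime p"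
  shows "\<Prod>S \<le> 2 * (totient (\<Prod>S))\<^sup>2"
proof -
  have "\<Prod>S \<le> (if 2 \<in> S then 2 else 1) * (\<Prod>p\<in>S. p - 1)\<^sup>2"
    using assms
  proof (induction S rule: finite_induct)
    case (insert p S)
    have "p \<ge> 2" using insert.prems by (auto intro: prime_ge_2_nat)
    show ?case
    proof (cases "p = 2")
      case True
      then show ?thesis using insert by simp
    next
      case False
      then obtain k where "p = k + 3" using \<open>p \<ge> 2\<close> by (metis add.commute le_Suc_ex le_antisym not_less_eq_eq numeral_2_eq_2 numeral_3_eq_3)
      then have "p \<le> (p - 1)\<^sup>2" by (simp add: power2_eq_square)
      then have "p * \<Prod>S \<le> (p - 1)\<^sup>2 * ((if 2 \<in> S then 2 else 1) * (\<Prod>p\<in>S. p - 1)\<^sup>2)"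
        using insert by (intro mult_le_mono) auto
      then show ?thesis using insert False by (simp add: power_mult_distrib mult_ac)
    qed
  qed simp
  also have "\<dots> \<le> 2 * (\<Prod>p\<in>S. p - 1)\<^sup>2" by simp
  finally show ?thesis using totient_prod_primes[OF assms] by simp
qed

lemma primorial_over_totient:
  "real (\<Prod>(primes_exp N)) / real (totient (\<Prod>(primes_exp N))) = exp (mertens_sum N)"
proof -
  have pr: "prime p" if "p \<in> primes_exp N" for p using that by (simp add: primes_exp_def)
  have "exp (mertens_sum N) = (\<Prod>p\<in>primes_exp N. exp (- ln (1 - 1 / real p)))"
    unfolding mertens_sum_def by (rule exp_sum[OF finite_primes_exp])
  also have "\<dots> = (\<Prod>p\<in>primes_exp N. real p / real (p - 1))"
  proof (intro prod.cong refl)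
    fix p assume "p \<in> primes_exp N"
    then have "p > 1" using pr prime_gt_1_nat by blast
    then show "exp (- ln (1 - 1 / real p)) = real p / real (p - 1)"
      by (simp add: exp_minus of_nat_diff field_simps)
  qed
  finally show ?thesis
    using pr by (simp add: prod_dividef totient_prod_primes finite_primes_exp)
qed

text \<open>At most exp N primes contribute at most N each. The factor N given away is harmless
  under the next logarithm: ln (N exp N) = N + ln N.\<close>

lemma ln_primorial_le: "ln (real (\<Prod>(primes_exp N))) \<le> real N * exp (real N)"
proof -
  have pr: "real p > 0" if "p \<in> primes_exp N" for p using that prime_gt_0_nat by (simp add: primes_exp_def)
  have "ln (real (\<Prod>(primes_exp N))) = (\<Sum>p\<in>primes_exp N. ln (real p))"
    using pr by (simp add: ln_prod finite_primes_exp)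
  also have "\<dots> \<le> (\<Sum>p\<in>primes_exp N. real N)"
  proof (rule sum_mono)
    fix p assume p: "p \<in> primes_exp N"
    then have "real p \<le> exp (real N)" by (simp add: primes_exp_def)
    then have "ln (real p) \<le> ln (exp (real N))" using pr[OF p] by (intro ln_mono) auto
    then show "ln (real p) \<le> real N" by simp
  qed
  also have "\<dots> = real (card (primes_exp N)) * real N" by simp
  also have "real (card (primes_exp N)) \<le> exp (real N)"
  proof -
    have "primes_exp N \<subseteq> {1..nat \<lfloor>exp (real N)\<rfloor>}"
      using prime_ge_1_nat by (auto simp: primes_exp_def le_nat_floor)
    then have "card (primes_exp N) \<le> card {1..nat \<lfloor>exp (real N)\<rfloor>}" by (intro card_mono) auto
    then have "card (primes_exp N) \<le> nat \<lfloor>exp (real N)\<rfloor>" by simp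
    then have "real (card (primes_exp N)) \<le> real (nat \<lfloor>exp (real N)\<rfloor>)" by (rule of_nat_mono)
    also have "\<dots> \<le> exp (real N)" by (rule of_nat_floor) simp
    finally show ?thesis .
  qed
  finally show ?thesis by (simp add: mult.commute mult_right_mono)
qed

text \<open>The goal requires 2 * 0.89 = 1.78, while exp \<gamma> = 1.78107...; the value 1.7801
  lies between and leaves some slack. The number 0.5768 separates ln 1.7801 = 0.57667... from
  \<gamma> = 0.57721.... The enclosure of \<gamma> is taken at 15 because ln 16 = 4 ln 2.\<close>

lemma euler_mascheroni_gt_ln: "euler_mascheroni > ln (1.7801 :: real)"
proof -
  have "ln (real (Suc 15)) = 4 * ln 2" using ln_realpow[of 2 4] by simp
  also have "\<dots> \<in> {4 * 0.693147 <..< 4 * (0.69315::real)}"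
    using ln_approx_bounds[of 2 6] by (simp add: eval_nat_numeral)
  finally have l: "ln (real (Suc 15)) \<in> {4 * 0.693147 <..< 4 * (0.69315::real)}" .
  have e: "euler_mascheroni > (0.5768 :: real)"
    using euler_mascheroni_bounds'[OF _ l] by (simp add: harm_expand)
  have "ln (1.7801 :: real) < 0.5768"
    using ln_approx_bounds[of "1.7801" 5] by (simp add: eval_nat_numeral)
  with e show ?thesis by simp
qed

text \<open>The witnesses are primorials, for which m / \<phi>(m) exceeds 1.7801 N infinitely often
  while ln ln (2 \<phi>(m)) is at most slightly more than N. The slack \<epsilon> is fixed before
  \<open>M\<close> because the density (1 - \<epsilon>) m / 2^n is only available for m large in
  terms of \<epsilon>.\<close>

lemma totient_frequently_small:
  "\<exists>\<epsilon>>0. \<forall>M. \<exists>m\<ge>M. M \<le> totient m \<and> m \<le> 2 * (totient m)\<^sup>2 \<and>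
     0.89 * real (2 * totient m) * ln (ln (real (2 * totient m))) \<le> (1 - \<epsilon>) * real m"
proof -
  define c :: real where "c = ln 1.7801"
  have c: "c < euler_mascheroni" "exp c = 1.7801" "c > 0"
    using euler_mascheroni_gt_ln by (auto simp: c_def)
  define \<epsilon> :: real where "\<epsilon> = 1 / 10 ^ 6"
  \<comment> \<open>Chosen so that 0.89 * 2 * k = (1 - \<epsilon>) * 1.7801. That k > 1 is the room
    for replacing ln (N exp N + 1) by k N.\<close>
  define k :: real where "k = (1 - \<epsilon>) * 1.7801 / 1.78"
  have k: "k > 1" by (simp add: k_def \<epsilon>_def)
  have "((\<lambda>N. ln (real N * exp (real N) + 1) / real N) \<longlongrightarrow> 1) at_top"
    by real_asymp
  then have "\<forall>\<^sub>F N in at_top. ln (real N * exp (real N) + 1) / real N < k"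
    using k by (rule order_tendstoD)
  then obtain N1 where N1: "ln (real N * exp (real N) + 1) / real N < k" if "N \<ge> N1" for N
    by (auto simp: eventually_at_top_linorder)
  have "\<exists>m\<ge>M. M \<le> totient m \<and> m \<le> 2 * (totient m)\<^sup>2 \<and>
     0.89 * real (2 * totient m) * ln (ln (real (2 * totient m))) \<le> (1 - \<epsilon>) * real m" for M
  proof -
    \<comment> \<open>The summand with the square of \<open>M\<close> serves to bound the totient: N
      \<le> m and m \<le> 2 \<phi>(m)^2 together give M \<le> \<phi>(m).\<close>
    obtain N where N: "N \<ge> N1 + 2 * M\<^sup>2 + M + 1" "mertens_sum N \<ge> ln (real N) + c"
      using mertens_sum_frequently_ge[OF c(1)] by blast
    define m where "m = \<Prod>(primes_exp N)"
    have pr: "prime p" if "p \<in> primes_exp N" for p using that by (simp add: primes_exp_def)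
    have m0: "m > 0" unfolding m_def using pr by (rule prod_primes_pos)
    have N0: "N > 0" using N by simp
    have t0: "totient m > 0" using m0 by simp
    have mt: "m \<le> 2 * (totient m)\<^sup>2"
      unfolding m_def by (rule prod_primes_le_totient_squared) (use pr finite_primes_exp in auto)
    have "exp (ln (real N) + c) \<le> exp (mertens_sum N)" using N by simp
    then have "real N * 1.7801 \<le> real m / real (totient m)"
      using N0 c unfolding m_def primorial_over_totient by (simp add: exp_add)
    then have ratio: "real N * 1.7801 * real (totient m) \<le> real m"
      using t0 by (simp add: field_simps)
    have t1: "real (totient m) \<ge> 1" using t0 by linarith
    then have "real N * 1 \<le> real N * (1.7801 * real (totient m))"
      by (intro mult_left_mono) auto
    then have mN: "m \<ge> N" using ratio by simp
    then have "2 * M\<^sup>2 \<le> 2 * (totient m)\<^sup>2" using N mt by linarith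
    then have tM: "M \<le> totient m" by (simp add: power2_nat_le_eq_le)
    have "ln (real (2 * totient m)) \<le> ln (real (2 * m))"
      using t0 totient_le[of m] by (intro ln_mono) auto
    also have "\<dots> = ln 2 + ln (real m)" using m0 by (simp add: ln_mult)
    also have "\<dots> \<le> 1 + real N * exp (real N)"
      using ln_primorial_le[of N] ln_2_less_1 by (simp add: m_def)
    finally have l1: "ln (real (2 * totient m)) \<le> real N * exp (real N) + 1" by simp
    have "ln (real (2 * totient m)) > 0" using t1 by (intro ln_gt_zero) simp
    then have "ln (ln (real (2 * totient m))) \<le> ln (real N * exp (real N) + 1)"
      using l1 by (intro ln_mono) auto
    also have "\<dots> \<le> k * real N"
      using N1[of N] N N0 by (simp add: field_simps)
    finally have "0.89 * real (2 * totient m) * ln (ln (real (2 * totient m))) \<le> 0.89 * real (2 * totient m) * (k * real N)"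
      by (intro mult_left_mono) auto
    also have "\<dots> = (1 - \<epsilon>) * (real N * 1.7801 * real (totient m))"
      by (simp add: k_def)
    also have "\<dots> \<le> (1 - \<epsilon>) * real m" using ratio by (intro mult_left_mono) (auto simp: \<epsilon>_def)
    finally show ?thesis using N mN tM mt by (intro exI[of _ m]) auto
  qed
  then show ?thesis by (intro exI[of _ \<epsilon>]) (simp add: \<epsilon>_def)
qed

section \<open>Lebesgue measure and lattices in a Euclidean subspace\<close>

locale euclidean_subspace =
  fixes V :: "'a::real_vector set" and ip :: "'a \<Rightarrow> 'a \<Rightarrow> real"
  assumes subspace_V: "subspace V"
    and finite_dim: "\<exists>B. finite B \<and> V = span B"
    and ip_add: "x \<in> V \<Longrightarrow> y \<in> V \<Longrightarrow> z \<in> V \<Longrightarrow> ip (x + y) z = ip x z + ip y z"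
    and ip_scaleR: "x \<in> V \<Longrightarrow> z \<in> V \<Longrightarrow> ip (r *\<^sub>R x) z = r * ip x z"
    and ip_commute: "x \<in> V \<Longrightarrow> y \<in> V \<Longrightarrow> ip x y = ip y x"
    and ip_pos: "x \<in> V \<Longrightarrow> x \<noteq> 0 \<Longrightarrow> ip x x > 0"
begin

lemma V_closed:
  "0 \<in> V"
  "x \<in> V \<Longrightarrow> y \<in> V \<Longrightarrow> x + y \<in> V"
  "x \<in> V \<Longrightarrow> y \<in> V \<Longrightarrow> x - y \<in> V"
  "x \<in> V \<Longrightarrow> - x \<in> V"
  "x \<in> V \<Longrightarrow> r *\<^sub>R x \<in> V"
  "(\<And>i. i \<in> I \<Longrightarrow> f i \<in> V) \<Longrightarrow> sum f I \<in> V"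
  using subspace_V
  by (auto intro: subspace_0 subspace_add subspace_diff subspace_neg subspace_scale subspace_sum)

lemma ip_zero: "z \<in> V \<Longrightarrow> ip 0 z = 0"
  using ip_scaleR[of 0 z 0] V_closed(1) by simp

lemma ip_sum: "(\<And>i. i \<in> I \<Longrightarrow> f i \<in> V) \<Longrightarrow> z \<in> V \<Longrightarrow> ip (sum f I) z = (\<Sum>i\<in>I. ip (f i) z)"
  by (induction I rule: infinite_finite_induct) (auto simp: ip_zero ip_add V_closed)

lemma ip_diff: "x \<in> V \<Longrightarrow> y \<in> V \<Longrightarrow> z \<in> V \<Longrightarrow> ip (x - y) z = ip x z - ip y z"
  using ip_add[of x "- y" z] ip_scaleR[of y z "-1"] V_closed by simp

section \<open>Orthonormal bases and coordinates\<close>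

lemma gram_schmidt:
  assumes "finite B" "independent B" "B \<subseteq> V"
  shows "\<exists>e :: nat \<Rightarrow> 'a. (\<forall>i<card B. e i \<in> V) \<and> span (e ` {..<card B}) = span B \<and>
    (\<forall>i<card B. \<forall>j<card B. ip (e i) (e j) = (if i = j then 1 else 0))"
  using assms
proof (induction B rule: finite_induct)
  case (insert b B)
  let ?k = "card B"
  have indep: "b \<notin> span B" "independent B" using insert by (auto simp: independent_insert)
  have "B \<subseteq> V" using insert.prems by auto
  from insert.IH[OF indep(2) this] obtain e :: "nat \<Rightarrow> 'a"
    where e': "(\<forall>i<?k. e i \<in> V) \<and> span (e ` {..<?k}) = span B \<and>
      (\<forall>i<?k. \<forall>j<?k. ip (e i) (e j) = (if i = j then 1 else 0))" ..
  then have e: "\<And>i. i < ?k \<Longrightarrow> e i \<in> V" "span (e ` {..<?k}) = span B"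
      "\<And>i j. i < ?k \<Longrightarrow> j < ?k \<Longrightarrow> ip (e i) (e j) = (if i = j then 1 else 0)" by auto
  define w where "w = (\<Sum>i<?k. ip b (e i) *\<^sub>R e i)"
  define u where "u = b - w"
  have bV: "b \<in> V" using insert by auto
  have wV: "w \<in> V" unfolding w_def using e by (intro V_closed) auto
  have uV: "u \<in> V" unfolding u_def using bV wV by (intro V_closed)
  have w: "w \<in> span B" unfolding w_def e(2)[symmetric] by (intro span_sum span_scale span_base) auto
  have u0: "u \<noteq> 0" using w indep(1) by (auto simp: u_def)
  define c where "c = 1 / sqrt (ip u u)"
  have c: "c \<noteq> 0" "c * (c * ip u u) = 1"
    using ip_pos[OF uV u0] by (auto simp: c_def field_simps)
  have orth: "ip u (e j) = 0" if "j < ?k" for j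
  proof -
    have "ip w (e j) = (\<Sum>i<?k. ip b (e i) * ip (e i) (e j))"
      unfolding w_def using e that by (subst ip_sum) (auto simp: V_closed ip_scaleR)
    also have "\<dots> = (\<Sum>i<?k. if i = j then ip b (e j) else 0)"
      using e that by (intro sum.cong) auto
    also have "\<dots> = ip b (e j)" using that by simp
    finally show ?thesis unfolding u_def using bV wV e that by (simp add: ip_diff)
  qed
  define e' where "e' = e(?k := c *\<^sub>R u)"
  have cuV: "c *\<^sub>R u \<in> V" using uV by (rule V_closed)
  have "span (e' ` {..<Suc ?k}) = span (insert (c *\<^sub>R u) (e ` {..<?k}))"
    by (auto simp: e'_def lessThan_Suc intro!: arg_cong[of _ _ span])
  also have "\<dots> = span (insert b B)"
    unfolding span_eq
  proof
    show "insert (c *\<^sub>R u) (e ` {..<?k}) \<subseteq> span (insert b B)"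
    proof -
      have sub: "span B \<subseteq> span (insert b B)" by (rule span_mono) auto
      have "e ` {..<?k} \<subseteq> span B" unfolding e(2)[symmetric] by (rule span_superset)
      moreover have "b \<in> span (insert b B)" by (rule span_base) simp
      then have "c *\<^sub>R u \<in> span (insert b B)"
        unfolding u_def using subsetD[OF sub w] by (intro span_scale span_diff)
      ultimately show ?thesis using sub by (metis insert_subset order.trans)
    qed
    show "insert b B \<subseteq> span (insert (c *\<^sub>R u) (e ` {..<?k}))"
    proof -
      have sub: "span B \<subseteq> span (insert (c *\<^sub>R u) (e ` {..<?k}))"
        unfolding e(2)[symmetric] by (rule span_mono) auto
      have "c *\<^sub>R u \<in> span (insert (c *\<^sub>R u) (e ` {..<?k}))" by (rule span_base) simp
      then have "(1 / c) *\<^sub>R (c *\<^sub>R u) + w \<in> span (insert (c *\<^sub>R u) (e ` {..<?k}))"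
        using subsetD[OF sub w] by (rule span_add[OF span_scale])
      moreover have "(1 / c) *\<^sub>R (c *\<^sub>R u) + w = b" using c by (simp add: u_def)
      ultimately show ?thesis using order.trans[OF span_superset sub] by simp
    qed
  qed
  finally have sp: "span (e' ` {..<Suc ?k}) = span (insert b B)" .
  have "ip (e' i) (e' j) = (if i = j then 1 else 0)" if "i < Suc ?k" "j < Suc ?k" for i j
  proof -
    have 1: "ip (c *\<^sub>R u) (e j) = 0" if "j < ?k" for j
      using that orth uV e by (simp add: ip_scaleR)
    have 2: "ip (e j) (c *\<^sub>R u) = 0" if "j < ?k" for j
      using that 1 ip_commute e cuV by metis
    have 3: "ip (c *\<^sub>R u) (c *\<^sub>R u) = 1"
      using c uV cuV ip_commute[of u "c *\<^sub>R u"] by (simp add: ip_scaleR)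
    show ?thesis using that e(3) 1 2 3 by (auto simp: e'_def less_Suc_eq)
  qed
  then show ?case using sp e cuV insert
    by (intro exI[of _ e']) (auto simp: e'_def less_Suc_eq)
qed simp

lemma dim_V_basis: "\<exists>B. finite B \<and> independent B \<and> span B = V \<and> B \<subseteq> V \<and> card B = dim V"
proof -
  obtain B0 where B0: "finite B0" "V = span B0" using finite_dim by blast
  obtain B where B: "B \<subseteq> V" "independent B" "V \<subseteq> span B" "card B = dim V" by (rule basis_exists)
  have "finite B" using independent_span_bound[OF B0(1) B(2)] B(1) B0(2) by auto
  moreover have "span B = V" using B subspace_V span_minimal by blast
  ultimately show ?thesis using B by blast
qed

lemma orthonormal_basis_exists: "\<exists>e. orthonormal_basis V ip e"
proof -
  obtain B where B: "finite B" "independent B" "span B = V" "B \<subseteq> V" "card B = dim V"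
    using dim_V_basis by blast
  then show ?thesis using gram_schmidt[of B] unfolding orthonormal_basis_def by metis
qed

text \<open>The very choice made inside \<open>euclid_lebesgue\<close>, so that \<open>vol\<close>
  is by definition the image of the coordinate measure under \<open>vec\<close>.\<close>

definition onb :: "nat \<Rightarrow> 'a" where "onb = (SOME e. orthonormal_basis V ip e)"

lemma orthonormal_onb: "orthonormal_basis V ip onb"
  unfolding onb_def using orthonormal_basis_exists by (rule someI_ex)

lemma span_onb: "span (onb ` {..<dim V}) = V"
  and ip_onb: "i < dim V \<Longrightarrow> j < dim V \<Longrightarrow> ip (onb i) (onb j) = (if i = j then 1 else 0)"
  using orthonormal_onb by (auto simp: orthonormal_basis_def)

lemma onb_in_V: "i < dim V \<Longrightarrow> onb i \<in> V"
  using span_base[of "onb i" "onb ` {..<dim V}"] span_onb by auto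

definition vec :: "(nat \<Rightarrow> real) \<Rightarrow> 'a" where "vec t = (\<Sum>i<dim V. t i *\<^sub>R onb i)"

lemma vec_in_V: "vec t \<in> V"
  unfolding vec_def by (intro V_closed onb_in_V) auto

lemma ip_vec_onb: "j < dim V \<Longrightarrow> ip (vec t) (onb j) = t j"
proof -
  assume j: "j < dim V"
  have "ip (vec t) (onb j) = (\<Sum>i<dim V. t i * ip (onb i) (onb j))"
    unfolding vec_def using j by (subst ip_sum) (auto simp: V_closed ip_scaleR onb_in_V)
  also have "\<dots> = (\<Sum>i<dim V. if i = j then t j else 0)"
    using j by (intro sum.cong) (auto simp: ip_onb)
  finally show ?thesis using j by simp
qed

lemma ip_vec_vec: "ip (vec t) (vec s) = (\<Sum>i<dim V. t i * s i)"
proof -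
  have "ip (vec t) (vec s) = (\<Sum>i<dim V. t i * ip (onb i) (vec s))"
    unfolding vec_def[of t] by (subst ip_sum) (auto simp: V_closed ip_scaleR onb_in_V vec_in_V)
  also have "\<dots> = (\<Sum>i<dim V. t i * s i)"
  proof (intro sum.cong refl)
    fix i assume "i \<in> {..<dim V}"
    then show "t i * ip (onb i) (vec s) = t i * s i"
      using ip_vec_onb[of i s] ip_commute[of "onb i" "vec s"] onb_in_V vec_in_V by simp
  qed
  finally show ?thesis .
qed

lemma vec_add: "vec (\<lambda>i. t i + s i) = vec t + vec s"
  by (simp add: vec_def sum.distrib scaleR_add_left)

lemma vec_scaleR: "vec (\<lambda>i. c * t i) = c *\<^sub>R vec t"
  by (simp add: vec_def scaleR_sum_right)

lemma vec_cong: "(\<And>i. i < dim V \<Longrightarrow> t i = s i) \<Longrightarrow> vec t = vec s"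
  by (simp add: vec_def)

lemma vec_eq_iff: "vec t = vec s \<longleftrightarrow> (\<forall>i<dim V. t i = s i)"
  using ip_vec_onb vec_cong by metis

lemma in_V_iff: "x \<in> V \<longleftrightarrow> (\<exists>t\<in>extensional {..<dim V}. x = vec t)"
proof
  assume "x \<in> V"
  have "\<exists>t. x = vec t"
  proof -
    have "x \<in> span (onb ` {..<dim V})" using \<open>x \<in> V\<close> span_onb by simp
    then show ?thesis
    proof (induction rule: span_induct_alt)
      case base
      show ?case by (rule exI[of _ "\<lambda>_. 0"]) (simp add: vec_def)
    next
      case (step c x y)
      then obtain t j where tj: "y = vec t" "x = onb j" "j < dim V" by auto
      have "c *\<^sub>R x = vec (\<lambda>i. if i = j then c else 0)"
        using tj by (simp add: vec_def if_distrib[of "\<lambda>c. c *\<^sub>R _"] cong: if_cong)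
      then show ?case using tj vec_add by metis
    qed
  qed
  then obtain t where "x = vec t" by blast
  then have "x = vec (restrict t {..<dim V})" by (auto intro: vec_cong)
  then show "\<exists>t\<in>extensional {..<dim V}. x = vec t" by blast
qed (auto simp: vec_in_V)

definition nrm :: "'a \<Rightarrow> real" where "nrm x = sqrt (ip x x)"

lemma nrm_vec: "nrm (vec t) = L2_set t {..<dim V}"
  by (simp add: nrm_def ip_vec_vec L2_set_def power2_eq_square)

lemma nrm_nonneg: "x \<in> V \<Longrightarrow> nrm x \<ge> 0"
  by (auto simp: in_V_iff nrm_vec L2_set_nonneg)

lemma nrm_triangle: "x \<in> V \<Longrightarrow> y \<in> V \<Longrightarrow> nrm (x + y) \<le> nrm x + nrm y"
  by (auto simp: in_V_iff nrm_vec L2_set_triangle_ineq simp flip: vec_add)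

lemma nrm_scaleR: "x \<in> V \<Longrightarrow> nrm (c *\<^sub>R x) = \<bar>c\<bar> * nrm x"
  by (auto simp: in_V_iff nrm_vec L2_set_right_distrib simp flip: vec_scaleR)
    (simp add: L2_set_def power_mult_distrib real_sqrt_mult flip: sum_distrib_left)

lemma nrm_minus: "x \<in> V \<Longrightarrow> nrm (- x) = nrm x"
  using nrm_scaleR[of x "-1"] by simp

lemma nrm_eq_0_iff: "x \<in> V \<Longrightarrow> nrm x = 0 \<longleftrightarrow> x = 0"
  using ip_pos[of x] ip_zero[of 0] V_closed(1) by (cases "x = 0") (auto simp: nrm_def)

lemma nrm_square: "x \<in> V \<Longrightarrow> (nrm x)\<^sup>2 = ip x x"
  using ip_pos[of x] ip_zero[of 0] V_closed(1) by (cases "x = 0") (auto simp: nrm_def)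

lemma ip_add_self:
  "x \<in> V \<Longrightarrow> y \<in> V \<Longrightarrow> ip (x + c *\<^sub>R y) (x + c *\<^sub>R y) = ip x x + 2 * c * ip x y + c\<^sup>2 * ip y y"
  using ip_commute[of x "x + c *\<^sub>R y"] ip_commute[of y "x + c *\<^sub>R y"] ip_commute[of y x]
  by (simp add: ip_add ip_scaleR V_closed power2_eq_square algebra_simps)

text \<open>Rounding the coefficients one by one, always choosing the better of the two neighbouring
  integers: the weighted mean of the two squared norms exceeds the previous one by
  \<open>f (1 - f) ip (b i) (b i)\<close>, where \<open>f\<close> is the fractional part.\<close>

lemma integer_rounding:
  assumes "finite I" "\<And>i. i \<in> I \<Longrightarrow> b i \<in> V"
  shows "\<exists>z :: 'i \<Rightarrow> int. (nrm ((\<Sum>i\<in>I. a i *\<^sub>R b i) - (\<Sum>i\<in>I. of_int (z i) *\<^sub>R b i)))\<^sup>2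
    \<le> (\<Sum>i\<in>I. ip (b i) (b i)) / 4"
  using assms
proof (induction I rule: finite_induct)
  case empty
  then show ?case using nrm_eq_0_iff V_closed(1) by simp
next
  case (insert j I)
  then obtain z :: "'i \<Rightarrow> int" where
    z: "(nrm ((\<Sum>i\<in>I. a i *\<^sub>R b i) - (\<Sum>i\<in>I. of_int (z i) *\<^sub>R b i)))\<^sup>2 \<le> (\<Sum>i\<in>I. ip (b i) (b i)) / 4"
    by auto
  define u where "u = (\<Sum>i\<in>I. a i *\<^sub>R b i) - (\<Sum>i\<in>I. of_int (z i) *\<^sub>R b i)"
  have uV: "u \<in> V" unfolding u_def using insert.prems by (intro V_closed) auto
  have bV: "b j \<in> V" using insert by auto
  define f where "f = frac (a j)"
  have f: "0 \<le> f" "f < 1" by (auto simp: f_def frac_lt_1)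
  define Q where "Q c = ip (u + c *\<^sub>R b j) (u + c *\<^sub>R b j)" for c
  have b0: "ip (b j) (b j) \<ge> 0" using nrm_square[OF bV] by (metis zero_le_power2)
  have "(1 - f) * Q f + f * Q (f - 1) = ip u u + f * (1 - f) * ip (b j) (b j)"
    unfolding Q_def ip_add_self[OF uV bV] by (simp add: power2_eq_square algebra_simps)
  also have "\<dots> \<le> ip u u + 1 / 4 * ip (b j) (b j)"
  proof -
    have "f * (1 - f) \<le> 1 / 4" using zero_le_power2[of "f - 1/2"] by (simp add: power2_eq_square algebra_simps)
    then show ?thesis using b0 by (intro add_left_mono mult_right_mono) auto
  qed
  finally have mean: "(1 - f) * Q f + f * Q (f - 1) \<le> ip u u + ip (b j) (b j) / 4" by simp
  have "\<exists>c\<in>{f, f - 1}. Q c \<le> ip u u + ip (b j) (b j) / 4"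
  proof (rule ccontr)
    assume "\<not> ?thesis"
    then have "Q f > ip u u + ip (b j) (b j) / 4" "Q (f - 1) > ip u u + ip (b j) (b j) / 4" by auto
    then have "(1 - f) * (ip u u + ip (b j) (b j) / 4) < (1 - f) * Q f"
      "f * (ip u u + ip (b j) (b j) / 4) \<le> f * Q (f - 1)"
      using f by (auto intro: mult_left_mono)
    moreover have "(1 - f) * K + f * K = K" for K :: real by (simp add: algebra_simps)
    ultimately show False using mean by smt
  qed
  moreover have "f = a j - of_int \<lfloor>a j\<rfloor>" "f - 1 = a j - of_int (\<lfloor>a j\<rfloor> + 1)"
    by (simp_all add: f_def frac_def)
  ultimately obtain k :: int where k: "Q (a j - of_int k) \<le> ip u u + ip (b j) (b j) / 4"
    by (metis insertE singletonD)
  have "(\<Sum>i\<in>insert j I. a i *\<^sub>R b i) - (\<Sum>i\<in>insert j I. of_int ((z(j := k)) i) *\<^sub>R b i) = u + (a j - of_int k) *\<^sub>R b j"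
    using insert by (simp add: u_def algebra_simps cong: sum.cong_simp)
      (intro sum.cong, auto)
  moreover have "(nrm (u + (a j - of_int k) *\<^sub>R b j))\<^sup>2 = Q (a j - of_int k)"
    unfolding Q_def by (intro nrm_square V_closed uV bV)
  moreover have "ip u u \<le> (\<Sum>i\<in>I. ip (b i) (b i)) / 4"
    using z nrm_square[OF uV] by (simp add: u_def)
  ultimately show ?case using k insert by (intro exI[of _ "z(j := k)"]) (simp add: add_divide_distrib)
qed

end

section \<open>Affine change of variables, balls and small cells\<close>

lemma emeasure_PiM_lborel_affine:
  fixes w :: "nat \<Rightarrow> real" and c :: real
  assumes c: "c \<noteq> 0" and I: "finite I" and A: "A \<in> sets (\<Pi>\<^sub>M i\<in>I. (lborel :: real measure))"
  defines "M \<equiv> \<Pi>\<^sub>M i\<in>I. (lborel :: real measure)"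
  defines "T \<equiv> \<lambda>t. \<lambda>i\<in>I. w i + c * t i"
  shows "T -` A \<inter> space M \<in> sets M"
    and "emeasure M A = ennreal (\<bar>c\<bar> ^ card I) * emeasure M (T -` A \<inter> space M)"
proof -
  interpret product_sigma_finite "\<lambda>_. lborel :: real measure" ..
  have T: "T \<in> measurable M M"
    unfolding T_def M_def by measurable
  then show "T -` A \<inter> space M \<in> sets M"
    using A unfolding M_def by (rule measurable_sets)
  have one: "emeasure lborel B = ennreal \<bar>c\<bar> * emeasure lborel ((\<lambda>x. d + c * x) -` B)"
    if "B \<in> sets borel" for B and d :: real
  proof -
    have "emeasure lborel B = emeasure (density (distr lborel borel (\<lambda>x. d + c * x)) (\<lambda>_. ennreal \<bar>c\<bar>)) B"
      using lborel_real_affine[OF c, of d] by simp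
    also have "\<dots> = ennreal \<bar>c\<bar> * emeasure (distr lborel borel (\<lambda>x. d + c * x)) B"
      using that by (subst emeasure_density_const) auto
    finally show ?thesis using that by (simp add: emeasure_distr)
  qed
  \<comment> \<open>Two measures on the product agree once they agree on boxes, and there everything
    splits into one-dimensional affine maps, each contributing one factor \<bar>c\<bar>.\<close>
  have "scale_measure (ennreal (\<bar>c\<bar> ^ card I)) (distr M M T) = Pi\<^sub>M I (\<lambda>_. lborel)"
  proof (rule PiM_eqI[OF I])
    show "sets (scale_measure (ennreal (\<bar>c\<bar> ^ card I)) (distr M M T)) = sets (Pi\<^sub>M I (\<lambda>_. lborel))"
      by (simp add: M_def)
    fix B :: "nat \<Rightarrow> real set" assume "\<And>i. i \<in> I \<Longrightarrow> B i \<in> sets lborel"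
    then have B: "\<And>i. i \<in> I \<Longrightarrow> B i \<in> sets borel" by simp
    have pre: "(\<lambda>x. w i + c * x) -` B i \<in> sets borel" if "i \<in> I" for i
    proof -
      have "(\<lambda>x. w i + c * x) -` B i \<inter> space borel \<in> sets borel"
        by (rule measurable_sets[OF _ B[OF that]]) measurable
      then show ?thesis by simp
    qed
    have BM: "Pi\<^sub>E I B \<in> sets M" unfolding M_def using I B by (intro sets_PiM_I_finite) auto
    have "T -` Pi\<^sub>E I B \<inter> space M = Pi\<^sub>E I (\<lambda>i. (\<lambda>x. w i + c * x) -` B i)"
      by (auto simp: T_def M_def space_PiM PiE_iff)
    then have "emeasure (distr M M T) (Pi\<^sub>E I B) = (\<Prod>i\<in>I. emeasure lborel ((\<lambda>x. w i + c * x) -` B i))"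
      using pre by (simp add: emeasure_distr[OF T BM]) (simp add: M_def emeasure_PiM[OF I])
    moreover have "(\<Prod>i\<in>I. emeasure lborel (B i)) = (\<Prod>i\<in>I. ennreal \<bar>c\<bar> * emeasure lborel ((\<lambda>x. w i + c * x) -` B i))"
      by (intro prod.cong refl one B)
    ultimately show "emeasure (scale_measure (ennreal (\<bar>c\<bar> ^ card I)) (distr M M T)) (Pi\<^sub>E I B) = (\<Prod>i\<in>I. emeasure lborel (B i))"
      by (simp add: prod.distrib ennreal_power[symmetric])
  qed
  then have "emeasure M A = emeasure (scale_measure (ennreal (\<bar>c\<bar> ^ card I)) (distr M M T)) A"
    by (simp add: M_def)
  then show "emeasure M A = ennreal (\<bar>c\<bar> ^ card I) * emeasure M (T -` A \<inter> space M)"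
    using A emeasure_distr[OF T, of A] by (simp add: M_def)
qed

context euclidean_subspace
begin

abbreviation coord_measure :: "(nat \<Rightarrow> real) measure" where
  "coord_measure \<equiv> \<Pi>\<^sub>M i\<in>{..<dim V}. (lborel :: real measure)"

abbreviation vol :: "'a measure" where "vol \<equiv> euclid_lebesgue V ip"

lemma vol_eq: "vol = embed_measure coord_measure vec"
  by (simp add: euclid_lebesgue_def onb_def vec_def[abs_def])

lemma space_coord: "space coord_measure = extensional {..<dim V}"
  by (auto simp: space_PiM PiE_def)

lemma inj_vec: "inj_on vec (space coord_measure)"
  by (auto simp: space_coord inj_on_def vec_eq_iff intro: extensionalityI)

lemma vec_extensional_eq_iff:
  "t \<in> extensional {..<dim V} \<Longrightarrow> s \<in> extensional {..<dim V} \<Longrightarrow> vec t = vec s \<longleftrightarrow> t = s"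
  using inj_vec by (auto simp: space_coord inj_on_def)

lemma space_vol: "space vol = V"
  unfolding vol_eq space_embed_measure space_coord using in_V_iff by auto

lemma sets_vol: "sets vol = {vec ` A |A. A \<in> sets coord_measure}"
  unfolding vol_eq by (rule sets_embed_measure'[OF inj_vec])

lemma sets_vol_I: "A \<in> sets coord_measure \<Longrightarrow> vec ` A \<in> sets vol"
  by (auto simp: sets_vol)

lemma emeasure_vol: "A \<in> sets coord_measure \<Longrightarrow> emeasure vol (vec ` A) = emeasure coord_measure A"
  unfolding vol_eq by (rule emeasure_embed_measure_image'[OF inj_vec])

lemma sets_vol_subset: "A \<in> sets vol \<Longrightarrow> A \<subseteq> V"
  using sets.sets_into_space space_vol by blast

lemma vol_affine:
  assumes A: "A \<in> sets vol" and v: "v \<in> V" and c: "c \<noteq> 0"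
  shows "{x \<in> V. v + c *\<^sub>R x \<in> A} \<in> sets vol"
    and "emeasure vol A = ennreal (\<bar>c\<bar> ^ dim V) * emeasure vol {x \<in> V. v + c *\<^sub>R x \<in> A}"
proof -
  obtain A' where A': "A' \<in> sets coord_measure" "A = vec ` A'" using A sets_vol by auto
  have A'e: "A' \<subseteq> extensional {..<dim V}" using sets.sets_into_space[OF A'(1)] space_coord by simp
  obtain w where w: "v = vec w" using v in_V_iff by auto
  define T where "T t = (\<lambda>i\<in>{..<dim V}. w i + c * t i)" for t
  have T: "vec (T t) = v + c *\<^sub>R vec t" for t
    unfolding w vec_scaleR[symmetric] vec_add[symmetric] by (intro vec_cong) (simp add: T_def)
  have Te: "T t \<in> extensional {..<dim V}" for t by (simp add: T_def)
  have eq: "{x \<in> V. v + c *\<^sub>R x \<in> A} = vec ` (T -` A' \<inter> space coord_measure)"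
  proof (intro equalityI subsetI)
    fix x assume "x \<in> {x \<in> V. v + c *\<^sub>R x \<in> A}"
    then obtain t s where t: "t \<in> extensional {..<dim V}" "x = vec t" and s: "s \<in> A'" "v + c *\<^sub>R x = vec s"
      using in_V_iff A' by auto
    then have "vec (T t) = vec s" using T by simp
    then have "T t = s" using Te s A'e vec_extensional_eq_iff by auto
    then show "x \<in> vec ` (T -` A' \<inter> space coord_measure)" using t s space_coord by auto
  next
    fix x assume "x \<in> vec ` (T -` A' \<inter> space coord_measure)"
    then obtain t where "x = vec t" "T t \<in> A'" by auto
    moreover from this have "v + c *\<^sub>R x \<in> A" using T[of t] A'(2) by (metis imageI)
    ultimately show "x \<in> {x \<in> V. v + c *\<^sub>R x \<in> A}" using vec_in_V by auto
  qed
  note aff = emeasure_PiM_lborel_affine[OF c finite_lessThan A'(1), of w, folded T_def[abs_def]]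
  show "{x \<in> V. v + c *\<^sub>R x \<in> A} \<in> sets vol"
    unfolding eq using aff(1) by (rule sets_vol_I)
  show "emeasure vol A = ennreal (\<bar>c\<bar> ^ dim V) * emeasure vol {x \<in> V. v + c *\<^sub>R x \<in> A}"
    unfolding eq using aff A'(1) by (simp add: A'(2) emeasure_vol)
qed

lemma vol_translate:
  assumes "A \<in> sets vol" "v \<in> V"
  shows "{x \<in> V. x + v \<in> A} \<in> sets vol" "emeasure vol {x \<in> V. x + v \<in> A} = emeasure vol A"
  using vol_affine[OF assms, of 1] by (simp_all add: add.commute)

abbreviation cb :: "real \<Rightarrow> 'a set" where "cb \<equiv> euclid_cball V ip"

lemma cb_iff: "x \<in> cb r \<longleftrightarrow> x \<in> V \<and> nrm x \<le> r"
  by (simp add: euclid_cball_def nrm_def)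

lemma cb_eq: "cb r = vec ` {t \<in> space coord_measure. L2_set t {..<dim V} \<le> r}"
  by (auto simp: set_eq_iff cb_iff image_iff space_coord in_V_iff nrm_vec)

lemma sets_coord_ball: "{t \<in> space coord_measure. L2_set t {..<dim V} \<le> r} \<in> sets coord_measure"
  unfolding L2_set_def by measurable

lemma sets_cb: "cb r \<in> sets vol"
  unfolding cb_eq by (intro sets_vol_I sets_coord_ball)

lemma emeasure_box:
  assumes "\<And>i. i < dim V \<Longrightarrow> a i \<le> b i"
  shows "emeasure coord_measure (\<Pi>\<^sub>E i\<in>{..<dim V}. {a i..b i}) = ennreal (\<Prod>i<dim V. b i - a i)"
proof -
  interpret product_sigma_finite "\<lambda>_. lborel :: real measure" ..
  have "(\<Prod>i<dim V. ennreal (b i - a i)) = ennreal (\<Prod>i<dim V. b i - a i)"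
    using assms by (intro prod_ennreal) auto
  then show ?thesis using assms by (subst emeasure_PiM) auto
qed

lemma emeasure_cb_finite: "emeasure vol (cb r) < \<infinity>"
proof -
  let ?A = "{t \<in> space coord_measure. L2_set t {..<dim V} \<le> r}"
  have sub: "?A \<subseteq> (\<Pi>\<^sub>E i\<in>{..<dim V}. {- \<bar>r\<bar>..\<bar>r\<bar>})"
  proof
    fix t assume t: "t \<in> ?A"
    have "\<bar>t i\<bar> \<le> \<bar>r\<bar>" if "i < dim V" for i
      using member_le_L2_set[of "{..<dim V}" i "\<lambda>i. \<bar>t i\<bar>"] that t
      by (auto simp: L2_set_def)
    then show "t \<in> (\<Pi>\<^sub>E i\<in>{..<dim V}. {- \<bar>r\<bar>..\<bar>r\<bar>})" using t by (auto simp: space_coord PiE_def abs_le_iff)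
      (metis abs_le_iff minus_le_iff)
  qed
  have "emeasure vol (cb r) = emeasure coord_measure ?A"
    unfolding cb_eq by (rule emeasure_vol[OF sets_coord_ball])
  also have "\<dots> \<le> emeasure coord_measure (\<Pi>\<^sub>E i\<in>{..<dim V}. {- \<bar>r\<bar>..\<bar>r\<bar>})"
    by (intro emeasure_mono sub sets_PiM_I_finite) auto
  also have "\<dots> < \<infinity>" by (subst emeasure_box) auto
  finally show ?thesis .
qed

lemma emeasure_cb_pos:
  assumes "r > 0"
  shows "emeasure vol (cb r) > 0"
proof -
  \<comment> \<open>The cube of half side \<open>d\<close> lies in the ball because the Euclidean
    norm is at most the sum of the absolute coordinates. The + 1 keeps \<open>d\<close> meaningful
    and positive in dimension 0.\<close>
  define d where "d = r / (real (dim V) + 1)"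
  have d: "d > 0" using assms by (simp add: d_def)
  have sub: "(\<Pi>\<^sub>E i\<in>{..<dim V}. {- d..d}) \<subseteq> {t \<in> space coord_measure. L2_set t {..<dim V} \<le> r}"
  proof
    fix t assume t: "t \<in> (\<Pi>\<^sub>E i\<in>{..<dim V}. {- d..d})"
    have "L2_set t {..<dim V} \<le> (\<Sum>i<dim V. \<bar>t i\<bar>)" by (rule L2_set_le_sum_abs)
    also have "\<dots> \<le> (\<Sum>i<dim V. d)"
    proof (rule sum_mono)
      fix i assume "i \<in> {..<dim V}"
      then have "t i \<in> {- d..d}" using t by (auto simp: PiE_iff)
      then show "\<bar>t i\<bar> \<le> d" by auto
    qed
    also have "\<dots> = real (dim V) * d" by simp
    also have "\<dots> \<le> r" using assms by (simp add: d_def field_simps)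
    finally show "t \<in> {t \<in> space coord_measure. L2_set t {..<dim V} \<le> r}"
      using t by (auto simp: space_coord PiE_def)
  qed
  have "0 < emeasure coord_measure (\<Pi>\<^sub>E i\<in>{..<dim V}. {- d..d})"
    using d by (subst emeasure_box) (auto simp: prod_pos)
  also have "\<dots> \<le> emeasure coord_measure {t \<in> space coord_measure. L2_set t {..<dim V} \<le> r}"
    by (intro emeasure_mono sub sets_coord_ball)
  also have "\<dots> = emeasure vol (cb r)"
    unfolding cb_eq by (rule emeasure_vol[OF sets_coord_ball, symmetric])
  finally show ?thesis .
qed

definition unit_ball_vol :: real where "unit_ball_vol = measure vol (cb 1)"

lemma unit_ball_vol_pos: "unit_ball_vol > 0"
  unfolding unit_ball_vol_def
  using emeasure_cb_pos[of 1] emeasure_cb_finite[of 1] by (simp add: measure_def enn2real_positive_iff)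

lemma emeasure_cb:
  assumes "r > 0"
  shows "emeasure vol (cb r) = ennreal (unit_ball_vol * r ^ dim V)"
proof -
  have "{x \<in> V. 0 + (1 / r) *\<^sub>R x \<in> cb 1} = cb r"
    using assms by (auto simp: cb_iff nrm_scaleR V_closed field_simps)
  then have "emeasure vol (cb 1) = ennreal ((1 / r) ^ dim V) * emeasure vol (cb r)"
    using vol_affine(2)[OF sets_cb V_closed(1), of "1 / r" 1] assms by simp
  moreover have "emeasure vol (cb 1) = ennreal unit_ball_vol"
    using emeasure_cb_finite[of 1] by (simp add: unit_ball_vol_def emeasure_eq_ennreal_measure less_top)
  ultimately have "ennreal (r ^ dim V) * ennreal unit_ball_vol =
      ennreal (r ^ dim V) * ennreal ((1 / r) ^ dim V) * emeasure vol (cb r)"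
    by (simp add: mult.assoc)
  also have "ennreal (r ^ dim V) * ennreal ((1 / r) ^ dim V) = 1"
    using assms by (simp add: ennreal_mult[symmetric] power_mult_distrib[symmetric])
  finally show ?thesis
    using assms unit_ball_vol_pos by (simp add: ennreal_mult[symmetric] mult.commute less_imp_le)
qed

lemma measure_cb: "r > 0 \<Longrightarrow> measure vol (cb r) = unit_ball_vol * r ^ dim V"
  using emeasure_cb[of r] unit_ball_vol_pos by (simp add: measure_def)

text \<open>A countable grid of half-open cubes. With \<epsilon> a lower bound for the nonzero norms
  of a lattice, no cell contains two distinct points of the same orbit.\<close>

lemma small_cover:
  assumes \<epsilon>: "\<epsilon> > 0"
  shows "\<exists>C :: nat \<Rightarrow> 'a set. (\<forall>i. C i \<in> sets vol) \<and> (\<Union>i. C i) = V \<and>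
    (\<forall>i. \<forall>x\<in>C i. \<forall>y\<in>C i. nrm (x - y) < \<epsilon>)"
proof -
  \<comment> \<open>The + 1 turns dim V * d \<le> \<epsilon> into a strict inequality.\<close>
  define d where "d = \<epsilon> / (real (dim V) + 1)"
  have d: "d > 0" using \<epsilon> by (simp add: d_def)
  let ?I = "{..<dim V}"
  define box where "box k = vec ` (\<Pi>\<^sub>E i\<in>?I. {of_int (k i) * d..<(of_int (k i) + 1) * d})" for k :: "nat \<Rightarrow> int"
  have countable: "countable (?I \<rightarrow>\<^sub>E (UNIV :: int set))" by (intro countable_PiE) auto
  have ne: "?I \<rightarrow>\<^sub>E (UNIV :: int set) \<noteq> {}" by (simp add: PiE_eq_empty_iff)
  define C where "C i = box (from_nat_into (?I \<rightarrow>\<^sub>E (UNIV :: int set)) i)" for i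
  have range: "range (from_nat_into (?I \<rightarrow>\<^sub>E (UNIV :: int set))) = ?I \<rightarrow>\<^sub>E UNIV"
    using ne countable by (rule range_from_nat_into)
  have box_sets: "box k \<in> sets vol" for k
    unfolding box_def by (intro sets_vol_I sets_PiM_I_finite) auto
  have "(\<Union>i. C i) = V"
  proof (intro equalityI subsetI)
    fix x assume "x \<in> V"
    then obtain t where t: "t \<in> extensional ?I" "x = vec t" using in_V_iff by auto
    define k where "k = (\<lambda>i\<in>?I. \<lfloor>t i / d\<rfloor>)"
    have "t i \<in> {of_int (k i) * d..<(of_int (k i) + 1) * d}" if "i < dim V" for i
    proof -
      have "of_int \<lfloor>t i / d\<rfloor> * d \<le> t i" using d by (simp add: pos_le_divide_eq[symmetric])
      moreover have "t i < (of_int \<lfloor>t i / d\<rfloor> + 1) * d"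
        unfolding pos_divide_less_eq[OF d, symmetric] by linarith
      ultimately show ?thesis using that by (simp add: k_def)
    qed
    then have "x \<in> box k" unfolding box_def t(2) using t(1) by (intro imageI) (auto simp: PiE_def)
    moreover have "k \<in> ?I \<rightarrow>\<^sub>E UNIV" by (simp add: k_def)
    then obtain i where "k = from_nat_into (?I \<rightarrow>\<^sub>E (UNIV :: int set)) i" using range by (metis imageE)
    ultimately show "x \<in> (\<Union>i. C i)" by (auto simp: C_def)
  next
    fix x assume "x \<in> (\<Union>i. C i)"
    then show "x \<in> V" using vec_in_V by (auto simp: C_def box_def)
  qed
  moreover have "nrm (x - y) < \<epsilon>" if xy: "x \<in> box k" "y \<in> box k" for x y k
  proof -
    obtain t s where t: "x = vec t" "\<And>i. i < dim V \<Longrightarrow> t i \<in> {of_int (k i) * d..<(of_int (k i) + 1) * d}"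
      and s: "y = vec s" "\<And>i. i < dim V \<Longrightarrow> s i \<in> {of_int (k i) * d..<(of_int (k i) + 1) * d}"
    proof -
      obtain t s where "t \<in> (\<Pi>\<^sub>E i\<in>?I. {of_int (k i) * d..<(of_int (k i) + 1) * d})" "x = vec t"
        "s \<in> (\<Pi>\<^sub>E i\<in>?I. {of_int (k i) * d..<(of_int (k i) + 1) * d})" "y = vec s"
        using xy unfolding box_def by blast
      then show thesis using that[of t s] by (simp add: PiE_iff)
    qed
    have "x - y = vec (\<lambda>i. t i - s i)"
      unfolding t s by (simp add: vec_def scaleR_diff_left sum_subtractf)
    then have "nrm (x - y) = L2_set (\<lambda>i. t i - s i) ?I" by (simp add: nrm_vec)
    also have "\<dots> \<le> (\<Sum>i<dim V. \<bar>t i - s i\<bar>)" by (rule L2_set_le_sum_abs)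
    also have "\<dots> \<le> (\<Sum>i<dim V. d)"
    proof (rule sum_mono)
      fix i assume "i \<in> ?I"
      then have "t i \<in> {of_int (k i) * d..<of_int (k i) * d + d}" "s i \<in> {of_int (k i) * d..<of_int (k i) * d + d}"
        using t(2)[of i] s(2)[of i] by (auto simp: distrib_right)
      then show "\<bar>t i - s i\<bar> \<le> d" by auto
    qed
    also have "\<dots> < \<epsilon>" using \<epsilon> by (simp add: d_def field_simps)
    finally show ?thesis .
  qed
  ultimately show ?thesis using box_sets by (intro exI[of _ C]) (auto simp: C_def)
qed

end

section \<open>Lattices, fundamental regions and covolumes\<close>

locale lattice_in = euclidean_subspace +
  fixes L :: "'a set"
  assumes L_subset: "L \<subseteq> V" and L_0: "0 \<in> L"
    and L_diff: "x \<in> L \<Longrightarrow> y \<in> L \<Longrightarrow> x - y \<in> L"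
    and L_countable: "countable L"
    and L_discrete: "\<exists>\<epsilon>>0. \<forall>x\<in>L. x \<noteq> 0 \<longrightarrow> \<epsilon> \<le> nrm x"
begin

lemma L_minus: "x \<in> L \<Longrightarrow> - x \<in> L"
  using L_diff[of 0 x] L_0 by simp

lemma L_in_V: "x \<in> L \<Longrightarrow> x \<in> V" using L_subset by auto

text \<open>Greedy choice over small cells: \<open>S j\<close> is the union of the orbits meeting
  \<open>C j\<close>, and \<open>R\<close> keeps from each cell only points whose orbits met no
  earlier cell. An orbit is thus represented in the first cell it meets, and only once there because
  the cell is smaller than the shortest nonzero lattice vector.\<close>

lemma fundamental_region_exists: "\<exists>R. fundamental_region V ip L R"
proof -
  obtain \<epsilon> where \<epsilon>: "\<epsilon> > 0" "\<And>x. x \<in> L \<Longrightarrow> x \<noteq> 0 \<Longrightarrow> \<epsilon> \<le> nrm x" using L_discrete by blast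
  obtain C :: "nat \<Rightarrow> 'a set" where C: "\<And>i. C i \<in> sets vol" "(\<Union>i. C i) = V"
    "\<And>i x y. x \<in> C i \<Longrightarrow> y \<in> C i \<Longrightarrow> nrm (x - y) < \<epsilon>"
    using small_cover[OF \<epsilon>(1)] by blast
  define S where "S j = (\<Union>l\<in>L. {x \<in> V. x + l \<in> C j})" for j
  have S_sets: "S j \<in> sets vol" for j
    unfolding S_def using L_countable vol_translate(1)[OF C(1)] L_in_V by (intro sets.countable_UN') auto
  define R where "R = (\<Union>i. C i - (\<Union>j<i. S j))"
  have R_sets: "R \<in> sets vol" unfolding R_def using C(1) S_sets by auto
  have S_inv: "x + l \<in> S j" if "x \<in> S j" "l \<in> L" for x l j
  proof -
    have "\<exists>k\<in>L. x \<in> V \<and> x + k \<in> C j" using that by (auto simp: S_def)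
    then obtain k where "k \<in> L" "x \<in> V" "x + k \<in> C j" by blast
    then have "x + l + (k - l) \<in> C j" "k - l \<in> L" "x + l \<in> V"
      using that L_diff L_in_V V_closed(2) by auto
    then show ?thesis unfolding S_def by blast
  qed
  have "\<exists>!l. l \<in> L \<and> x - l \<in> R" if x: "x \<in> V" for x
  proof -
    have "\<exists>i. x \<in> S i"
    proof -
      obtain i where "x \<in> C i" using x C(2) by blast
      then have "x \<in> S i" using L_0 x by (auto simp: S_def intro!: bexI[of _ 0])
      then show ?thesis ..
    qed
    define i where "i = (LEAST i. x \<in> S i)"
    have i: "x \<in> S i" unfolding i_def using \<open>\<exists>i. x \<in> S i\<close> by (rule LeastI_ex)
    have i_min: "x \<notin> S j" if "j < i" for j using that not_less_Least unfolding i_def by blast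
    have iff: "x - l \<in> R \<longleftrightarrow> x - l \<in> C i" if l: "l \<in> L" for l
    proof
      assume "x - l \<in> C i"
      moreover have "x - l \<notin> S j" if "j < i" for j
        using S_inv[of "x - l" j l] i_min[OF that] l by auto
      ultimately show "x - l \<in> R" by (auto simp: R_def)
    next
      assume "x - l \<in> R"
      then obtain k where k: "x - l \<in> C k" "\<And>j. j < k \<Longrightarrow> x - l \<notin> S j" by (auto simp: R_def)
      have "x - l \<in> V" using x l L_in_V V_closed by auto
      then have "x - l \<in> S k" using k(1) L_0 by (auto simp: S_def intro!: bexI[of _ 0])
      then have "x \<in> S k" using S_inv[of "x - l" k l] l by simp
      then have "\<not> k < i" using i_min by blast
      moreover have "x - l \<in> S i" using S_inv[OF i L_minus[OF l]] by simp
      then have "\<not> i < k" using k(2) by blast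
      ultimately show "x - l \<in> C i" using k by (metis nat_neq_iff)
    qed
    obtain k where "k \<in> L" "x + k \<in> C i" using i by (auto simp: S_def)
    then have ex: "- k \<in> L" "x - (- k) \<in> C i" using L_minus by auto
    show ?thesis
    proof (rule ex1I[of _ "- k"])
      show "- k \<in> L \<and> x - - k \<in> R" using ex iff by blast
      fix l assume "l \<in> L \<and> x - l \<in> R"
      then have l: "l \<in> L" "x - l \<in> C i" using iff by auto
      have "nrm (x - l - (x - - k)) < \<epsilon>" using l ex C(3) by blast
      moreover have "x - l - (x - - k) = - k - l" by simp
      moreover have "- k - l \<in> L" using l ex L_diff by auto
      ultimately have "- k - l = 0" using \<epsilon>(2) by (metis not_le)
      then show "l = - k" by simp
    qed
  qed
  then have "fundamental_region V ip L R" using R_sets by (simp add: fundamental_region_def)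
  then show ?thesis ..
qed

text \<open>Cutting \<open>A\<close> along the translates of a fundamental region \<open>R\<close> and moving the pieces back to
  \<open>R\<close>, every point \<open>x\<close> of \<open>R\<close> is covered as often as its orbit meets \<open>A\<close>.\<close>

lemma emeasure_unfold:
  assumes R: "fundamental_region V ip L R" and A: "A \<in> sets vol"
  shows "emeasure vol A =
    (\<integral>\<^sup>+x. indicator R x * emeasure (count_space L) {l \<in> L. x + l \<in> A} \<partial>vol)"
proof -
  have Rs: "R \<in> sets vol" and R1: "\<And>x. x \<in> V \<Longrightarrow> \<exists>!l. l \<in> L \<and> x - l \<in> R"
    using R by (auto simp: fundamental_region_def)
  define X where "X l = A \<inter> {x \<in> V. x + (- l) \<in> R}" for l
  have X_sets: "X l \<in> sets vol" if "l \<in> L" for l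
    unfolding X_def using A vol_translate(1)[OF Rs V_closed(4)[OF L_in_V[OF that]]] by simp
  have disj: "disjoint_family_on X L"
    using R1 by (auto simp: disjoint_family_on_def X_def)
  have "A = (\<Union>l\<in>L. X l)"
  proof (intro equalityI subsetI)
    fix x assume x: "x \<in> A"
    then have "x \<in> V" using sets_vol_subset[OF A] by blast
    then obtain l where "l \<in> L" "x - l \<in> R" using R1 by blast
    then show "x \<in> (\<Union>l\<in>L. X l)" using x \<open>x \<in> V\<close> by (auto simp: X_def)
  qed (auto simp: X_def)
  then have "emeasure vol A = (\<integral>\<^sup>+l. emeasure vol (X l) \<partial>count_space L)"
    using emeasure_UN_countable[of L X vol] X_sets L_countable disj by simp
  also have "\<dots> = (\<integral>\<^sup>+l. (\<integral>\<^sup>+x. indicator R x * indicator {x \<in> V. x + l \<in> A} x \<partial>vol) \<partial>count_space L)"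
  proof (rule nn_integral_cong)
    fix l assume "l \<in> space (count_space L)"
    then have l: "l \<in> L" "l \<in> V" using L_in_V by auto
    have "emeasure vol (X l) = emeasure vol {x \<in> V. x + l \<in> X l}"
      using vol_translate(2)[OF X_sets l(2)] l by simp
    also have "{x \<in> V. x + l \<in> X l} = R \<inter> {x \<in> V. x + l \<in> A}"
      using sets_vol_subset[OF Rs] l V_closed(2) by (auto simp: X_def)
    also have "emeasure vol \<dots> = (\<integral>\<^sup>+x. indicator (R \<inter> {x \<in> V. x + l \<in> A}) x \<partial>vol)"
      using Rs vol_translate(1)[OF A l(2)] by (subst nn_integral_indicator) auto
    finally show "emeasure vol (X l) = (\<integral>\<^sup>+x. indicator R x * indicator {x \<in> V. x + l \<in> A} x \<partial>vol)"
      by (simp add: indicator_inter_arith)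
  qed
  also have "\<dots> = (\<integral>\<^sup>+x. (\<integral>\<^sup>+l. indicator R x * indicator {x \<in> V. x + l \<in> A} x \<partial>count_space L) \<partial>vol)"
    using L_countable Rs vol_translate(1)[OF A] L_in_V
    by (intro nn_integral_count_space_nn_integral[symmetric]) auto
  also have "\<dots> = (\<integral>\<^sup>+x. indicator R x * emeasure (count_space L) {l \<in> L. x + l \<in> A} \<partial>vol)"
  proof (rule nn_integral_cong)
    fix x assume "x \<in> space vol"
    then have x: "x \<in> V" by (simp add: space_vol)
    have "(\<integral>\<^sup>+l. indicator R x * indicator {x \<in> V. x + l \<in> A} x \<partial>count_space L) =
        (\<integral>\<^sup>+l. indicator R x * indicator {l \<in> L. x + l \<in> A} l \<partial>count_space L)"
      using x by (intro nn_integral_cong) (auto simp: indicator_def)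
    also have "\<dots> = indicator R x * emeasure (count_space L) {l \<in> L. x + l \<in> A}"
      by (subst nn_integral_cmult) (auto simp: nn_integral_indicator)
    finally show "(\<integral>\<^sup>+l. indicator R x * indicator {x \<in> V. x + l \<in> A} x \<partial>count_space L) =
        indicator R x * emeasure (count_space L) {l \<in> L. x + l \<in> A}" .
  qed
  finally show ?thesis .
qed

lemma emeasure_ge_multiple:
  assumes R: "fundamental_region V ip L R" and A: "A \<in> sets vol"
    and card: "\<And>x. x \<in> V \<Longrightarrow> \<exists>S\<subseteq>L. finite S \<and> k \<le> card S \<and> (\<forall>l\<in>S. x + l \<in> A)"
  shows "of_nat k * emeasure vol R \<le> emeasure vol A"
proof -
  have Rs: "R \<in> sets vol" using R by (simp add: fundamental_region_def)
  have "of_nat k * emeasure vol R = (\<integral>\<^sup>+x. of_nat k * indicator R x \<partial>vol)"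
    using Rs by (simp add: nn_integral_cmult)
  also have "\<dots> \<le> (\<integral>\<^sup>+x. indicator R x * emeasure (count_space L) {l \<in> L. x + l \<in> A} \<partial>vol)"
  proof (rule nn_integral_mono)
    fix x assume "x \<in> space vol"
    then obtain S where S: "S \<subseteq> L" "finite S" "k \<le> card S" "\<And>l. l \<in> S \<Longrightarrow> x + l \<in> A"
      using card space_vol by metis
    have "of_nat k \<le> (of_nat (card S) :: ennreal)" using S by simp
    also have "\<dots> = emeasure (count_space L) S" using S by simp
    also have "\<dots> \<le> emeasure (count_space L) {l \<in> L. x + l \<in> A}"
      using S by (intro emeasure_mono) auto
    finally show "of_nat k * indicator R x \<le> indicator R x * emeasure (count_space L) {l \<in> L. x + l \<in> A}"
      by (auto simp: indicator_def)
  qed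
  finally show ?thesis using emeasure_unfold[OF R A] by simp
qed

lemma emeasure_le_multiple:
  assumes R: "fundamental_region V ip L R" and A: "A \<in> sets vol"
    and card: "\<And>x. x \<in> V \<Longrightarrow> finite {l \<in> L. x + l \<in> A} \<and> card {l \<in> L. x + l \<in> A} \<le> k"
  shows "emeasure vol A \<le> of_nat k * emeasure vol R"
proof -
  have Rs: "R \<in> sets vol" using R by (simp add: fundamental_region_def)
  have "emeasure vol A = (\<integral>\<^sup>+x. indicator R x * emeasure (count_space L) {l \<in> L. x + l \<in> A} \<partial>vol)"
    by (rule emeasure_unfold[OF R A])
  also have "\<dots> \<le> (\<integral>\<^sup>+x. of_nat k * indicator R x \<partial>vol)"
  proof (rule nn_integral_mono)
    fix x assume "x \<in> space vol"
    then have "emeasure (count_space L) {l \<in> L. x + l \<in> A} \<le> of_nat k"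
      using card[of x] by (simp add: space_vol)
    then show "indicator R x * emeasure (count_space L) {l \<in> L. x + l \<in> A} \<le> of_nat k * indicator R x"
      by (auto simp: indicator_def)
  qed
  also have "\<dots> = of_nat k * emeasure vol R"
    using Rs by (simp add: nn_integral_cmult)
  finally show ?thesis .
qed

text \<open>For fixed x the orbit x + L splits into the cosets x + s + L' with s in
  \<open>S\<close>, each meeting \<open>R'\<close> exactly once; \<open>f x s\<close> is the lattice
  vector leading there. So every orbit meets \<open>R'\<close> in \<open>card S\<close> points. The
  case L' = L with S = {0} shows that the covolume is independent of the region.\<close>

lemma emeasure_fundamental_region_sublattice:
  assumes R: "fundamental_region V ip L R" and R': "fundamental_region V ip L' R'"
    and L': "L' \<subseteq> L" "\<And>x y. x \<in> L' \<Longrightarrow> y \<in> L' \<Longrightarrow> x - y \<in> L'"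
    and S: "finite S" "S \<subseteq> L" "\<And>l. l \<in> L \<Longrightarrow> \<exists>!s. s \<in> S \<and> l - s \<in> L'"
  shows "emeasure vol R' = of_nat (card S) * emeasure vol R"
proof -
  have R's: "R' \<in> sets vol" and R'1: "\<And>x. x \<in> V \<Longrightarrow> \<exists>!l. l \<in> L' \<and> x - l \<in> R'"
    using R' by (auto simp: fundamental_region_def)
  have SV: "x + s \<in> V" if "x \<in> V" "s \<in> S" for x s using that S L_in_V V_closed(2) by blast
  define f where "f x s = s - (THE l. l \<in> L' \<and> (x + s) - l \<in> R')" for x s
  have f: "s - f x s \<in> L'" "x + f x s \<in> R'" if "x \<in> V" "s \<in> S" for x s
    using theI'[OF R'1[OF SV[OF that]]] by (auto simp: f_def algebra_simps)
  have bij: "bij_betw (f x) S {l \<in> L. x + l \<in> R'}" if x: "x \<in> V" for x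
  proof (rule bij_betwI')
    fix s t assume st: "s \<in> S" "t \<in> S"
    show "f x s = f x t \<longleftrightarrow> s = t"
    proof
      assume eq: "f x s = f x t"
      have "(s - f x s) - (t - f x t) \<in> L'" using st f x L'(2) by blast
      then have "s - t \<in> L'" using eq by simp
      moreover have "s - s \<in> L'" using L'(2)[OF f(1)[OF x st(1)] f(1)[OF x st(1)]] by simp
      ultimately show "s = t" using S(2) S(3)[of s] st by blast
    qed simp
  next
    fix s assume s: "s \<in> S"
    have "s - (s - f x s) \<in> L" using s f[OF x s] S L' L_diff by blast
    then show "f x s \<in> {l \<in> L. x + l \<in> R'}" using f[OF x s] by simp
  next
    fix l assume l: "l \<in> {l \<in> L. x + l \<in> R'}"
    then obtain s where s: "s \<in> S" "l - s \<in> L'" using S(3) by blast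
    have "(l - s) - (l - s) \<in> L'" using s L'(2) by blast
    then have "s - l \<in> L'" using L'(2)[of 0 "l - s"] s by simp
    moreover have "(x + s) - (s - l) \<in> R'" using l by (simp add: algebra_simps)
    moreover have "s - f x s \<in> L' \<and> (x + s) - (s - f x s) \<in> R'"
      using f[OF x s(1)] by (simp add: algebra_simps)
    ultimately have "s - f x s = s - l" using R'1[OF SV[OF x s(1)]] by blast
    then show "\<exists>s\<in>S. l = f x s" using s by auto
  qed
  have card: "finite {l \<in> L. x + l \<in> R'}" "card {l \<in> L. x + l \<in> R'} = card S" if "x \<in> V" for x
    using bij_betw_finite[OF bij[OF that]] bij_betw_same_card[OF bij[OF that]] S by auto
  show ?thesis
  proof (rule antisym)
    show "emeasure vol R' \<le> of_nat (card S) * emeasure vol R"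
      using card by (intro emeasure_le_multiple R R's) auto
    show "of_nat (card S) * emeasure vol R \<le> emeasure vol R'"
    proof (intro emeasure_ge_multiple R R's)
      fix x assume "x \<in> V"
      then show "\<exists>T\<subseteq>L. finite T \<and> card S \<le> card T \<and> (\<forall>l\<in>T. x + l \<in> R')"
        using card[of x] by (intro exI[of _ "{l \<in> L. x + l \<in> R'}"]) auto
    qed
  qed
qed

lemma emeasure_covolume:
  assumes R: "fundamental_region V ip L R"
  shows "covolume V ip L = measure vol R"
proof -
  define R' where "R' = (SOME R. fundamental_region V ip L R)"
  have R': "fundamental_region V ip L R'"
    unfolding R'_def using fundamental_region_exists by (rule someI_ex)
  have "emeasure vol R' = of_nat (card {0::'a}) * emeasure vol R"
    by (rule emeasure_fundamental_region_sublattice[OF R R']) (use L_0 L_diff in \<open>auto intro: exI[of _ 0]\<close>)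
  then show ?thesis by (simp add: covolume_def measure_def R'_def)
qed

end

section \<open>Cyclotomic fields\<close>

abbreviation ev :: "rat poly \<Rightarrow> complex \<Rightarrow> complex" where
  "ev p z \<equiv> poly (map_poly of_rat p) z"

lemma ev_pCons: "ev (pCons a p) z = of_rat a + z * ev p z"
  by (simp add: map_poly_pCons)

lemma ev_add: "ev (p + q) z = ev p z + ev q z"
  by (induction p q rule: poly_induct2) (simp_all add: ev_pCons of_rat_add algebra_simps)

lemma ev_smult: "ev (Polynomial.smult c p) z = of_rat c * ev p z"
  by (induction p) (simp_all add: ev_pCons of_rat_mult algebra_simps)

lemma ev_mult: "ev (p * q) z = ev p z * ev q z"
  by (induction p) (simp_all add: ev_pCons ev_add ev_smult algebra_simps)

lemma ev_minus: "ev (- p) z = - ev p z"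
  using ev_smult[of "-1" p z] by simp

lemma ev_diff: "ev (p - q) z = ev p z - ev q z"
  using ev_add[of p "- q" z] ev_minus[of q z] by simp

lemma ev_const: "ev [:c:] z = of_rat c"
  using ev_pCons[of c 0 z] by simp

lemma ev_1: "ev 1 z = 1"
  using ev_const[of 1 z] by (simp add: one_pCons)

lemma ev_X: "ev [:0, 1:] z = z"
  by (simp add: ev_pCons)

lemma ev_monom: "ev (monom c n) z = of_rat c * z ^ n"
  by (simp add: map_poly_monom poly_monom)

lemma ev_pcompose: "ev (pcompose p q) z = ev p (ev q z)"
  by (induction p) (simp_all add: pcompose_pCons ev_add ev_mult ev_const ev_pCons)

lemma minimal_poly_exists:
  assumes "f \<noteq> 0" "ev f z = 0"
  obtains \<nu> where "\<nu> \<noteq> 0" "lead_coeff \<nu> = 1" "\<And>g. ev g z = 0 \<longleftrightarrow> \<nu> dvd g"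
proof -
  define n where "n = (LEAST n. \<exists>g. g \<noteq> 0 \<and> ev g z = 0 \<and> degree g = n)"
  have "\<exists>n g. g \<noteq> 0 \<and> ev g z = 0 \<and> degree g = n" using assms by blast
  then have "\<exists>g. g \<noteq> 0 \<and> ev g z = 0 \<and> degree g = n" unfolding n_def by (rule LeastI_ex)
  then obtain g0 where g0: "g0 \<noteq> 0" "ev g0 z = 0" "degree g0 = n" by blast
  have least: "n \<le> degree g" if "g \<noteq> 0" "ev g z = 0" for g
    unfolding n_def by (rule Least_le) (use that in blast)
  define \<nu> where "\<nu> = Polynomial.smult (1 / lead_coeff g0) g0"
  have \<nu>: "\<nu> \<noteq> 0" "lead_coeff \<nu> = 1" "degree \<nu> = n" "ev \<nu> z = 0"
    using g0 by (auto simp: \<nu>_def ev_smult)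
  have "ev g z = 0 \<longleftrightarrow> \<nu> dvd g" for g
  proof
    assume g: "ev g z = 0"
    have "g = \<nu> * (g div \<nu>) + g mod \<nu>" by simp
    then have "ev (g mod \<nu>) z = 0" using g \<nu>(4) by (metis ev_add ev_mult add_0 mult_zero_left)
    then have "g mod \<nu> = 0" using least[of "g mod \<nu>"] degree_mod_less[OF \<nu>(1), of g] \<nu>(3) by linarith
    then show "\<nu> dvd g" by (simp add: dvd_eq_mod_eq_0)
  next
    assume "\<nu> dvd g"
    then show "ev g z = 0" using \<nu>(4) by (auto simp: ev_mult)
  qed
  with \<nu> that show thesis by blast
qed

text \<open>The closure of the algebraic integers under sums and products is not proved; it comes with the
  hypothesis that \<open>\<PP>\<close> is an ideal of a ring.\<close>

locale cyclotomic =
  fixes m :: nat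
  assumes m_pos: "m > 0" and ring_integers: "ring (integers_ring (cyclotomic_field m))"
begin

section \<open>The field, its integers and the roots of unity\<close>

definition K :: "complex set" where "K = cyclotomic_field m"
definition \<zeta> :: complex where "\<zeta> = cis (2 * pi / real m)"
definition OK :: "complex set" where "OK = {x \<in> K. algebraic_int x}"
definition U :: "complex set" where "U = {z. z ^ m = 1}"

lemma K_eq: "K = range (\<lambda>p. ev p \<zeta>)"
  by (auto simp: K_def cyclotomic_field_def \<zeta>_def)

lemma ev_in_K: "ev p \<zeta> \<in> K" by (simp add: K_eq)

lemma K_add: "x \<in> K \<Longrightarrow> y \<in> K \<Longrightarrow> x + y \<in> K"
  by (auto simp: K_eq simp flip: ev_add)

lemma K_mult: "x \<in> K \<Longrightarrow> y \<in> K \<Longrightarrow> x * y \<in> K"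
  by (auto simp: K_eq simp flip: ev_mult)

lemma K_uminus: "x \<in> K \<Longrightarrow> - x \<in> K"
  by (auto simp: K_eq simp flip: ev_minus)

lemma K_diff: "x \<in> K \<Longrightarrow> y \<in> K \<Longrightarrow> x - y \<in> K"
  by (auto simp: K_eq simp flip: ev_diff)

lemma K_of_rat: "of_rat r \<in> K"
  using ev_in_K[of "[:r:]"] by (simp add: ev_const)

lemma K_0: "0 \<in> K" and K_1: "1 \<in> K"
  using K_of_rat[of 0] K_of_rat[of 1] by auto

lemma K_\<zeta>: "\<zeta> \<in> K"
  using ev_in_K[of "[:0, 1:]"] by (simp add: ev_X)

lemma K_power: "x \<in> K \<Longrightarrow> x ^ n \<in> K"
  by (induction n) (auto simp: K_1 K_mult)

lemma K_prod: "(\<And>i. i \<in> I \<Longrightarrow> f i \<in> K) \<Longrightarrow> prod f I \<in> K"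
  by (induction I rule: infinite_finite_induct) (auto simp: K_1 K_mult)

lemma K_sum: "(\<And>i. i \<in> I \<Longrightarrow> f i \<in> K) \<Longrightarrow> sum f I \<in> K"
  by (induction I rule: infinite_finite_induct) (auto simp: K_0 K_add)

lemma carrier_integers_ring: "carrier (integers_ring K) = OK"
  by (simp add: integers_ring_def OK_def)

lemma OK_in_K: "x \<in> OK \<Longrightarrow> x \<in> K" by (simp add: OK_def)

lemma OK_add: "x \<in> OK \<Longrightarrow> y \<in> OK \<Longrightarrow> x + y \<in> OK"
  and OK_mult: "x \<in> OK \<Longrightarrow> y \<in> OK \<Longrightarrow> x * y \<in> OK"
proof -
  interpret ring "integers_ring K" using ring_integers by (simp add: K_def)
  assume "x \<in> OK" "y \<in> OK"
  then show "x + y \<in> OK" "x * y \<in> OK"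
    using add.m_closed[of x y] m_closed[of x y] by (auto simp: carrier_integers_ring) (auto simp: integers_ring_def)
qed

lemma OK_uminus: "x \<in> OK \<Longrightarrow> - x \<in> OK"
  by (auto simp: OK_def K_uminus)

lemma OK_diff: "x \<in> OK \<Longrightarrow> y \<in> OK \<Longrightarrow> x - y \<in> OK"
  using OK_add[of x "- y"] OK_uminus by simp

lemma OK_of_int: "of_int k \<in> OK"
  using K_of_rat[of "of_int k"] by (auto simp: OK_def int_imp_algebraic_int)

lemma OK_0: "0 \<in> OK" and OK_1: "1 \<in> OK" and OK_of_nat: "of_nat n \<in> OK"
  using OK_of_int[of 0] OK_of_int[of 1] OK_of_int[of "int n"] by auto

lemma OK_power: "x \<in> OK \<Longrightarrow> x ^ n \<in> OK"
  by (induction n) (auto simp: OK_1 OK_mult)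

lemma OK_prod: "(\<And>i. i \<in> I \<Longrightarrow> f i \<in> OK) \<Longrightarrow> prod f I \<in> OK"
  by (induction I rule: infinite_finite_induct) (auto simp: OK_1 OK_mult)

lemma OK_sum: "(\<And>i. i \<in> I \<Longrightarrow> f i \<in> OK) \<Longrightarrow> sum f I \<in> OK"
  by (induction I rule: infinite_finite_induct) (auto simp: OK_0 OK_add)

lemma \<zeta>_power: "\<zeta> ^ k = cis (2 * pi * real k / real m)"
  unfolding \<zeta>_def Complex.DeMoivre by (simp add: mult_ac)

lemma \<zeta>_power_m: "\<zeta> ^ m = 1"
  using m_pos by (simp add: \<zeta>_power)

lemma \<zeta>_power_inj: "inj_on (\<lambda>k. \<zeta> ^ k) {..<m}"
proof -
  have "bij_betw (\<lambda>k. cis (2 * pi * real k / real m)) {..<m} {z. z ^ m = 1}"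
    by (rule Complex.bij_betw_roots_unity[OF m_pos])
  then show ?thesis by (simp add: bij_betw_def \<zeta>_power)
qed

lemma U_eq: "U = (\<lambda>k. \<zeta> ^ k) ` {..<m}"
proof -
  have "bij_betw (\<lambda>k. cis (2 * pi * real k / real m)) {..<m} {z. z ^ m = 1}"
    by (rule Complex.bij_betw_roots_unity[OF m_pos])
  then show ?thesis by (simp add: bij_betw_def \<zeta>_power U_def)
qed

lemma finite_U: "finite U" by (simp add: U_eq)

lemma \<zeta>_power_eq_1_iff: "\<zeta> ^ k = 1 \<longleftrightarrow> m dvd k"
proof -
  have "\<zeta> ^ k = (\<zeta> ^ m) ^ (k div m) * \<zeta> ^ (k mod m)"
    by (simp flip: power_mult power_add)
  then have "\<zeta> ^ k = \<zeta> ^ (k mod m)" by (simp add: \<zeta>_power_m)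
  moreover have "\<zeta> ^ (k mod m) = \<zeta> ^ 0 \<longleftrightarrow> k mod m = 0"
    using m_pos by (intro inj_on_eq_iff[OF \<zeta>_power_inj]) auto
  ultimately show ?thesis by (auto simp: mod_eq_0_iff_dvd)
qed

lemma OK_\<zeta>: "\<zeta> \<in> OK"
proof -
  have "algebraic_int \<zeta>"
  proof (rule algebraic_int_root)
    show "poly (monom 1 m) \<zeta> = 1" by (simp add: poly_monom \<zeta>_power_m)
  qed (use m_pos in \<open>auto simp: degree_monom_eq\<close>)
  then show ?thesis by (simp add: OK_def K_\<zeta>)
qed

lemma U_OK: "z \<in> U \<Longrightarrow> z \<in> OK"
  by (auto simp: U_eq OK_power OK_\<zeta>)

lemma rational_OK_is_int: "of_rat r \<in> OK \<Longrightarrow> r \<in> \<int>"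
proof -
  assume "of_rat r \<in> OK"
  then have "(of_rat r :: complex) \<in> \<int>" by (intro rational_algebraic_int_is_int) (auto simp: OK_def)
  then obtain k where "(of_rat r :: complex) = of_int k" by (auto elim: Ints_cases)
  then have "(of_rat r :: complex) = of_rat (of_int k)" by simp
  then show ?thesis by (simp only: of_rat_eq_iff) auto
qed

section \<open>The minimal polynomial of zeta\<close>

definition \<mu> :: "rat poly" where
  "\<mu> = (SOME \<nu>. \<nu> \<noteq> 0 \<and> lead_coeff \<nu> = 1 \<and> (\<forall>g. ev g \<zeta> = 0 \<longleftrightarrow> \<nu> dvd g))"

lemma \<mu>: "\<mu> \<noteq> 0" "lead_coeff \<mu> = 1" "ev g \<zeta> = 0 \<longleftrightarrow> \<mu> dvd g"
proof -
  have ne: "monom 1 m - 1 \<noteq> (0 :: rat poly)"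
    using m_pos by (metis degree_1 degree_monom_eq eq_iff_diff_eq_0 less_numeral_extra(3) one_neq_zero)
  have "ev (monom 1 m - 1) \<zeta> = 0" by (simp add: ev_diff ev_monom ev_1 \<zeta>_power_m)
  then have "\<exists>\<nu>. \<nu> \<noteq> 0 \<and> lead_coeff \<nu> = 1 \<and> (\<forall>g. ev g \<zeta> = 0 \<longleftrightarrow> \<nu> dvd g)"
    using minimal_poly_exists[OF ne] by metis
  then have "\<mu> \<noteq> 0 \<and> lead_coeff \<mu> = 1 \<and> (\<forall>g. ev g \<zeta> = 0 \<longleftrightarrow> \<mu> dvd g)"
    unfolding \<mu>_def by (rule someI_ex)
  then show "\<mu> \<noteq> 0" "lead_coeff \<mu> = 1" "ev g \<zeta> = 0 \<longleftrightarrow> \<mu> dvd g" by auto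
qed

text \<open>The conjugates of \<open>\<zeta>\<close>. That they are all the primitive m-th roots of
  unity is established only in \<open>Z_eq\<close>.\<close>

definition Z :: "complex set" where "Z = {z. ev \<mu> z = 0}"

lemma \<zeta>_in_Z: "\<zeta> \<in> Z" by (simp add: Z_def \<mu>(3))

lemma ev_vanishes_on_Z: "ev g \<zeta> = 0 \<Longrightarrow> z \<in> Z \<Longrightarrow> ev g z = 0"
  by (auto simp: \<mu>(3) Z_def ev_mult)

lemma Z_subset_U: "Z \<subseteq> U"
  using ev_vanishes_on_Z[of "monom 1 m - 1"] by (auto simp: U_def ev_diff ev_monom ev_1 \<zeta>_power_m)

lemma finite_Z: "finite Z" using Z_subset_U finite_U by (rule finite_subset)

lemma Z_OK: "z \<in> Z \<Longrightarrow> z \<in> OK" using Z_subset_U U_OK by blast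

text \<open>Irreducibility of \<open>\<mu>\<close>: write \<mu> = \<nu> k with \<nu> the minimal
  polynomial of z. As \<nu> is not constant, k has too small a degree to vanish at
  \<open>\<zeta>\<close>, so \<nu> does, and \<mu> divides \<nu>. Consequently the conjugation maps
  are well defined and injective.\<close>

lemma ev_eq_0_iff_on_Z: "z \<in> Z \<Longrightarrow> ev g z = 0 \<longleftrightarrow> ev g \<zeta> = 0"
proof
  assume z: "z \<in> Z" and g: "ev g z = 0"
  obtain \<nu> where \<nu>: "\<nu> \<noteq> 0" "lead_coeff \<nu> = 1" "\<And>g. ev g z = 0 \<longleftrightarrow> \<nu> dvd g"
    using minimal_poly_exists[of \<mu> z] \<mu>(1) z by (auto simp: Z_def)
  have "\<nu> dvd \<mu>" using \<nu>(3) z by (auto simp: Z_def)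
  then obtain k where k: "\<mu> = \<nu> * k" by blast
  have "ev k \<zeta> \<noteq> 0"
  proof
    assume "ev k \<zeta> = 0"
    then have "degree \<mu> \<le> degree k" using \<mu>(1) k by (intro dvd_imp_degree_le) (auto simp: \<mu>(3))
    then have "degree \<nu> = 0" using degree_mult_eq[of \<nu> k] \<mu>(1) k by auto
    then have "\<nu> = [:1:]" using \<nu>(2) by (metis degree_0_id)
    then have "ev \<nu> z \<noteq> 0" by (simp add: ev_const)
    then show False using \<nu>(3)[of \<nu>] by simp
  qed
  moreover have "ev \<nu> \<zeta> * ev k \<zeta> = 0"
    using \<mu>(3)[of \<mu>] unfolding ev_mult[symmetric] k[symmetric] by simp
  ultimately have "\<mu> dvd \<nu>" by (simp add: \<mu>(3))
  then show "ev g \<zeta> = 0" using \<nu>(3)[of g] g \<mu>(3)[of g] dvd_trans[of \<mu> \<nu> g] by simp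
qed (rule ev_vanishes_on_Z)

definition M :: "complex poly" where "M = map_poly of_rat \<mu>"

lemma M_monic: "lead_coeff M = 1" "degree M = degree \<mu>" "M \<noteq> 0"
proof -
  show d: "degree M = degree \<mu>" unfolding M_def by (rule degree_map_poly) auto
  show "lead_coeff M = 1" unfolding d unfolding M_def by (simp add: coeff_map_poly \<mu>(2))
  then show "M \<noteq> 0" by auto
qed

lemma M_dvd: "M dvd monom 1 m - 1"
proof -
  obtain h where h: "monom 1 m - 1 = \<mu> * h"
    using \<mu>(3)[of "monom 1 m - 1"] by (auto simp: ev_diff ev_monom ev_1 \<zeta>_power_m)
  have "poly (M * map_poly of_rat h) z = poly (monom 1 m - 1) z" for z
  proof -
    have "poly (M * map_poly of_rat h) z = ev (\<mu> * h) z" by (simp add: M_def ev_mult)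
    also have "\<dots> = poly (monom 1 m - 1) z"
      unfolding h[symmetric] by (simp add: ev_diff ev_monom ev_1 poly_monom)
    finally show ?thesis .
  qed
  then have "M * map_poly of_rat h = monom 1 m - 1" by (simp add: poly_eq_poly_eq_iff[symmetric] fun_eq_iff)
  then show ?thesis by (metis dvd_triv_left)
qed

text \<open>A double root a of p would be a double root of X^m - 1, but the derivative m a^(m-1)
  vanishes only at 0, which is no m-th root of unity.\<close>

lemma factor_dvd_unity_poly:
  assumes p: "p dvd monom 1 m - (1 :: complex poly)" "lead_coeff p = 1"
  shows "p = (\<Prod>z | poly p z = 0. [:- z, 1:])"
proof -
  obtain h where h: "monom 1 m - 1 = p * h" using p(1) by blast
  have "rsquarefree p"
  proof (rule rsquarefree_roots[THEN iffD2], intro allI notI)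
    fix a assume a: "poly p a = 0 \<and> poly (pderiv p) a = 0"
    have "poly (monom 1 m - 1) a = 0" "poly (pderiv (monom 1 m - 1)) a = 0"
      unfolding h using a by (simp_all add: pderiv_mult)
    then have "a ^ m = 1" "of_nat m * a ^ (m - 1) = 0"
      by (simp_all add: poly_monom pderiv_diff pderiv_monom)
    then show False using m_pos by (cases "a = 0") (auto simp: zero_power)
  qed
  then have "smult (lead_coeff p) (\<Prod>z | poly p z = 0. [:- z, 1:]) = p"
    by (rule complex_poly_decompose_rsquarefree)
  then show ?thesis using p(2) by simp
qed

lemma M_factor: "M = (\<Prod>z\<in>Z. [:- z, 1:])"
  using factor_dvd_unity_poly[OF M_dvd M_monic(1)] by (simp add: Z_def M_def)

lemma unity_poly_factor: "monom 1 m - (1 :: complex poly) = (\<Prod>z\<in>U. [:- z, 1:])"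
proof -
  define p where "p = monom 1 m - (1 :: complex poly)"
  have "degree (monom 1 m + (- 1) :: complex poly) = degree (monom 1 m :: complex poly)"
    using m_pos by (intro degree_add_eq_left) (simp add: degree_monom_eq)
  then have "degree p = m" by (simp add: p_def degree_monom_eq)
  then have "lead_coeff p = 1" using m_pos by (simp add: p_def one_pCons coeff_pCons split: nat.splits)
  moreover have "{z. poly p z = 0} = U" by (auto simp: p_def U_def poly_monom)
  ultimately show ?thesis using factor_dvd_unity_poly[of p] by (simp add: p_def)
qed

lemma degree_\<mu>: "degree \<mu> = card Z"
  using M_monic(2) by (simp add: M_factor degree_prod_eq_sum_degree)

text \<open>In place of Gauss's lemma: the coefficients are sums of products of conjugates of
  \<open>\<zeta>\<close>, hence algebraic integers, and rational algebraic integers are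
  integers.\<close>

lemma \<mu>_coeff_int: "coeff \<mu> i \<in> \<int>"
proof -
  have "coeff (\<Prod>z\<in>S. [:- z, 1:]) i \<in> OK" if "finite S" "S \<subseteq> OK" for S i
    using that
  proof (induction S arbitrary: i rule: finite_induct)
    case empty
    then show ?case by (auto simp: one_pCons coeff_pCons OK_0 OK_1 split: nat.splits)
  next
    case (insert z S)
    then show ?case
      by (auto simp: coeff_pCons OK_uminus OK_mult intro!: OK_diff OK_add split: nat.splits)
  qed
  then have "coeff M i \<in> OK" using finite_Z Z_OK by (auto simp: M_factor)
  then show ?thesis by (intro rational_OK_is_int) (simp add: M_def coeff_map_poly)
qed

section \<open>Frobenius congruences and the Galois orbit of zeta\<close>

lemma add_power_prime_mod:
  assumes p: "prime p" and x: "x \<in> OK" and y: "y \<in> OK"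
  shows "\<exists>w\<in>OK. (x + y) ^ p = x ^ p + y ^ p + of_nat p * w"
proof -
  have p2: "p \<ge> 2" using p by (rule prime_ge_2_nat)
  have split: "{..p} = insert 0 (insert p {1..<p})" using p2 by auto
  define w where "w = (\<Sum>k\<in>{1..<p}. of_nat ((p choose k) div p) * x ^ k * y ^ (p - k))"
  have "(x + y) ^ p = (\<Sum>k\<le>p. of_nat (p choose k) * x ^ k * y ^ (p - k))" by (rule binomial_ring)
  also have "\<dots> = x ^ p + y ^ p + (\<Sum>k\<in>{1..<p}. of_nat (p choose k) * x ^ k * y ^ (p - k))"
    unfolding split using p2 by simp
  also have "(\<Sum>k\<in>{1..<p}. of_nat (p choose k) * x ^ k * y ^ (p - k)) = of_nat p * w"
    unfolding w_def sum_distrib_left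
  proof (rule sum.cong)
    fix k assume "k \<in> {1..<p}"
    then have "p dvd (p choose k)" using p by (intro dvd_choose_prime) auto
    then have "(of_nat (p choose k) :: complex) = of_nat p * of_nat ((p choose k) div p)"
      by (metis dvd_mult_div_cancel of_nat_mult)
    then show "of_nat (p choose k) * x ^ k * y ^ (p - k) = of_nat p * (of_nat ((p choose k) div p) * x ^ k * y ^ (p - k))"
      by (simp add: mult.assoc)
  qed simp
  finally have "(x + y) ^ p = x ^ p + y ^ p + of_nat p * w" .
  moreover have "w \<in> OK" unfolding w_def using x y by (intro OK_sum OK_mult OK_of_nat OK_power)
  ultimately show ?thesis by blast
qed

lemma fermat_OK:
  assumes p: "prime p"
  shows "\<exists>w\<in>OK. of_int k ^ p = of_int k + of_nat p * w"
proof (induction k rule: int_induct[of _ 0])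
  case base
  then show ?case using prime_gt_0_nat[OF p] by (auto simp: OK_0 zero_power intro!: bexI[of _ 0])
next
  case (step1 k)
  then obtain w where "w \<in> OK" "of_int k ^ p = of_int k + of_nat p * w" by blast
  moreover obtain u where "u \<in> OK" "(of_int k + 1) ^ p = of_int k ^ p + 1 ^ p + of_nat p * u"
    using add_power_prime_mod[OF p OK_of_int OK_1] by blast
  ultimately show ?case by (intro bexI[of _ "w + u"]) (auto simp: OK_add algebra_simps)
next
  case (step2 k)
  then obtain w where "w \<in> OK" "of_int k ^ p = of_int k + of_nat p * w" by blast
  moreover obtain u where "u \<in> OK" "(of_int (k - 1) + 1) ^ p = of_int (k - 1) ^ p + 1 ^ p + of_nat p * u"
    using add_power_prime_mod[OF p OK_of_int OK_1] by blast
  ultimately show ?case by (intro bexI[of _ "w - u"]) (auto simp: OK_diff algebra_simps)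
qed

text \<open>f(x)^p = f(x^p) modulo p OK for integral f, with the congruence expressed by the
  multiplier \<open>w\<close>. Horner induction combines the binomial congruence with Fermat's for
  the constant coefficient; membership of f(x) in \<open>OK\<close> goes through the same induction
  because the binomial step consumes it.\<close>

lemma ev_power_prime_mod:
  assumes p: "prime p" and x: "x \<in> OK"
  shows "(\<And>i. coeff f i \<in> \<int>) \<Longrightarrow> \<exists>w\<in>OK. ev f x ^ p = ev f (x ^ p) + of_nat p * w"
    and "(\<And>i. coeff f i \<in> \<int>) \<Longrightarrow> ev f x \<in> OK"
proof -
  have "(\<forall>i. coeff f i \<in> \<int>) \<Longrightarrow> (\<exists>w\<in>OK. ev f x ^ p = ev f (x ^ p) + of_nat p * w) \<and> ev f x \<in> OK"
  proof (induction f)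
    case 0
    then show ?case using prime_gt_0_nat[OF p] by (auto simp: OK_0 zero_power intro!: bexI[of _ 0])
  next
    case (pCons a f)
    have "coeff f i \<in> \<int>" for i using pCons.prems[rule_format, of "Suc i"] by simp
    then obtain w where w: "w \<in> OK" "ev f x ^ p = ev f (x ^ p) + of_nat p * w" and fx: "ev f x \<in> OK"
      using pCons.IH by blast
    have "a \<in> \<int>" using pCons.prems[rule_format, of 0] by simp
    then obtain k where k: "a = of_int k" by (auto elim: Ints_cases)
    obtain u where u: "u \<in> OK" "(of_int k + x * ev f x) ^ p = of_int k ^ p + (x * ev f x) ^ p + of_nat p * u"
      using add_power_prime_mod[OF p OK_of_int OK_mult[OF x fx]] by blast
    obtain l where l: "l \<in> OK" "of_int k ^ p = of_int k + of_nat p * l" using fermat_OK[OF p] by blast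
    have "ev (pCons a f) x ^ p = ev (pCons a f) (x ^ p) + of_nat p * (l + x ^ p * w + u)"
      using u(2) w(2) l(2) by (simp add: ev_pCons k power_mult_distrib algebra_simps)
    moreover have "l + x ^ p * w + u \<in> OK" using l u w x by (intro OK_add OK_mult OK_of_int OK_power)
    moreover have "ev (pCons a f) x \<in> OK" using fx x by (simp add: ev_pCons k OK_add OK_mult OK_of_int)
    ultimately show ?case by blast
  qed
  then show "(\<And>i. coeff f i \<in> \<int>) \<Longrightarrow> \<exists>w\<in>OK. ev f x ^ p = ev f (x ^ p) + of_nat p * w"
    "(\<And>i. coeff f i \<in> \<int>) \<Longrightarrow> ev f x \<in> OK" by auto
qed

text \<open>Dedekind's argument, with the discriminant of \<open>X\<^sup>m - 1\<close> in place of its reduction modulo \<open>p\<close>: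
  if \<open>\<eta> = x\<^sup>p\<close> were not a conjugate, then \<open>\<mu>(\<eta>)\<close>, a multiple of \<open>p\<close>, would divide
  \<open>m \<eta>\<^bsup>m - 1\<^esup>\<close>, the product of the differences of \<open>\<eta>\<close> to all other roots of unity.\<close>

lemma Z_power_prime:
  assumes p: "prime p" "\<not> p dvd m" and x: "x \<in> Z"
  shows "x ^ p \<in> Z"
proof (rule ccontr)
  define \<eta> where "\<eta> = x ^ p"
  assume "x ^ p \<notin> Z"
  then have \<eta>Z: "\<eta> \<notin> Z" by (simp add: \<eta>_def)
  have xU: "x ^ m = 1" using Z_subset_U x by (auto simp: U_def)
  have \<eta>U: "\<eta> ^ m = 1" unfolding \<eta>_def using xU by (metis power_mult mult.commute power_one)
  have \<eta>OK: "\<eta> \<in> OK" unfolding \<eta>_def using x Z_OK OK_power by blast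
  obtain w where w: "w \<in> OK" "ev \<mu> x ^ p = ev \<mu> \<eta> + of_nat p * w"
    using ev_power_prime_mod(1)[OF p(1) Z_OK[OF x] \<mu>_coeff_int] unfolding \<eta>_def by blast
  then have y: "ev \<mu> \<eta> = of_nat p * (- w)" "- w \<in> OK"
    using x prime_gt_0_nat[OF p(1)] OK_uminus by (auto simp: Z_def zero_power add_eq_0_iff2)
  have \<eta>in: "\<eta> \<in> U" using \<eta>U by (simp add: U_def)
  have "pderiv (\<Prod>z\<in>U. [:- z, 1:]) = pderiv ([:- \<eta>, 1:] * (\<Prod>z\<in>U - {\<eta>}. [:- z, 1:]))"
    using finite_U \<eta>in by (subst prod.remove[of U \<eta>]) auto
  then have "poly (pderiv (\<Prod>z\<in>U. [:- z, 1:])) \<eta> = (\<Prod>z\<in>U - {\<eta>}. \<eta> - z)"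
    by (simp add: pderiv_mult pderiv_pCons poly_prod del: mult_pCons_left)
  then have "of_nat m * \<eta> ^ (m - 1) = (\<Prod>z\<in>U - {\<eta>}. \<eta> - z)"
    by (simp add: unity_poly_factor[symmetric] pderiv_diff pderiv_monom poly_monom)
  also have "\<dots> = (\<Prod>z\<in>Z. \<eta> - z) * (\<Prod>z\<in>U - {\<eta>} - Z. \<eta> - z)"
    using finite_U Z_subset_U \<eta>Z by (subst prod.subset_diff[of Z "U - {\<eta>}"]) (auto simp: mult.commute)
  also have "(\<Prod>z\<in>Z. \<eta> - z) = ev \<mu> \<eta>"
    using arg_cong[OF M_factor, of "\<lambda>p. poly p \<eta>"] by (simp add: M_def poly_prod)
  finally have eq: "of_nat m * \<eta> ^ (m - 1) = of_nat p * (- w) * (\<Prod>z\<in>U - {\<eta>} - Z. \<eta> - z)"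
    using y by simp
  \<comment> \<open>The extra factor \<eta> completes \<eta>^(m-1) to \<eta>^m = 1. This leaves m =
    p v with v in \<open>OK\<close>, so m / p is a rational algebraic integer and p divides
    m.\<close>
  define v where "v = (- w) * (\<Prod>z\<in>U - {\<eta>} - Z. \<eta> - z) * \<eta>"
  have vOK: "v \<in> OK" unfolding v_def using y(2) \<eta>OK U_OK by (intro OK_mult OK_prod OK_diff) auto
  have "of_nat m * (\<eta> ^ (m - 1) * \<eta>) = of_nat p * v" using arg_cong[OF eq, of "\<lambda>u. u * \<eta>"] by (simp add: v_def mult_ac)
  moreover have "\<eta> ^ (m - 1) * \<eta> = 1" using power_minus_mult[OF m_pos, of \<eta>] \<eta>U by simp
  ultimately have "of_nat m = of_nat p * v" by simp
  then have "v = of_rat (of_nat m / of_nat p)"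
    using prime_gt_0_nat[OF p(1)] by (simp add: of_rat_divide field_simps)
  then have "(of_nat m / of_nat p :: rat) \<in> \<int>" using vOK rational_OK_is_int by blast
  then obtain k where "(of_nat m / of_nat p :: rat) = of_int k" by (auto elim: Ints_cases)
  then have "(of_int (int m) :: rat) = of_int (k * int p)" using prime_gt_0_nat[OF p(1)] by (simp add: field_simps)
  then have "int m = k * int p" by (simp only: of_int_eq_iff)
  then have "int p dvd int m" by simp
  then show False using p(2) by simp
qed

lemma Z_power_coprime:
  assumes "coprime n m" "n > 0" "x \<in> Z"
  shows "x ^ n \<in> Z"
  using assms
proof (induction n arbitrary: x rule: less_induct)
  case (less n)
  show ?case
  proof (cases "n = 1")
    case False
    then obtain p where p: "prime p" "p dvd n" using prime_factor_nat by blast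
    then obtain k where k: "n = p * k" by blast
    have "\<not> p dvd m" using p less.prems(1) by (meson coprime_common_divisor not_prime_unit)
    then have "x ^ p \<in> Z" using Z_power_prime p less.prems by blast
    moreover have "k < n" "k > 0" "coprime k m" using k p less.prems prime_gt_1_nat[OF p(1)] by auto
    ultimately have "(x ^ p) ^ k \<in> Z" using less.IH by blast
    then show ?thesis by (simp add: k power_mult)
  qed (use less.prems in simp)
qed

text \<open>A conjugate z satisfies the same rational equations as \<open>\<zeta>\<close>, so it has
  the same order. If z = \<zeta>^j and g = gcd j m, then z^(m/g) = 1 forces \<zeta>^(m/g) = 1, hence
  g = 1.\<close>

lemma Z_eq: "Z = (\<lambda>k. \<zeta> ^ k) ` totatives m"
proof (intro equalityI subsetI)
  fix z assume "z \<in> (\<lambda>k. \<zeta> ^ k) ` totatives m"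
  then show "z \<in> Z" using Z_power_coprime[OF _ _ \<zeta>_in_Z] by (auto simp: totatives_def)
next
  fix z assume z: "z \<in> Z"
  then obtain k where k: "k < m" "z = \<zeta> ^ k" using Z_subset_U U_eq by auto
  \<comment> \<open>\<open>totatives m\<close> lies in 1..m, so the exponent 0 is replaced by m;
    this is what makes the case m = 1 come out right.\<close>
  define j where "j = (if k = 0 then m else k)"
  have j: "0 < j" "j \<le> m" "z = \<zeta> ^ j" using k m_pos by (auto simp: j_def \<zeta>_power_m)
  have "coprime j m"
  proof -
    define g where "g = gcd j m"
    have "z ^ (m div g) = (\<zeta> ^ m) ^ (j div g)"
      unfolding j(3) g_def by (simp flip: power_mult) (metis dvd_div_mult div_mult_swap gcd_dvd1 gcd_dvd2 mult.commute)
    then have "ev (monom 1 (m div g) - 1) z = 0" by (simp add: ev_diff ev_monom ev_1 \<zeta>_power_m)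
    then have "ev (monom 1 (m div g) - 1) \<zeta> = 0" using ev_eq_0_iff_on_Z[OF z] by blast
    then have "\<zeta> ^ (m div g) = 1" by (simp add: ev_diff ev_monom ev_1)
    then have "m dvd m div g" by (simp add: \<zeta>_power_eq_1_iff)
    moreover have "m div g > 0" using m_pos by (simp add: g_def div_greater_zero_iff gcd_le2_nat)
    ultimately have "m \<le> m div g" by (rule dvd_imp_le)
    then have "\<not> g > 1" using m_pos by (meson div_less_dividend not_le)
    moreover have "g > 0" using m_pos by (simp add: g_def)
    ultimately have "g = 1" by linarith
    then show ?thesis by (simp add: g_def coprime_iff_gcd_eq_1)
  qed
  then show "z \<in> (\<lambda>k. \<zeta> ^ k) ` totatives m" using j by (auto simp: totatives_def)
qed

lemma card_Z: "card Z = totient m"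
proof -
  have "inj_on (\<lambda>k. \<zeta> ^ k) (totatives m)"
  proof (rule inj_onI)
    fix a b assume ab: "a \<in> totatives m" "b \<in> totatives m" "\<zeta> ^ a = \<zeta> ^ b"
    have *: "a = b" if "a \<le> b" "0 < a" "b \<le> m" "\<zeta> ^ a = \<zeta> ^ b" for a b
    proof -
      have "\<zeta> ^ a * \<zeta> ^ (b - a) = \<zeta> ^ b" using that(1) unfolding power_add[symmetric] by simp
      then have "\<zeta> ^ (b - a) = 1" using that(4) by (simp add: \<zeta>_def)
      then have "m dvd b - a" by (simp add: \<zeta>_power_eq_1_iff)
      moreover have "b - a < m" using that by linarith
      ultimately have "b - a = 0" using m_pos by (meson dvd_imp_le gr0I not_le)
      then show ?thesis using that by simp
    qed
    have "0 < a" "a \<le> m" "0 < b" "b \<le> m" using ab(1,2) by (auto simp: totatives_def)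
    then show "a = b" using *[of a b] *[of b a] ab(3) by (metis nat_le_linear)
  qed
  then show ?thesis by (simp add: Z_eq card_image totient_def)
qed

section \<open>Conjugation maps\<close>

definition d :: nat where "d = totient m"

lemma d_pos: "d > 0" using m_pos by (simp add: d_def)

lemma degree_\<mu>_d: "degree \<mu> = d" by (simp add: degree_\<mu> card_Z d_def)

text \<open>The conjugation maps are indexed by the conjugates \<open>z \<in> Z\<close> of \<open>\<zeta>\<close>: \<open>\<sigma> z\<close> sends \<open>\<zeta>\<close> to \<open>z\<close>.\<close>

definition rep_poly :: "complex \<Rightarrow> rat poly" where
  "rep_poly x = (SOME g. x = ev g \<zeta>) mod \<mu>"

definition \<sigma> :: "complex \<Rightarrow> complex \<Rightarrow> complex" where "\<sigma> z x = ev (rep_poly x) z"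

lemma ev_mod_\<mu>: "z \<in> Z \<Longrightarrow> ev (g mod \<mu>) z = ev g z"
proof -
  assume z: "z \<in> Z"
  have "ev g z = ev (\<mu> * (g div \<mu>) + g mod \<mu>) z" by simp
  also have "\<dots> = ev (g mod \<mu>) z" using z unfolding ev_add ev_mult by (simp add: Z_def)
  finally show ?thesis ..
qed

lemma ev_rep_poly: "x \<in> K \<Longrightarrow> ev (rep_poly x) \<zeta> = x"
proof -
  assume "x \<in> K"
  then have "\<exists>g. x = ev g \<zeta>" by (auto simp: K_eq)
  then have "x = ev (SOME g. x = ev g \<zeta>) \<zeta>" by (rule someI_ex)
  then show ?thesis unfolding rep_poly_def ev_mod_\<mu>[OF \<zeta>_in_Z] by simp
qed

lemma degree_rep_poly: "degree (rep_poly x) < d"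
proof (cases "rep_poly x = 0")
  case False
  then show ?thesis using degree_mod_less[OF \<mu>(1), of "SOME g. x = ev g \<zeta>"]
    unfolding rep_poly_def degree_\<mu>_d by auto
qed (simp add: d_pos)

lemma \<sigma>_ev: "z \<in> Z \<Longrightarrow> \<sigma> z (ev g \<zeta>) = ev g z"
proof -
  assume z: "z \<in> Z"
  have "ev (rep_poly (ev g \<zeta>) - g) \<zeta> = 0" by (simp add: ev_diff ev_rep_poly ev_in_K)
  then have "ev (rep_poly (ev g \<zeta>) - g) z = 0" using ev_vanishes_on_Z z by blast
  then show ?thesis by (simp add: \<sigma>_def ev_diff)
qed

lemma \<sigma>_add: "z \<in> Z \<Longrightarrow> x \<in> K \<Longrightarrow> y \<in> K \<Longrightarrow> \<sigma> z (x + y) = \<sigma> z x + \<sigma> z y"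
proof -
  assume z: "z \<in> Z" and "x \<in> K" "y \<in> K"
  then obtain g h where "x = ev g \<zeta>" "y = ev h \<zeta>" by (auto simp: K_eq)
  then show ?thesis using \<sigma>_ev[OF z, of "g + h"] z by (simp add: ev_add \<sigma>_ev)
qed

lemma \<sigma>_mult: "z \<in> Z \<Longrightarrow> x \<in> K \<Longrightarrow> y \<in> K \<Longrightarrow> \<sigma> z (x * y) = \<sigma> z x * \<sigma> z y"
proof -
  assume z: "z \<in> Z" and "x \<in> K" "y \<in> K"
  then obtain g h where "x = ev g \<zeta>" "y = ev h \<zeta>" by (auto simp: K_eq)
  then show ?thesis using \<sigma>_ev[OF z, of "g * h"] z by (simp add: ev_mult \<sigma>_ev)
qed

lemma \<sigma>_of_rat: "z \<in> Z \<Longrightarrow> \<sigma> z (of_rat r) = of_rat r"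
  using \<sigma>_ev[of z "[:r:]"] by (simp add: ev_const)

lemma \<sigma>_0: "z \<in> Z \<Longrightarrow> \<sigma> z 0 = 0" and \<sigma>_1: "z \<in> Z \<Longrightarrow> \<sigma> z 1 = 1"
  using \<sigma>_of_rat[of z 0] \<sigma>_of_rat[of z 1] by auto

lemma \<sigma>_\<zeta>: "z \<in> Z \<Longrightarrow> \<sigma> z \<zeta> = z"
  using \<sigma>_ev[of z "[:0, 1:]"] by (simp add: ev_X)

lemma \<sigma>_power: "z \<in> Z \<Longrightarrow> x \<in> K \<Longrightarrow> \<sigma> z (x ^ n) = \<sigma> z x ^ n"
  by (induction n) (auto simp: \<sigma>_1 \<sigma>_mult K_power)

lemma \<sigma>_prod: "z \<in> Z \<Longrightarrow> (\<And>i. i \<in> I \<Longrightarrow> f i \<in> K) \<Longrightarrow> \<sigma> z (prod f I) = (\<Prod>i\<in>I. \<sigma> z (f i))"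
  by (induction I rule: infinite_finite_induct) (auto simp: \<sigma>_1 \<sigma>_mult K_prod)

lemma \<sigma>_sum: "z \<in> Z \<Longrightarrow> (\<And>i. i \<in> I \<Longrightarrow> f i \<in> K) \<Longrightarrow> \<sigma> z (sum f I) = (\<Sum>i\<in>I. \<sigma> z (f i))"
  by (induction I rule: infinite_finite_induct) (auto simp: \<sigma>_0 \<sigma>_add K_sum)

lemma \<sigma>_eq_0_iff: "z \<in> Z \<Longrightarrow> x \<in> K \<Longrightarrow> \<sigma> z x = 0 \<longleftrightarrow> x = 0"
  by (auto simp: K_eq \<sigma>_ev ev_eq_0_iff_on_Z \<sigma>_0)

lemma \<sigma>_\<zeta>_id: "x \<in> K \<Longrightarrow> \<sigma> \<zeta> x = x"
  by (auto simp: K_eq \<sigma>_ev \<zeta>_in_Z)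

lemma Z_in_K: "z \<in> Z \<Longrightarrow> z \<in> K" using Z_OK OK_in_K by blast

lemma ev_Z_in_K: "z \<in> Z \<Longrightarrow> ev g z \<in> K"
proof -
  assume "z \<in> Z"
  then obtain h where "z = ev h \<zeta>" using Z_in_K K_eq by auto
  then show ?thesis using ev_in_K[of "pcompose g h"] by (simp add: ev_pcompose)
qed

lemma \<sigma>_in_K: "z \<in> Z \<Longrightarrow> \<sigma> z x \<in> K"
  by (simp add: \<sigma>_def ev_Z_in_K)

lemma \<sigma>_ev_general: "z \<in> Z \<Longrightarrow> x \<in> K \<Longrightarrow> \<sigma> z (ev g x) = ev g (\<sigma> z x)"
  by (auto simp: K_eq \<sigma>_ev simp flip: ev_pcompose)

lemma \<sigma>_in_OK: "z \<in> Z \<Longrightarrow> x \<in> OK \<Longrightarrow> \<sigma> z x \<in> OK"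
proof -
  assume z: "z \<in> Z" and x: "x \<in> OK"
  then obtain q :: "int poly" where q: "poly (map_poly of_int q) x = 0" "lead_coeff q = 1"
    by (auto simp: OK_def algebraic_int_altdef_ipoly)
  have ev: "ev (map_poly of_int q) y = poly (map_poly of_int q) y" for y
    by (simp add: map_poly_map_poly o_def)
  have "poly (map_poly of_int q) (\<sigma> z x) = \<sigma> z (poly (map_poly of_int q) x)"
    unfolding ev[symmetric] using z x OK_in_K by (simp add: \<sigma>_ev_general)
  then have "poly (map_poly of_int q) (\<sigma> z x) = 0" using q z by (simp add: \<sigma>_0)
  then show ?thesis using q(2) z by (auto simp: OK_def algebraic_int_altdef_ipoly \<sigma>_in_K)
qed

lemma cnj_Z: "z \<in> Z \<Longrightarrow> cnj z = z ^ (m - 1)"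
proof -
  assume "z \<in> Z"
  then have zm: "z ^ m = 1" using Z_subset_U by (auto simp: U_def)
  then have "norm z = 1" using power_eq_1_iff[of z m] m_pos by blast
  then have "cnj z * z = 1" using complex_norm_square[of z] by (simp add: mult.commute)
  moreover have "z ^ (m - 1) * z = 1" using zm power_minus_mult[OF m_pos, of z] by simp
  ultimately show ?thesis by (metis mult_cancel_right mult_zero_right zero_neq_one)
qed

lemma cnj_ev: "cnj (ev g z) = ev g (cnj z)"
proof (induction g)
  case (pCons a g)
  have "cnj (of_rat a) = (of_rat a :: complex)"
    by (induction a) (simp add: of_rat_rat)
  then show ?case using pCons by (simp add: ev_pCons)
qed simp

lemma cnj_K: "x \<in> K \<Longrightarrow> cnj x \<in> K"
proof -
  assume "x \<in> K"
  then obtain g where "x = ev g \<zeta>" by (auto simp: K_eq)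
  then have "cnj x = ev (pcompose g (monom 1 (m - 1))) \<zeta>"
    by (simp add: cnj_ev cnj_Z \<zeta>_in_Z ev_pcompose ev_monom)
  then show ?thesis by (simp add: ev_in_K)
qed

text \<open>On every conjugate, complex conjugation is the same polynomial map z -> z^(m-1), so it
  commutes with all conjugation maps. This is what turns the trace form into a Hermitian sum of
  squares.\<close>

lemma \<sigma>_cnj: "z \<in> Z \<Longrightarrow> x \<in> K \<Longrightarrow> \<sigma> z (cnj x) = cnj (\<sigma> z x)"
proof -
  assume z: "z \<in> Z" and "x \<in> K"
  then obtain g where g: "x = ev g \<zeta>" by (auto simp: K_eq)
  then have "cnj x = ev (pcompose g (monom 1 (m - 1))) \<zeta>"
    by (simp add: cnj_ev cnj_Z \<zeta>_in_Z ev_pcompose ev_monom)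
  then have "\<sigma> z (cnj x) = ev (pcompose g (monom 1 (m - 1))) z" by (simp only: \<sigma>_ev[OF z])
  then show ?thesis using g z by (simp add: \<sigma>_ev cnj_ev cnj_Z ev_pcompose ev_monom)
qed

lemma ev_eq_sum: "degree g < n \<Longrightarrow> ev g z = (\<Sum>i<n. of_rat (coeff g i) * z ^ i)"
proof -
  assume "degree g < n"
  then have "degree (map_poly of_rat g :: complex poly) < n"
    by (subst degree_map_poly) auto
  then show ?thesis
    by (subst poly_altdef, subst sum.mono_neutral_left[of "{..<n}"])
      (auto simp: coeff_map_poly coeff_eq_0 not_le)
qed

section \<open>Norm and trace\<close>

definition rcoeff :: "complex \<Rightarrow> nat \<Rightarrow> rat" where "rcoeff x i = coeff (rep_poly x) i"

lemma \<sigma>_expansion: "\<sigma> z x = (\<Sum>i<d. of_rat (rcoeff x i) * z ^ i)"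
  unfolding \<sigma>_def rcoeff_def by (rule ev_eq_sum[OF degree_rep_poly])

lemma K_expansion: "x \<in> K \<Longrightarrow> x = (\<Sum>i<d. of_rat (rcoeff x i) * \<zeta> ^ i)"
  using \<sigma>_expansion[of \<zeta> x] \<sigma>_\<zeta>_id by simp

text \<open>The norm of \<open>x\<close>, being invariant under all \<open>\<sigma> w\<close>, is rational.\<close>

lemma norm_in_OK_rational:
  assumes x: "x \<in> OK"
  shows "\<exists>k::int. (\<Prod>z\<in>Z. \<sigma> z x) = of_int k"
proof -
  define N where "N = (\<Prod>z\<in>Z. \<sigma> z x)"
  have NK: "N \<in> OK" unfolding N_def using x by (intro OK_prod \<sigma>_in_OK)
  have inv: "\<sigma> w N = N" if w: "w \<in> Z" for w
  proof -
    have maps: "\<sigma> w z \<in> Z" if z: "z \<in> Z" for z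
      using \<sigma>_ev_general[OF w Z_in_K[OF z], of \<mu>] z w by (simp add: Z_def \<sigma>_0[OF w])
    have inj: "inj_on (\<sigma> w) Z"
    proof (rule inj_onI)
      fix z y assume zy: "z \<in> Z" "y \<in> Z" "\<sigma> w z = \<sigma> w y"
      have "\<sigma> w (z + - y) = 0"
        using \<sigma>_add[OF w, of z "- y"] \<sigma>_mult[OF w, of "-1" y] \<sigma>_of_rat[OF w, of "-1"] zy Z_in_K K_uminus K_1 by simp
      then have "z + - y = 0" using \<sigma>_eq_0_iff[OF w, of "z + - y"] zy by (auto simp: Z_in_K K_diff)
      then show "z = y" by simp
    qed
    have "\<sigma> w ` Z = Z" using endo_inj_surj[OF finite_Z _ inj] maps by blast
    then have bij: "bij_betw (\<sigma> w) Z Z" using inj by (simp add: bij_betw_def)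
    have "\<sigma> w N = (\<Prod>z\<in>Z. \<sigma> w (\<sigma> z x))" unfolding N_def using w by (intro \<sigma>_prod \<sigma>_in_K)
    also have "\<dots> = (\<Prod>z\<in>Z. \<sigma> (\<sigma> w z) x)"
      using \<sigma>_ev_general[OF w Z_in_K] by (intro prod.cong refl) (simp add: \<sigma>_def)
    also have "\<dots> = N" unfolding N_def by (rule prod.reindex_bij_betw[OF bij])
    finally show ?thesis .
  qed
  \<comment> \<open>At w the polynomial takes the value \<sigma> w N - N = 0. It has degree below d
    but d roots, so it vanishes identically and N equals the rational constant coefficient of its
    own representative.\<close>
  define P where "P = map_poly of_rat (rep_poly N) - [:N:]"
  have "P = 0"
  proof (rule ccontr)
    assume P0: "P \<noteq> 0"
    have "degree P < d"
      unfolding P_def using degree_rep_poly[of N] d_pos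
      by (intro degree_diff_less) (auto simp: degree_map_poly)
    moreover have "Z \<subseteq> {z. poly P z = 0}" using inv by (auto simp: P_def \<sigma>_def)
    then have "card Z \<le> card {z. poly P z = 0}" using poly_roots_finite[OF P0] by (rule card_mono[rotated])
    then have "d \<le> degree P" using card_poly_roots_bound[OF P0] card_Z by (simp add: d_def)
    ultimately show False by simp
  qed
  then have "coeff P 0 = 0" by simp
  then have N: "N = of_rat (coeff (rep_poly N) 0)" by (simp add: P_def coeff_map_poly)
  then have "coeff (rep_poly N) 0 \<in> \<int>" using NK rational_OK_is_int by metis
  then show ?thesis using N by (metis Ints_cases N_def of_rat_of_int_eq)
qed

definition sqnorm :: "complex \<Rightarrow> real" where "sqnorm x = (\<Sum>z\<in>Z. (cmod (\<sigma> z x))\<^sup>2)"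

text \<open>The norm is a nonzero integer, so the product of the squared absolute values of the
  conjugates is at least 1; the inequality of arithmetic and geometric means does the rest.\<close>

lemma sqnorm_ge_d:
  assumes x: "x \<in> OK" "x \<noteq> 0"
  shows "sqnorm x \<ge> real d"
proof -
  obtain k where k: "(\<Prod>z\<in>Z. \<sigma> z x) = of_int k" using norm_in_OK_rational[OF x(1)] by blast
  have "(\<Prod>z\<in>Z. \<sigma> z x) \<noteq> 0" using x OK_in_K finite_Z by (simp add: \<sigma>_eq_0_iff)
  then have "k \<noteq> 0" using k by auto
  then have "1 \<le> \<bar>real_of_int k\<bar>" by linarith
  also have "\<dots> = (\<Prod>z\<in>Z. cmod (\<sigma> z x))" using arg_cong[OF k, of cmod] by (simp add: prod_norm)
  finally have "1 \<le> (\<Prod>z\<in>Z. cmod (\<sigma> z x))" .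
  then have "1 \<le> (\<Prod>z\<in>Z. cmod (\<sigma> z x))\<^sup>2" by simp
  then have p: "1 \<le> (\<Prod>z\<in>Z. (cmod (\<sigma> z x))\<^sup>2)" by (simp add: prod_power_distrib)
  have cz: "card Z = d" by (simp add: card_Z d_def)
  have "1 \<le> (\<Prod>z\<in>Z. (cmod (\<sigma> z x))\<^sup>2) powr (1 / real (card Z))"
    using p by (intro ge_one_powr_ge_zero) auto
  also have "\<dots> \<le> (\<Sum>z\<in>Z. (cmod (\<sigma> z x))\<^sup>2 / real (card Z))"
    using finite_Z \<zeta>_in_Z by (intro arith_geom_mean) auto
  also have "\<dots> = (\<Sum>z\<in>Z. (cmod (\<sigma> z x))\<^sup>2) / real (card Z)" by (rule sum_divide_distrib[symmetric])
  finally show ?thesis using d_pos by (simp add: sqnorm_def cz field_simps)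
qed

definition lagrange :: "complex \<Rightarrow> complex poly" where
  "lagrange z = Polynomial.smult (1 / (\<Prod>y\<in>Z - {z}. z - y)) (\<Prod>y\<in>Z - {z}. [:- y, 1:])"

lemma poly_lagrange: "z \<in> Z \<Longrightarrow> w \<in> Z \<Longrightarrow> poly (lagrange z) w = (if w = z then 1 else 0)"
  using finite_Z by (auto simp: lagrange_def poly_prod)

lemma degree_lagrange: "z \<in> Z \<Longrightarrow> degree (lagrange z) < d"
proof -
  assume z: "z \<in> Z"
  have "degree (lagrange z) \<le> degree (\<Prod>y\<in>Z - {z}. [:- y, 1:])"
    unfolding lagrange_def by (rule degree_smult_le)
  also have "\<dots> = card (Z - {z})" by (simp add: degree_prod_eq_sum_degree)
  also have "\<dots> < card Z" using finite_Z z by (intro psubset_card_mono) auto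
  finally show ?thesis by (simp add: card_Z d_def)
qed

lemma poly_eq_sum: "degree p < n \<Longrightarrow> poly p (z :: complex) = (\<Sum>i<n. coeff p i * z ^ i)"
  by (subst poly_altdef, subst sum.mono_neutral_left[of "{..<n}"])
    (auto simp: coeff_eq_0 not_le)

lemma poly_eq_0_if_vanishes_on_Z:
  assumes "degree p < d" "\<And>z. z \<in> Z \<Longrightarrow> poly p z = 0"
  shows "p = 0"
proof (rule ccontr)
  assume p: "p \<noteq> 0"
  have "card Z \<le> card {z. poly p z = 0}"
    using poly_roots_finite[OF p] assms(2) by (intro card_mono) auto
  then have "d \<le> degree p" using card_poly_roots_bound[OF p] by (simp add: card_Z d_def)
  then show False using assms(1) by simp
qed

text \<open>The coefficients of the Lagrange polynomials form the inverse of the Vandermonde matrix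
  of \<open>Z\<close>: interpolating X^j in the d points of \<open>Z\<close> returns X^j, as j <
  d.\<close>

lemma lagrange_orthogonal:
  assumes "i < d" "j < d"
  shows "(\<Sum>z\<in>Z. z ^ j * coeff (lagrange z) i) = (if i = j then 1 else 0)"
proof -
  define p where "p = (\<Sum>z\<in>Z. Polynomial.smult (z ^ j) (lagrange z)) - monom 1 j"
  have "p = 0"
  proof (rule poly_eq_0_if_vanishes_on_Z)
    have "degree (Polynomial.smult (z ^ j) (lagrange z)) < d" if "z \<in> Z" for z
      using degree_smult_le[of "z ^ j" "lagrange z"] degree_lagrange[OF that] by linarith
    then have "degree (\<Sum>z\<in>Z. Polynomial.smult (z ^ j) (lagrange z)) < d"
      using d_pos by (intro degree_sum_less) auto
    moreover have "degree (monom (1 :: complex) j) < d"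
      using assms(2) by (simp add: degree_monom_eq)
    ultimately show "degree p < d" unfolding p_def by (rule degree_diff_less)
    fix w assume w: "w \<in> Z"
    have "poly p w = (\<Sum>z\<in>Z. if z = w then w ^ j else 0) - w ^ j"
      unfolding p_def using w by (auto simp: poly_sum poly_monom poly_lagrange intro!: sum.cong)
    then show "poly p w = 0" using w finite_Z by simp
  qed
  then have "coeff p i = 0" by simp
  then show ?thesis by (auto simp: p_def coeff_sum)
qed

lemma rat_subspace_K: "ratvs.subspace K"
  by (auto simp: ratvs.subspace_def K_0 K_add K_mult K_of_rat)

lemma rat_span_powers: "rat_span ((\<lambda>i. \<zeta> ^ i) ` {..<d}) = K"
proof (intro equalityI subsetI)
  fix x assume "x \<in> rat_span ((\<lambda>i. \<zeta> ^ i) ` {..<d})"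
  moreover have "(\<lambda>i. \<zeta> ^ i) ` {..<d} \<subseteq> K" by (auto simp: K_power K_\<zeta>)
  ultimately show "x \<in> K" using ratvs.span_minimal[OF _ rat_subspace_K] by blast
next
  fix x assume "x \<in> K"
  then have "x = (\<Sum>i<d. of_rat (rcoeff x i) * \<zeta> ^ i)" by (rule K_expansion)
  also have "\<dots> \<in> rat_span ((\<lambda>i. \<zeta> ^ i) ` {..<d})"
    by (intro ratvs.span_sum ratvs.span_scale ratvs.span_base) auto
  finally show "x \<in> rat_span ((\<lambda>i. \<zeta> ^ i) ` {..<d})" .
qed

lemma rat_basis_exists: "\<exists>B. rat_basis K B"
proof -
  obtain B where B: "B \<subseteq> K" "rat_independent B" "K \<subseteq> rat_span B"
    using ratvs.maximal_independent_subset[of K] unfolding rat_independent_def by auto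
  then have "rat_span B = K" using ratvs.span_minimal[OF _ rat_subspace_K] by blast
  then show ?thesis using B by (auto simp: rat_basis_def)
qed

lemma finite_rat_basis: "rat_basis K B \<Longrightarrow> finite B"
proof -
  assume B: "rat_basis K B"
  then have "B \<subseteq> rat_span ((\<lambda>i. \<zeta> ^ i) ` {..<d})"
    unfolding rat_span_powers using ratvs.span_superset[of B] by (auto simp: rat_basis_def)
  then show ?thesis
    using ratvs.independent_span_bound[of "(\<lambda>i. \<zeta> ^ i) ` {..<d}" B] B by (auto simp: rat_basis_def rat_independent_def)
qed

lemma sum_rat_representation:
  assumes B: "rat_basis K B" and x: "x \<in> K"
  shows "(\<Sum>b\<in>B. of_rat (rat_representation B x b) * b) = x"
  using ratvs.sum_representation_eq[of B x B] B x finite_rat_basis[OF B] by (auto simp: rat_basis_def rat_independent_def)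

lemma rat_basis_subset: "rat_basis K B \<Longrightarrow> B \<subseteq> K"
  using ratvs.span_superset[of B] by (auto simp: rat_basis_def)

lemma \<sigma>_rat_representation:
  assumes B: "rat_basis K B" and x: "x \<in> K" and z: "z \<in> Z"
  shows "\<sigma> z x = (\<Sum>b\<in>B. of_rat (rat_representation B x b) * \<sigma> z b)"
proof -
  have "\<sigma> z x = \<sigma> z (\<Sum>b\<in>B. of_rat (rat_representation B x b) * b)"
    using sum_rat_representation[OF B x] by simp
  also have "\<dots> = (\<Sum>b\<in>B. \<sigma> z (of_rat (rat_representation B x b) * b))"
    using z rat_basis_subset[OF B] by (intro \<sigma>_sum) (auto intro: K_mult K_of_rat)
  also have "\<dots> = (\<Sum>b\<in>B. of_rat (rat_representation B x b) * \<sigma> z b)"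
    using z rat_basis_subset[OF B] by (intro sum.cong refl) (subst \<sigma>_mult; auto simp: K_of_rat \<sigma>_of_rat)
  finally show ?thesis .
qed

lemma rat_representation_expansion:
  assumes B: "rat_basis K B" and x: "x \<in> K"
  shows "rat_representation B x b = (\<Sum>i<d. rcoeff x i * rat_representation B (\<zeta> ^ i) b)"
proof -
  have ind: "ratvs.independent B" and span: "rat_span B = K"
    using B by (auto simp: rat_basis_def rat_independent_def)
  have "rat_representation B x = rat_representation B (\<Sum>i<d. of_rat (rcoeff x i) * \<zeta> ^ i)"
    using K_expansion[OF x] by simp
  also have "\<dots> = (\<lambda>b. \<Sum>i<d. rat_representation B (of_rat (rcoeff x i) * \<zeta> ^ i) b)"
    using ratvs.representation_sum[OF ind, of "{..<d}" "\<lambda>i. of_rat (rcoeff x i) * \<zeta> ^ i"] span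
    by (auto simp: K_mult K_of_rat K_power K_\<zeta>)
  also have "\<dots> = (\<lambda>b. \<Sum>i<d. rcoeff x i * rat_representation B (\<zeta> ^ i) b)"
    using ratvs.representation_scale[OF ind, of "\<zeta> ^ _"] span by (auto simp: K_power K_\<zeta>)
  finally show ?thesis by (rule fun_cong)
qed

text \<open>The matrix \<open>(W z b)\<close> is the inverse of \<open>(\<sigma> z b)\<close>; it conjugates the matrix of the
  multiplication by \<open>x\<close> into the diagonal matrix of the \<open>\<sigma> z x\<close>.\<close>

lemma field_trace_eq:
  assumes x: "x \<in> K"
  shows "of_rat (field_trace K x) = (\<Sum>z\<in>Z. \<sigma> z x)"
proof -
  define B where "B = (SOME B. rat_basis K B)"
  have B: "rat_basis K B" unfolding B_def using rat_basis_exists by (rule someI_ex)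
  note BK = rat_basis_subset[OF B]
  let ?r = "rat_representation B"
  define W where "W z b = (\<Sum>i<d. coeff (lagrange z) i * of_rat (?r (\<zeta> ^ i) b))" for z b
  \<comment> \<open>In powers of \<open>\<zeta>\<close> the conjugates of y are a Vandermonde matrix
    applied to its rational coordinates, and \<open>lagrange_orthogonal\<close> inverts that
    matrix.\<close>
  have rep: "of_rat (?r y b) = (\<Sum>z\<in>Z. \<sigma> z y * W z b)" if y: "y \<in> K" for y b
  proof -
    have "(\<Sum>z\<in>Z. \<sigma> z y * W z b) =
        (\<Sum>z\<in>Z. \<Sum>j<d. \<Sum>i<d. (of_rat (rcoeff y j) * of_rat (?r (\<zeta> ^ i) b)) * (z ^ j * coeff (lagrange z) i))"
      unfolding \<sigma>_expansion W_def sum_product by (simp add: mult_ac)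
    also have "\<dots> = (\<Sum>j<d. \<Sum>i<d. \<Sum>z\<in>Z. (of_rat (rcoeff y j) * of_rat (?r (\<zeta> ^ i) b)) * (z ^ j * coeff (lagrange z) i))"
      by (subst sum.swap, intro sum.cong refl, rule sum.swap)
    also have "\<dots> = (\<Sum>j<d. \<Sum>i<d. (of_rat (rcoeff y j) * of_rat (?r (\<zeta> ^ i) b)) * (if i = j then 1 else 0))"
      unfolding sum_distrib_left[symmetric] by (intro sum.cong refl) (simp add: lagrange_orthogonal)
    also have "\<dots> = (\<Sum>j<d. of_rat (rcoeff y j * ?r (\<zeta> ^ j) b))"
      by (simp add: of_rat_mult if_distrib[of "\<lambda>c. _ * c"] cong: if_cong)
    also have "\<dots> = of_rat (?r y b)"
      unfolding rat_representation_expansion[OF B y] by (simp add: of_rat_sum)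
    finally show ?thesis ..
  qed
  have inv: "(\<Sum>b\<in>B. \<sigma> z b * W z b) = 1" if z: "z \<in> Z" for z
  proof -
    have "(\<Sum>b\<in>B. \<sigma> z b * W z b) = (\<Sum>b\<in>B. \<Sum>i<d. coeff (lagrange z) i * (of_rat (?r (\<zeta> ^ i) b) * \<sigma> z b))"
      unfolding W_def sum_distrib_left by (simp add: mult_ac)
    also have "\<dots> = (\<Sum>i<d. coeff (lagrange z) i * (\<Sum>b\<in>B. of_rat (?r (\<zeta> ^ i) b) * \<sigma> z b))"
      by (subst sum.swap) (simp add: sum_distrib_left)
    also have "\<dots> = (\<Sum>i<d. coeff (lagrange z) i * z ^ i)"
      using z by (intro sum.cong refl) (simp add: \<sigma>_rat_representation[OF B, symmetric] K_power K_\<zeta> \<sigma>_power \<sigma>_\<zeta>)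
    also have "\<dots> = poly (lagrange z) z" using degree_lagrange[OF z] by (simp add: poly_eq_sum)
    finally show ?thesis using z by (simp add: poly_lagrange)
  qed
  have "of_rat (field_trace K x) = (\<Sum>b\<in>B. of_rat (?r (x * b) b))"
    by (simp add: field_trace_def B_def[symmetric] of_rat_sum)
  also have "\<dots> = (\<Sum>b\<in>B. \<Sum>z\<in>Z. \<sigma> z x * (\<sigma> z b * W z b))"
    using x BK by (intro sum.cong refl) (simp add: rep K_mult subset_iff \<sigma>_mult mult_ac)
  also have "\<dots> = (\<Sum>z\<in>Z. \<sigma> z x * (\<Sum>b\<in>B. \<sigma> z b * W z b))"
    by (subst sum.swap) (simp add: sum_distrib_left)
  also have "\<dots> = (\<Sum>z\<in>Z. \<sigma> z x)" by (simp add: inv)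
  finally show ?thesis .
qed

text \<open>The tensor product is formed with all complex numbers, so a conjugation of
  \<open>K\<close> must first be extended Q-linearly to them before it can act there. Only its
  values on \<open>K\<close> are used afterwards.\<close>

lemma \<sigma>_linear_extension:
  assumes z: "z \<in> Z"
  shows "\<exists>g. (\<forall>x y. g (x + y) = g x + g y) \<and> (\<forall>r x. g (of_rat r * x) = of_rat r * g x) \<and> (\<forall>x\<in>K. g x = \<sigma> z x)"
proof -
  interpret vector_space_pair "\<lambda>(r::rat) (x::complex). of_rat r * x" "\<lambda>(r::rat) (x::complex). of_rat r * x" ..
  obtain B where B: "rat_basis K B" using rat_basis_exists by blast
  then have "ratvs.independent B" by (simp add: rat_basis_def rat_independent_def)
  then obtain g where g: "Vector_Spaces.linear (\<lambda>(r::rat) (x::complex). of_rat r * x) (\<lambda>(r::rat) (x::complex). of_rat r * x) g"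
    "\<And>x. x \<in> B \<Longrightarrow> g x = \<sigma> z x"
    using linear_independent_extend[of B "\<sigma> z"] by blast
  have "g x = \<sigma> z x" if x: "x \<in> K" for x
  proof -
    have "g x = g (\<Sum>b\<in>B. of_rat (rat_representation B x b) * b)" using sum_rat_representation[OF B x] by simp
    also have "\<dots> = (\<Sum>b\<in>B. of_rat (rat_representation B x b) * g b)"
      using g(1) by (simp add: linear_sum linear_scale)
    also have "\<dots> = \<sigma> z x" unfolding \<sigma>_rat_representation[OF B x z] using g(2) by (intro sum.cong) auto
    finally show ?thesis .
  qed
  then show ?thesis using linear_add[OF g(1)] linear_scale[OF g(1)] by blast
qed

end

section \<open>Rational linear maps on the tensor product\<close>

definition rat_linear :: "(complex \<Rightarrow> complex) \<Rightarrow> bool" where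
  "rat_linear g \<longleftrightarrow> (\<forall>x y. g (x + y) = g x + g y) \<and> (\<forall>r x. g (of_rat r * x) = of_rat r * g x)"

definition raw_functional :: "(complex \<Rightarrow> complex) \<Rightarrow> (complex \<Rightarrow>\<^sub>0 real) \<Rightarrow> complex" where
  "raw_functional g f = (\<Sum>a\<in>Poly_Mapping.keys f. of_real (Poly_Mapping.lookup f a) * g a)"

lemma raw_functional_superset:
  "finite A \<Longrightarrow> Poly_Mapping.keys f \<subseteq> A \<Longrightarrow>
    raw_functional g f = (\<Sum>a\<in>A. of_real (Poly_Mapping.lookup f a) * g a)"
  unfolding raw_functional_def by (rule sum.mono_neutral_left) (auto simp: in_keys_iff)

lemma raw_functional_add: "raw_functional g (f + h) = raw_functional g f + raw_functional g h"
proof -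
  let ?A = "Poly_Mapping.keys f \<union> Poly_Mapping.keys h"
  have "finite ?A" "Poly_Mapping.keys f \<subseteq> ?A" "Poly_Mapping.keys h \<subseteq> ?A" "Poly_Mapping.keys (f + h) \<subseteq> ?A"
    using keys_add[of f h] by auto
  then show ?thesis
    by (simp add: raw_functional_superset[of ?A] lookup_add algebra_simps sum.distrib)
qed

lemma raw_functional_uminus: "raw_functional g (- f) = - raw_functional g f"
  by (simp add: raw_functional_def sum_negf)

lemma raw_functional_diff: "raw_functional g (f - h) = raw_functional g f - raw_functional g h"
  using raw_functional_add[of g f "- h"] by (simp add: raw_functional_uminus)

lemma raw_functional_scale: "raw_functional g (Poly_Mapping.map ((*) r) f) = of_real r * raw_functional g f"
proof -
  have "Poly_Mapping.keys (Poly_Mapping.map ((*) r) f) \<subseteq> Poly_Mapping.keys f"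
    by (auto simp: in_keys_iff lookup_map_times)
  then show ?thesis
    by (simp add: raw_functional_superset[of "Poly_Mapping.keys f"] lookup_map_times sum_distrib_left mult.assoc)
qed

lemma raw_functional_single: "raw_functional g (Poly_Mapping.single a s) = of_real s * g a"
  by (simp add: raw_functional_def)

lemma raw_functional_relations:
  assumes "rat_linear g" "f \<in> tensor_relations"
  shows "raw_functional g f = 0"
  using assms(2)
proof (induction rule: tensor_relations.induct)
  case zero
  then show ?case by (simp add: raw_functional_def)
next
  case (balanced r a s)
  have "(of_real (of_rat r) :: complex) = of_rat r" by (induction r) (simp add: of_rat_rat)
  then show ?case using assms(1) by (simp add: raw_functional_diff raw_functional_single rat_linear_def)
qed (use assms(1) in \<open>auto simp: raw_functional_add raw_functional_uminus raw_functional_diff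
      raw_functional_single rat_linear_def algebra_simps\<close>)

text \<open>The map a \<otimes> s -> s g(a). The value 0 for other g makes the lifting respect the
  relations for every g, so additivity and homogeneity carry no side condition.\<close>

lift_definition functional :: "(complex \<Rightarrow> complex) \<Rightarrow> ctensor \<Rightarrow> complex"
  is "\<lambda>g f. if rat_linear g then raw_functional g f else 0"
  using raw_functional_relations by (fastforce simp: raw_functional_diff)

lemma functional_add: "functional g (x + y) = functional g x + functional g y"
  by transfer (simp add: raw_functional_add)

lemma functional_scaleR: "functional g (r *\<^sub>R x) = of_real r * functional g x"
  by transfer (simp add: raw_functional_scale)

lemma functional_tensor: "rat_linear g \<Longrightarrow> functional g (tensor a s) = of_real s * g a"
  by transfer (simp add: raw_functional_single)

section \<open>The trace form on the real extension\<close>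

lemma of_real_of_rat: "(of_real (of_rat r) :: complex) = of_rat r"
  by (induction r) (simp add: of_rat_rat)

lemma sum_lessThan_add: "(\<Sum>k<a + b. f k) = (\<Sum>k<a. f k) + (\<Sum>k<b. f (a + k :: nat) :: 'a::comm_monoid_add)"
  by (induction b) (simp_all add: add.assoc)

lemma tensor_zero_left: "tensor 0 s = 0"
  using tensor_add_left[of 0 0 s] by simp

lemma tensor_sum_left: "tensor (sum f I) s = (\<Sum>i\<in>I. tensor (f i) s)"
  by (induction I rule: infinite_finite_induct) (simp_all add: tensor_zero_left tensor_add_left)

lemma tensor_of_rat_mult: "tensor (of_rat r * a) 1 = of_rat r *\<^sub>R tensor a 1"
  by (simp add: tensor_of_rat_left scaleR_tensor)

lemma tensor_uminus_left: "tensor (- a) s = - tensor a s"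
  using tensor_add_left[of a "- a" s] tensor_zero_left[of s] by (simp add: eq_neg_iff_add_eq_0 add.commute)

lemma tensor_diff_left: "tensor (a - b) s = tensor a s - tensor b s"
  using tensor_add_left[of a "- b" s] by (simp add: tensor_uminus_left)

lemma functional_sum: "functional g (sum f I) = (\<Sum>i\<in>I. functional g (f i))"
proof -
  have "functional g 0 = 0" using functional_scaleR[of g 0 0] by simp
  then show ?thesis by (induction I rule: infinite_finite_induct) (simp_all add: functional_add)
qed

context cyclotomic
begin

section \<open>Conjugations and coordinates on the real extension\<close>

definition conj_extension :: "complex \<Rightarrow> complex \<Rightarrow> complex" where
  "conj_extension z = (SOME g. rat_linear g \<and> (\<forall>x\<in>K. g x = \<sigma> z x))"

lemma conj_extension: "z \<in> Z \<Longrightarrow> rat_linear (conj_extension z)" "z \<in> Z \<Longrightarrow> x \<in> K \<Longrightarrow> conj_extension z x = \<sigma> z x"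
proof -
  assume "z \<in> Z"
  then have "\<exists>g. rat_linear g \<and> (\<forall>x\<in>K. g x = \<sigma> z x)"
    using \<sigma>_linear_extension unfolding rat_linear_def by blast
  then have "rat_linear (conj_extension z) \<and> (\<forall>x\<in>K. conj_extension z x = \<sigma> z x)" unfolding conj_extension_def by (rule someI_ex)
  then show "rat_linear (conj_extension z)" "x \<in> K \<Longrightarrow> conj_extension z x = \<sigma> z x" by auto
qed

definition conj_real :: "complex \<Rightarrow> ctensor \<Rightarrow> complex" where "conj_real z = functional (conj_extension z)"

lemma conj_real_tensor: "z \<in> Z \<Longrightarrow> x \<in> K \<Longrightarrow> conj_real z (tensor x s) = of_real s * \<sigma> z x"
  by (simp add: conj_real_def functional_tensor conj_extension)

lemma conj_real_add: "conj_real z (x + y) = conj_real z x + conj_real z y"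
  by (simp add: conj_real_def functional_add)

lemma conj_real_scaleR: "conj_real z (r *\<^sub>R x) = of_real r * conj_real z x"
  by (simp add: conj_real_def functional_scaleR)

lemma conj_real_sum: "conj_real z (sum f I) = (\<Sum>i\<in>I. conj_real z (f i))"
  by (simp add: conj_real_def functional_sum)

lemma conj_real_0: "conj_real z 0 = 0" using conj_real_scaleR[of z 0 0] by simp

abbreviation E1 :: "ctensor set" where "E1 \<equiv> real_extension K"

text \<open>Coordinates in the real basis y, y \<zeta>, ..., y \<zeta>^(d-1), for y nonzero. The
  parameter y allows rounding to multiples of y, which the covering modulo an ideal y OK calls
  for.\<close>

definition comb :: "complex \<Rightarrow> (nat \<Rightarrow> real) \<Rightarrow> ctensor" where
  "comb y t = (\<Sum>i<d. t i *\<^sub>R tensor (y * \<zeta> ^ i) 1)"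

lemma comb_add: "comb y (\<lambda>i. t i + s i) = comb y t + comb y s"
  by (simp add: comb_def scaleR_add_left sum.distrib)

lemma comb_scaleR: "comb y (\<lambda>i. c * t i) = c *\<^sub>R comb y t"
  by (simp add: comb_def scaleR_sum_right)

lemma subspace_E1: "subspace E1"
  unfolding real_extension_def by (rule subspace_span)

lemma tensor_in_E1: "x \<in> K \<Longrightarrow> tensor x 1 \<in> E1"
  unfolding real_extension_def by (intro span_base) auto

text \<open>The product of the other conjugates is the norm divided by x, and the norm is a nonzero
  integer.\<close>

lemma OK_inverse_in_K:
  assumes x: "x \<in> OK" "x \<noteq> 0"
  shows "inverse x \<in> K"
proof -
  obtain k where k: "(\<Prod>z\<in>Z. \<sigma> z x) = of_int k" using norm_in_OK_rational[OF x(1)] by blast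
  have "(\<Prod>z\<in>Z. \<sigma> z x) \<noteq> 0" using x OK_in_K finite_Z by (simp add: \<sigma>_eq_0_iff)
  then have k0: "k \<noteq> 0" using k by auto
  have "(\<Prod>z\<in>Z. \<sigma> z x) = x * (\<Prod>z\<in>Z - {\<zeta>}. \<sigma> z x)"
    using finite_Z \<zeta>_in_Z x OK_in_K by (subst prod.remove[of Z \<zeta>]) (auto simp: \<sigma>_\<zeta>_id)
  then have "inverse x * of_int k = (\<Prod>z\<in>Z - {\<zeta>}. \<sigma> z x)" using k x(2) by (simp flip: mult.assoc)
  then have "inverse x = of_rat (1 / of_int k) * (\<Prod>z\<in>Z - {\<zeta>}. \<sigma> z x)"
    using k0 by (simp add: of_rat_divide eq_divide_eq)
  moreover have "of_rat (1 / of_int k) * (\<Prod>z\<in>Z - {\<zeta>}. \<sigma> z x) \<in> K"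
    by (intro K_mult K_of_rat K_prod \<sigma>_in_K) auto
  ultimately show ?thesis by simp
qed

lemma E1_eq_comb:
  assumes y: "y \<in> OK" "y \<noteq> 0" and v: "v \<in> E1"
  shows "\<exists>t. v = comb y t"
  using v unfolding real_extension_def
proof (induction rule: span_induct_alt)
  case base
  show ?case by (rule exI[of _ "\<lambda>_. 0"]) (simp add: comb_def)
next
  case (step c x v)
  then obtain a t where a: "a \<in> K" "x = tensor a 1" and t: "v = comb y t" by auto
  have "inverse y * a \<in> K" using OK_inverse_in_K[OF y] a by (intro K_mult)
  then have "inverse y * a = (\<Sum>i<d. of_rat (rcoeff (inverse y * a) i) * \<zeta> ^ i)" by (rule K_expansion)
  then have "y * (inverse y * a) = y * (\<Sum>i<d. of_rat (rcoeff (inverse y * a) i) * \<zeta> ^ i)" by simp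
  then have "a = (\<Sum>i<d. of_rat (rcoeff (inverse y * a) i) * (y * \<zeta> ^ i))"
    using y(2) by (simp add: sum_distrib_left mult_ac flip: mult.assoc)
  then have "x = comb y (\<lambda>i. of_rat (rcoeff (inverse y * a) i))"
    unfolding a(2) comb_def by (metis (no_types, lifting) sum.cong tensor_of_rat_mult tensor_sum_left)
  then have "c *\<^sub>R x + v = comb y (\<lambda>i. c * of_rat (rcoeff (inverse y * a) i) + t i)"
    by (simp add: comb_add comb_scaleR t)
  then show ?case by blast
qed

lemma conj_real_comb_1: "z \<in> Z \<Longrightarrow> conj_real z (comb 1 t) = (\<Sum>i<d. of_real (t i) * z ^ i)"
  by (simp add: comb_def conj_real_sum conj_real_scaleR conj_real_tensor K_power K_\<zeta> \<sigma>_power \<sigma>_\<zeta>)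

text \<open>The coordinates are the coefficients of a polynomial of degree below d that vanishes at
  all d conjugates. This gives both the independence of the power basis over the reals and the
  definiteness of the trace form.\<close>

lemma conj_real_comb_eq_0:
  assumes "\<And>z. z \<in> Z \<Longrightarrow> conj_real z (comb 1 t) = 0" and i: "i < d"
  shows "t i = 0"
proof -
  define p :: "complex poly" where "p = (\<Sum>i<d. monom (of_real (t i)) i)"
  have "p = 0"
  proof (rule poly_eq_0_if_vanishes_on_Z)
    have "degree (monom (of_real (t i)) i :: complex poly) < d" if "i < d" for i
      using degree_monom_le[of "of_real (t i) :: complex" i] that by linarith
    then show "degree p < d" unfolding p_def using d_pos by (intro degree_sum_less) auto
    show "poly p z = 0" if "z \<in> Z" for z
      using assms(1)[OF that] that by (simp add: p_def poly_sum poly_monom conj_real_comb_1)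
  qed
  then have "coeff p i = 0" by simp
  then show ?thesis using i by (simp add: p_def coeff_sum if_distrib cong: if_cong)
qed

lemma conj_real_eq_0_imp:
  assumes x: "x \<in> E1" "\<And>z. z \<in> Z \<Longrightarrow> conj_real z x = 0"
  shows "x = 0"
proof -
  obtain t where t: "x = comb 1 t" using E1_eq_comb[OF OK_1 _ x(1)] by auto
  then have "t i = 0" if "i < d" for i using conj_real_comb_eq_0 x(2) that by blast
  then show ?thesis unfolding t comb_def by simp
qed

lemma E1_expansion:
  assumes "x \<in> E1"
  shows "\<exists>A f. finite A \<and> A \<subseteq> K \<and> x = (\<Sum>a\<in>A. tensor a (f a))"
proof -
  obtain t where t: "x = comb 1 t" using E1_eq_comb[OF OK_1 _ assms] by auto
  have "{..<d} \<subseteq> {..<m}" using totient_le[of m] by (auto simp: d_def)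
  then have inj: "inj_on (\<lambda>i. \<zeta> ^ i) {..<d}" using \<zeta>_power_inj inj_on_subset by blast
  let ?A = "(\<lambda>i. \<zeta> ^ i) ` {..<d}"
  let ?f = "\<lambda>a. t (the_inv_into {..<d} (\<lambda>i. \<zeta> ^ i) a)"
  have "(\<Sum>a\<in>?A. tensor a (?f a)) = (\<Sum>i<d. tensor (\<zeta> ^ i) (t i))"
    by (subst sum.reindex[OF inj]) (auto simp: the_inv_into_f_f[OF inj])
  also have "\<dots> = x" by (simp add: t comb_def scaleR_tensor)
  finally show ?thesis by (intro exI[of _ ?A] exI[of _ ?f]) (auto simp: K_power K_\<zeta>)
qed

lemma trace_form_eq:
  assumes x: "x \<in> E1" and y: "y \<in> E1"
  shows "of_real (trace_form K x y) = (\<Sum>z\<in>Z. conj_real z x * cnj (conj_real z y))"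
proof -
  let ?P = "\<lambda>v. \<exists>A B f g. finite A \<and> A \<subseteq> K \<and> finite B \<and> B \<subseteq> K \<and>
        x = (\<Sum>a\<in>A. tensor a (f a)) \<and> y = (\<Sum>b\<in>B. tensor b (g b)) \<and>
        v = (\<Sum>a\<in>A. \<Sum>b\<in>B. f a * g b * of_rat (field_trace K (a * cnj b)))"
  have val: "of_real v = (\<Sum>z\<in>Z. conj_real z x * cnj (conj_real z y))" if v: "?P v" for v
  proof -
    obtain A B f g where AB: "finite A" "A \<subseteq> K" "finite B" "B \<subseteq> K"
      "x = (\<Sum>a\<in>A. tensor a (f a))" "y = (\<Sum>b\<in>B. tensor b (g b))"
      "v = (\<Sum>a\<in>A. \<Sum>b\<in>B. f a * g b * of_rat (field_trace K (a * cnj b)))" using v by blast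
    have "(of_real v :: complex) = (\<Sum>a\<in>A. \<Sum>b\<in>B. of_real (f a) * of_real (g b) * (\<Sum>z\<in>Z. \<sigma> z a * cnj (\<sigma> z b)))"
      unfolding AB(7) of_real_sum of_real_mult of_real_of_rat
    proof (intro sum.cong refl)
      fix a b assume "a \<in> A" "b \<in> B"
      then have ab: "a \<in> K" "b \<in> K" using AB by auto
      have "of_rat (field_trace K (a * cnj b)) = (\<Sum>z\<in>Z. \<sigma> z a * cnj (\<sigma> z b))"
        using ab by (simp add: field_trace_eq K_mult cnj_K \<sigma>_mult \<sigma>_cnj)
      then show "of_real (f a) * of_real (g b) * of_rat (field_trace K (a * cnj b)) =
          of_real (f a) * of_real (g b) * (\<Sum>z\<in>Z. \<sigma> z a * cnj (\<sigma> z b))" by simp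
    qed
    also have "\<dots> = (\<Sum>a\<in>A. \<Sum>b\<in>B. \<Sum>z\<in>Z. (of_real (f a) * \<sigma> z a) * (of_real (g b) * cnj (\<sigma> z b)))"
      by (simp add: sum_distrib_left mult_ac)
    also have "\<dots> = (\<Sum>a\<in>A. \<Sum>z\<in>Z. \<Sum>b\<in>B. (of_real (f a) * \<sigma> z a) * (of_real (g b) * cnj (\<sigma> z b)))"
      by (rule sum.cong[OF refl], rule sum.swap)
    also have "\<dots> = (\<Sum>z\<in>Z. \<Sum>a\<in>A. \<Sum>b\<in>B. (of_real (f a) * \<sigma> z a) * (of_real (g b) * cnj (\<sigma> z b)))"
      by (rule sum.swap)
    also have "\<dots> = (\<Sum>z\<in>Z. (\<Sum>a\<in>A. of_real (f a) * \<sigma> z a) * (\<Sum>b\<in>B. of_real (g b) * cnj (\<sigma> z b)))"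
      by (simp add: sum_product)
    also have "\<dots> = (\<Sum>z\<in>Z. conj_real z x * cnj (conj_real z y))"
    proof (intro sum.cong refl)
      fix z assume z: "z \<in> Z"
      have "conj_real z x = (\<Sum>a\<in>A. of_real (f a) * \<sigma> z a)"
        unfolding AB(5) conj_real_sum using z AB(2) by (intro sum.cong refl conj_real_tensor) auto
      moreover have "conj_real z y = (\<Sum>b\<in>B. of_real (g b) * \<sigma> z b)"
        unfolding AB(6) conj_real_sum using z AB(4) by (intro sum.cong refl conj_real_tensor) auto
      ultimately show "(\<Sum>a\<in>A. of_real (f a) * \<sigma> z a) * (\<Sum>b\<in>B. of_real (g b) * cnj (\<sigma> z b)) = conj_real z x * cnj (conj_real z y)"
        by (simp add: cnj_sum)
    qed
    finally show ?thesis .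
  qed
  obtain A f where A: "finite A" "A \<subseteq> K" "x = (\<Sum>a\<in>A. tensor a (f a))" using E1_expansion[OF x] by blast
  obtain B g where B: "finite B" "B \<subseteq> K" "y = (\<Sum>b\<in>B. tensor b (g b))" using E1_expansion[OF y] by blast
  define v0 where "v0 = (\<Sum>a\<in>A. \<Sum>b\<in>B. f a * g b * of_rat (field_trace K (a * cnj b)))"
  have P0: "?P v0" unfolding v0_def using A B by blast
  have "trace_form K x y = v0"
    unfolding trace_form_def
  proof (rule the_equality)
    show "?P v0" by (rule P0)
    fix v assume "?P v"
    then have "(of_real v :: complex) = of_real v0" using val P0 by simp
    then show "v = v0" by (simp only: of_real_eq_iff)
  qed
  then show ?thesis using val[OF P0] by simp
qed

lemma trace_form_self:
  assumes "x \<in> E1"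
  shows "trace_form K x x = (\<Sum>z\<in>Z. (cmod (conj_real z x))\<^sup>2)"
proof -
  have "(of_real (trace_form K x x) :: complex) = of_real (\<Sum>z\<in>Z. (cmod (conj_real z x))\<^sup>2)"
    unfolding trace_form_eq[OF assms assms] of_real_sum complex_norm_square ..
  then show ?thesis by (simp only: of_real_eq_iff)
qed

lemma trace_form_pos: "x \<in> E1 \<Longrightarrow> x \<noteq> 0 \<Longrightarrow> trace_form K x x > 0"
  using conj_real_eq_0_imp[of x] finite_Z
  by (auto simp: trace_form_self intro!: sum_pos2 sum_nonneg less_le[THEN iffD2]) 
    (metis (no_types, lifting) norm_eq_zero power_eq_0_iff sum_nonneg_eq_0_iff zero_le_power2)

lemma trace_form_bilinear:
  assumes x: "x \<in> E1" and y: "y \<in> E1" and z: "z \<in> E1"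
  shows "trace_form K (x + y) z = trace_form K x z + trace_form K y z"
    and "trace_form K (r *\<^sub>R x) z = r * trace_form K x z"
    and "trace_form K x z = trace_form K z x"
proof -
  have xy: "x + y \<in> E1" "r *\<^sub>R x \<in> E1"
    using x y subspace_E1 by (auto intro: subspace_add subspace_scale)
  have "(of_real (trace_form K (x + y) z) :: complex) = of_real (trace_form K x z + trace_form K y z)"
    using x y z xy by (simp add: trace_form_eq conj_real_add algebra_simps sum.distrib)
  then show "trace_form K (x + y) z = trace_form K x z + trace_form K y z" by (simp only: of_real_eq_iff)
  have "(of_real (trace_form K (r *\<^sub>R x) z) :: complex) = of_real (r * trace_form K x z)"
    using x y z xy by (simp add: trace_form_eq conj_real_scaleR algebra_simps sum_distrib_left)
  then show "trace_form K (r *\<^sub>R x) z = r * trace_form K x z" by (simp only: of_real_eq_iff)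
  have "(of_real (trace_form K x z) :: complex) = cnj (of_real (trace_form K x z))" by simp
  also have "\<dots> = of_real (trace_form K z x)"
    using x z by (subst (1 2) trace_form_eq) (auto simp: cnj_sum mult.commute)
  finally show "trace_form K x z = trace_form K z x" by (simp only: of_real_eq_iff)
qed

section \<open>The Euclidean space of pairs\<close>

definition power_basis :: "complex \<Rightarrow> nat \<Rightarrow> ctensor \<times> ctensor" where
  "power_basis y k = (if k < d then (tensor (y * \<zeta> ^ k) 1, 0) else (0, tensor (y * \<zeta> ^ (k - d)) 1))"

lemma sum_power_basis: "(\<Sum>k<d + d. u k *\<^sub>R power_basis y k) = (comb y u, comb y (\<lambda>i. u (d + i)))"
proof -
  have "(\<Sum>k<d. u k *\<^sub>R power_basis y k) = (comb y u, 0)" for u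
    by (simp add: power_basis_def comb_def prod_eq_iff fst_sum snd_sum)
  moreover have "(\<Sum>k<d. u (d + k) *\<^sub>R power_basis y (d + k)) = (0, comb y (\<lambda>i. u (d + i)))"
    by (simp add: power_basis_def comb_def prod_eq_iff fst_sum snd_sum)
  ultimately show ?thesis unfolding sum_lessThan_add by simp
qed

lemma subspace_code_space: "subspace (code_space K)"
  unfolding code_space_def by (intro subspace_Times subspace_E1)

lemma span_power_basis: "code_space K = span (power_basis 1 ` {..<d + d})"
proof (intro equalityI subsetI)
  fix x assume "x \<in> code_space K"
  then obtain t s where ts: "x = (comb 1 t, comb 1 s)"
    using E1_eq_comb[OF OK_1] by (fastforce simp: code_space_def)
  have "x = (\<Sum>k<d + d. (if k < d then t k else s (k - d)) *\<^sub>R power_basis 1 k)"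
    unfolding sum_power_basis ts by (simp add: comb_def)
  also have "\<dots> \<in> span (power_basis 1 ` {..<d + d})" by (intro span_sum span_scale span_base) auto
  finally show "x \<in> span (power_basis 1 ` {..<d + d})" .
next
  fix x assume "x \<in> span (power_basis 1 ` {..<d + d})"
  moreover have "power_basis 1 ` {..<d + d} \<subseteq> code_space K"
    using subspace_0[OF subspace_E1] by (auto simp: power_basis_def code_space_def intro!: tensor_in_E1 K_power K_\<zeta>)
  ultimately show "x \<in> code_space K" using span_minimal[OF _ subspace_code_space] by blast
qed

lemma power_basis_coeffs_zero:
  assumes "(\<Sum>k<d + d. u k *\<^sub>R power_basis 1 k) = 0" "k < d + d"
  shows "u k = 0"
proof (cases "k < d")
  case True
  then show ?thesis using conj_real_comb_eq_0[of u k] assms(1) by (simp add: sum_power_basis zero_prod_def conj_real_0)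
next
  case False
  then show ?thesis using conj_real_comb_eq_0[of "\<lambda>i. u (d + i)" "k - d"] assms by (simp add: sum_power_basis zero_prod_def conj_real_0)
qed

lemma inj_power_basis: "inj_on (power_basis 1) {..<d + d}"
proof (rule inj_onI)
  fix k l assume kl: "k \<in> {..<d + d}" "l \<in> {..<d + d}" "power_basis 1 k = power_basis 1 l"
  have "(\<Sum>j<d + d. ((if j = k then 1 else 0) - (if j = l then 1 else 0)) *\<^sub>R power_basis 1 j) = power_basis 1 k - power_basis 1 l"
    using kl by (simp add: scaleR_diff_left sum_subtractf if_distrib[of "\<lambda>c. c *\<^sub>R _"] cong: if_cong)
  then have "(\<Sum>j<d + d. ((if j = k then 1 else 0) - (if j = l then 1 else 0)) *\<^sub>R power_basis 1 j) = 0" using kl by simp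
  from power_basis_coeffs_zero[OF this, of k] show "k = l" using kl by (auto split: if_splits)
qed

lemma dim_code_space: "dim (code_space K) = 2 * d"
proof -
  have "independent (power_basis 1 ` {..<d + d})"
  proof (rule independent_if_scalars_zero)
    fix f x assume f: "(\<Sum>v\<in>power_basis 1 ` {..<d + d}. f v *\<^sub>R v) = 0" and x: "x \<in> power_basis 1 ` {..<d + d}"
    then obtain k where k: "k < d + d" "x = power_basis 1 k" by auto
    have "(\<Sum>k<d + d. f (power_basis 1 k) *\<^sub>R power_basis 1 k) = 0" using f by (simp add: sum.reindex[OF inj_power_basis])
    then show "f x = 0" using power_basis_coeffs_zero[of "\<lambda>k. f (power_basis 1 k)"] k by simp
  qed simp
  then have "dim (code_space K) = card (power_basis 1 ` {..<d + d})"
    unfolding span_power_basis dim_span by (rule dim_eq_card_independent)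
  then show ?thesis using card_image[OF inj_power_basis] by simp
qed

lemma euclidean_subspace_code_space: "euclidean_subspace (code_space K) (code_form K)"
proof
  show "subspace (code_space K)" by (rule subspace_code_space)
  show "\<exists>B. finite B \<and> code_space K = span B" using span_power_basis by (intro exI[of _ "power_basis 1 ` {..<d + d}"]) auto
  fix x y z :: "ctensor \<times> ctensor" and r :: real
  assume x: "x \<in> code_space K"
  have fx: "fst x \<in> E1" "snd x \<in> E1" using x by (auto simp: code_space_def)
  have nn: "trace_form K u u \<ge> 0" if "u \<in> E1" for u
    using that by (simp add: trace_form_self sum_nonneg)
  show "code_form K x x > 0" if "x \<noteq> 0"
  proof (cases "fst x = 0")
    case True
    then have "snd x \<noteq> 0" using that by (simp add: prod_eq_iff)
    then show ?thesis using trace_form_pos fx nn by (simp add: code_form_def add_nonneg_pos)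
  next
    case False
    then show ?thesis using trace_form_pos fx nn by (simp add: code_form_def add_pos_nonneg)
  qed
  show "code_form K (r *\<^sub>R x) z = r * code_form K x z" if "z \<in> code_space K"
    using that fx by (auto simp: code_space_def code_form_def trace_form_bilinear(2)[of _ 0] subspace_0[OF subspace_E1] algebra_simps)
  show "code_form K x y = code_form K y x" if "y \<in> code_space K"
    using that fx trace_form_bilinear(3)[OF _ subspace_0[OF subspace_E1]]
    by (auto simp: code_space_def code_form_def intro!: arg_cong2[of _ _ _ _ "(+)"])
  show "code_form K (x + y) z = code_form K x z + code_form K y z" if "y \<in> code_space K" "z \<in> code_space K"
    using that fx by (auto simp: code_space_def code_form_def trace_form_bilinear(1))
qed

end

section \<open>Counting lattice points\<close>

sublocale cyclotomic \<subseteq> E: euclidean_subspace "code_space K" "code_form K"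
  by (rule euclidean_subspace_code_space)

context cyclotomic
begin

section \<open>The lattice of integral pairs and its covering radius\<close>

definition emb :: "complex \<times> complex \<Rightarrow> ctensor \<times> ctensor" where
  "emb x = (tensor (fst x) 1, tensor (snd x) 1)"

lemma emb_in_code_space: "x \<in> K \<times> K \<Longrightarrow> emb x \<in> code_space K"
  by (auto simp: emb_def code_space_def tensor_in_E1)

lemma OK2_in_K2: "x \<in> OK \<times> OK \<Longrightarrow> x \<in> K \<times> K"
  using OK_in_K by auto

lemma emb_diff: "emb (x - y) = emb x - emb y"
  by (simp add: emb_def tensor_diff_left)

lemma emb_0: "emb 0 = 0"
  using emb_diff[of 0 0] by simp

lemma nrm_emb: "x \<in> K \<times> K \<Longrightarrow> (E.nrm (emb x))\<^sup>2 = sqnorm (fst x) + sqnorm (snd x)"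
proof -
  assume x: "x \<in> K \<times> K"
  have "trace_form K (tensor a 1) (tensor a 1) = sqnorm a" if "a \<in> K" for a
    using that by (simp add: trace_form_self tensor_in_E1 sqnorm_def conj_real_tensor)
  then show ?thesis using x
    unfolding E.nrm_square[OF emb_in_code_space[OF x]] by (auto simp: emb_def code_form_def)
qed

lemma sqnorm_nonneg: "sqnorm x \<ge> 0"
  by (simp add: sqnorm_def sum_nonneg)

lemma sqnorm_0: "sqnorm 0 = 0"
  by (simp add: sqnorm_def \<sigma>_0)

lemma sqnorm_pos: "x \<in> OK \<Longrightarrow> x \<noteq> 0 \<Longrightarrow> sqnorm x > 0"
  using sqnorm_ge_d[of x] d_pos by linarith

lemma nrm_emb_ge: "x \<in> OK \<times> OK \<Longrightarrow> x \<noteq> 0 \<Longrightarrow> sqrt (real d) \<le> E.nrm (emb x)"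
proof -
  assume x: "x \<in> OK \<times> OK" "x \<noteq> 0"
  then have "real d \<le> sqnorm (fst x) + sqnorm (snd x)"
    using sqnorm_ge_d[of "fst x"] sqnorm_ge_d[of "snd x"] sqnorm_nonneg[of "fst x"] sqnorm_nonneg[of "snd x"]
    by (cases "fst x = 0") (auto simp: prod_eq_iff)
  then have "real d \<le> (E.nrm (emb x))\<^sup>2" using nrm_emb[OF OK2_in_K2[OF x(1)]] by simp
  then show ?thesis
    using E.nrm_nonneg[OF emb_in_code_space[OF OK2_in_K2[OF x(1)]]] by (rule real_le_lsqrt[rotated 1])
qed

lemma emb_inj: "x \<in> OK \<times> OK \<Longrightarrow> y \<in> OK \<times> OK \<Longrightarrow> emb x = emb y \<Longrightarrow> x = y"
proof (rule ccontr)
  assume x: "x \<in> OK \<times> OK" "y \<in> OK \<times> OK" "emb x = emb y" "x \<noteq> y"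
  then have "x - y \<in> OK \<times> OK" "x - y \<noteq> 0" by (auto simp: OK_diff)
  then have "sqrt (real d) \<le> E.nrm (emb (x - y))" by (rule nrm_emb_ge)
  then show False using x(3) d_pos E.nrm_eq_0_iff[OF E.V_closed(1)] by (simp add: emb_diff)
qed

lemma \<sigma>_\<zeta>_power: "z \<in> Z \<Longrightarrow> \<sigma> z (\<zeta> ^ i) = z ^ i"
  by (simp add: \<sigma>_power K_\<zeta> \<sigma>_\<zeta>)

lemma norm_Z: "z \<in> Z \<Longrightarrow> cmod z = 1"
  using Z_subset_U power_eq_1_iff[of z m] m_pos by (auto simp: U_def)

lemma sqnorm_\<zeta>_mult: "x \<in> K \<Longrightarrow> sqnorm (x * \<zeta> ^ i) = sqnorm x"
  by (simp add: sqnorm_def \<sigma>_mult K_power K_\<zeta> \<sigma>_\<zeta>_power norm_mult norm_power norm_Z)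

lemma sqnorm_1: "sqnorm 1 = real d"
  by (simp add: sqnorm_def \<sigma>_1 card_Z d_def)

text \<open>Each squared conjugate is at most \<open>sqnorm x\<close>. The factor d does not grow
  with k, so it is lost when k tends to infinity in \<open>sqnorm_prime_ge\<close>.\<close>

lemma sqnorm_power_le: "x \<in> K \<Longrightarrow> sqnorm (x ^ k) \<le> real d * sqnorm x ^ k"
proof -
  assume x: "x \<in> K"
  have "sqnorm (x ^ k) = (\<Sum>z\<in>Z. ((cmod (\<sigma> z x))\<^sup>2) ^ k)"
    using x by (simp add: sqnorm_def \<sigma>_power norm_power mult.commute flip: power_mult)
  also have "\<dots> \<le> (\<Sum>z\<in>Z. sqnorm x ^ k)"
    unfolding sqnorm_def by (intro sum_mono power_mono member_le_sum finite_Z) auto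
  also have "\<dots> = real d * sqnorm x ^ k" by (simp add: card_Z d_def)
  finally show ?thesis .
qed

lemma power_basis_emb: "y \<in> OK \<Longrightarrow> \<exists>x\<in>OK \<times> OK. power_basis y k = emb x \<and> sqnorm (fst x) + sqnorm (snd x) = sqnorm y"
proof (cases "k < d")
  case True
  assume y: "y \<in> OK"
  show ?thesis
    by (rule bexI[of _ "(y * \<zeta> ^ k, 0)"])
      (use True y in \<open>auto simp: power_basis_def emb_def tensor_zero_left sqnorm_0 sqnorm_\<zeta>_mult OK_in_K OK_0 OK_mult OK_power OK_\<zeta>\<close>)
next
  case False
  assume y: "y \<in> OK"
  show ?thesis
    by (rule bexI[of _ "(0, y * \<zeta> ^ (k - d))"])
      (use False y in \<open>auto simp: power_basis_def emb_def tensor_zero_left sqnorm_0 sqnorm_\<zeta>_mult OK_in_K OK_0 OK_mult OK_power OK_\<zeta>\<close>)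
qed

text \<open>The 2d vectors of \<open>power_basis y\<close> all have squared norm
  \<open>sqnorm y\<close>, because roots of unity have absolute value 1 in every conjugation.
  Rounding therefore leaves a squared error of at most 2d * sqnorm y / 4.\<close>

lemma covering:
  assumes y: "y \<in> OK" "y \<noteq> 0" and v: "v \<in> code_space K"
  shows "\<exists>a\<in>OK \<times> OK. E.nrm (v - emb (y * fst a, y * snd a)) \<le> sqrt (real d * sqnorm y / 2)"
proof -
  obtain t s where ts: "v = (comb y t, comb y s)"
    using v E1_eq_comb[OF y] by (fastforce simp: code_space_def)
  define a where "a k = (if k < d then t k else s (k - d))" for k
  have va: "v = (\<Sum>k<d + d. a k *\<^sub>R power_basis y k)"
    unfolding sum_power_basis ts a_def by (simp add: comb_def)
  have bbV: "power_basis y k \<in> code_space K" "code_form K (power_basis y k) (power_basis y k) = sqnorm y" for k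
  proof -
    obtain x where x: "x \<in> OK \<times> OK" "power_basis y k = emb x" "sqnorm (fst x) + sqnorm (snd x) = sqnorm y"
      using power_basis_emb[OF y(1)] by blast
    note xK = OK2_in_K2[OF x(1)]
    show 1: "power_basis y k \<in> code_space K" using x emb_in_code_space[OF xK] by simp
    show "code_form K (power_basis y k) (power_basis y k) = sqnorm y"
      using E.nrm_square[OF 1] nrm_emb[OF xK] x by simp
  qed
  obtain z :: "nat \<Rightarrow> int" where
    z: "(E.nrm ((\<Sum>k<d + d. a k *\<^sub>R power_basis y k) - (\<Sum>k<d + d. of_int (z k) *\<^sub>R power_basis y k)))\<^sup>2
      \<le> (\<Sum>k<d + d. code_form K (power_basis y k) (power_basis y k)) / 4"
    using E.integer_rounding[of "{..<d + d}" "power_basis y" a] bbV by blast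
  define x where "x = ((\<Sum>i<d. of_int (z i) * \<zeta> ^ i), (\<Sum>i<d. of_int (z (d + i)) * \<zeta> ^ i))"
  have xOK: "x \<in> OK \<times> OK"
    unfolding x_def by (auto intro!: OK_sum OK_mult OK_of_int OK_power OK_\<zeta>)
  have "comb y (\<lambda>i. of_int (u i)) = tensor (y * (\<Sum>i<d. of_int (u i) * \<zeta> ^ i)) 1" for u :: "nat \<Rightarrow> int"
  proof -
    have "tensor (y * (\<Sum>i<d. of_int (u i) * \<zeta> ^ i)) 1 = (\<Sum>i<d. tensor (of_rat (of_int (u i)) * (y * \<zeta> ^ i)) 1)"
      by (simp add: sum_distrib_left tensor_sum_left mult_ac)
    also have "\<dots> = comb y (\<lambda>i. of_int (u i))"
      unfolding tensor_of_rat_mult comb_def by simp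
    finally show ?thesis ..
  qed
  then have "(\<Sum>k<d + d. of_int (z k) *\<^sub>R power_basis y k) = emb (y * fst x, y * snd x)"
    unfolding sum_power_basis by (simp add: emb_def x_def)
  then have "(E.nrm (v - emb (y * fst x, y * snd x)))\<^sup>2 \<le> real d * sqnorm y / 2"
    using z va bbV by (simp add: mult.commute)
  then show ?thesis using xOK by (intro bexI[of _ x] real_le_rsqrt)
qed

lemma countable_OK: "countable OK"
proof -
  have "OK \<subseteq> (\<lambda>t. \<Sum>i<d. of_rat (t i) * \<zeta> ^ i) ` ({..<d} \<rightarrow>\<^sub>E (UNIV :: rat set))"
  proof
    fix x assume "x \<in> OK"
    then have "x = (\<Sum>i<d. of_rat (rcoeff x i) * \<zeta> ^ i)" using K_expansion OK_in_K by blast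
    then show "x \<in> (\<lambda>t. \<Sum>i<d. of_rat (t i) * \<zeta> ^ i) ` ({..<d} \<rightarrow>\<^sub>E (UNIV :: rat set))"
      by (intro image_eqI[of _ _ "restrict (rcoeff x) {..<d}"]) auto
  qed
  then show ?thesis by (rule countable_subset) (intro countable_image countable_PiE; auto)
qed

lemma lattice_in_emb:
  assumes S: "S \<subseteq> OK \<times> OK" "0 \<in> S" "\<And>x y. x \<in> S \<Longrightarrow> y \<in> S \<Longrightarrow> x - y \<in> S"
  shows "lattice_in (code_space K) (code_form K) (emb ` S)"
proof
  show "emb ` S \<subseteq> code_space K" using S(1) OK2_in_K2 emb_in_code_space by blast
  show "0 \<in> emb ` S" using S(2) emb_0 by force
  show "x - y \<in> emb ` S" if xy: "x \<in> emb ` S" "y \<in> emb ` S" for x y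
  proof -
    obtain a b where ab: "a \<in> S" "b \<in> S" "x = emb a" "y = emb b" using xy by blast
    then have "x - y = emb (a - b)" "a - b \<in> S" using S(3) by (auto simp: emb_diff)
    then show ?thesis by blast
  qed
  show "countable (emb ` S)" using S(1) countable_OK by (meson countable_SIGMA countable_image countable_subset)
  show "\<exists>\<epsilon>>0. \<forall>x\<in>emb ` S. x \<noteq> 0 \<longrightarrow> \<epsilon> \<le> E.nrm x"
  proof (intro exI[of _ "sqrt (real d)"] conjI ballI impI)
    fix x assume "x \<in> emb ` S" "x \<noteq> 0"
    then show "sqrt (real d) \<le> E.nrm x" using S(1) nrm_emb_ge emb_0 by force
  qed (use d_pos in simp)
qed

sublocale L0: lattice_in "code_space K" "code_form K" "emb ` (OK \<times> OK)"
  by (rule lattice_in_emb) (auto simp: OK_0 OK_diff zero_prod_def)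

section \<open>Covolume bounds and counting of short vectors\<close>

definition R0 :: "(ctensor \<times> ctensor) set" where
  "R0 = (SOME R. fundamental_region (code_space K) (code_form K) (emb ` (OK \<times> OK)) R)"

definition D :: real where "D = measure E.vol R0"

text \<open>The bound of \<open>covering\<close> for y = 1, where \<open>sqnorm 1\<close> is
  d.\<close>

definition \<tau> :: real where "\<tau> = real d / sqrt 2"

lemma \<tau>_pos: "\<tau> > 0" using d_pos by (simp add: \<tau>_def)

lemma R0: "fundamental_region (code_space K) (code_form K) (emb ` (OK \<times> OK)) R0"
  unfolding R0_def using L0.fundamental_region_exists by (rule someI_ex)

lemma covering_1: "v \<in> code_space K \<Longrightarrow> \<exists>a\<in>OK \<times> OK. E.nrm (v - emb a) \<le> \<tau>"
  using covering[OF OK_1 _, of v] by (auto simp: sqnorm_1 \<tau>_def real_sqrt_divide)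

lemma covering_by_ball:
  assumes v: "v \<in> code_space K"
  shows "\<exists>S\<subseteq>emb ` (OK \<times> OK). finite S \<and> 1 \<le> card S \<and> (\<forall>l\<in>S. v + l \<in> E.cb \<tau>)"
proof -
  obtain a where a: "a \<in> OK \<times> OK" "E.nrm (v - emb a) \<le> \<tau>" using covering_1[OF v] by blast
  have "- emb a \<in> emb ` (OK \<times> OK)" using a L0.L_minus by blast
  then show ?thesis
    using a v L0.L_in_V by (intro exI[of _ "{- emb a}"]) (auto simp: E.cb_iff E.V_closed)
qed

lemma volume_bound_aux:
  assumes "\<And>x. x \<in> code_space K \<Longrightarrow> \<exists>S\<subseteq>emb ` (OK \<times> OK). finite S \<and> k \<le> card S \<and> (\<forall>l\<in>S. x + l \<in> E.cb r)"
    and r: "r > 0"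
  shows "of_nat k * emeasure E.vol R0 \<le> ennreal (E.unit_ball_vol * r ^ (2 * d))"
  using L0.emeasure_ge_multiple[OF R0 E.sets_cb[of r] assms(1)] E.emeasure_cb[OF r]
  by (simp add: dim_code_space)

text \<open>\<open>measure\<close> returns 0 on sets of infinite measure, so \<open>D\<close>
  represents the covolume only after finiteness is shown. It comes from the ball of radius \<tau>,
  which meets every orbit.\<close>

lemma emeasure_R0: "emeasure E.vol R0 = ennreal D"
proof -
  have "of_nat 1 * emeasure E.vol R0 \<le> ennreal (E.unit_ball_vol * \<tau> ^ (2 * d))"
  by (rule volume_bound_aux[OF covering_by_ball \<tau>_pos])
  then have "emeasure E.vol R0 < \<infinity>" by (simp add: le_less_trans ennreal_less_top)
  then show ?thesis by (simp add: D_def emeasure_eq_ennreal_measure less_top)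
qed

lemma D_nonneg: "D \<ge> 0" by (simp add: D_def)

text \<open>A ball meeting every orbit in at least k points has k times the covolume. It is applied
  with k = 1 to bound \<open>D\<close>, with the number of short vectors in
  \<open>point_count\<close>, and with a power of q in \<open>sqnorm_prime_ge\<close>.\<close>

lemma volume_bound:
  assumes "\<And>x. x \<in> code_space K \<Longrightarrow> \<exists>S\<subseteq>emb ` (OK \<times> OK). finite S \<and> k \<le> card S \<and> (\<forall>l\<in>S. x + l \<in> E.cb r)"
    and r: "r > 0"
  shows "real k * D \<le> E.unit_ball_vol * r ^ (2 * d)"
proof -
  have "ennreal (real k * D) = of_nat k * emeasure E.vol R0"
    by (simp add: emeasure_R0 ennreal_mult D_nonneg ennreal_of_nat_eq_real_of_nat)
  also have "\<dots> \<le> ennreal (E.unit_ball_vol * r ^ (2 * d))" by (rule volume_bound_aux[OF assms])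
  finally show ?thesis using r E.unit_ball_vol_pos by (simp add: ennreal_le_iff)
qed

lemma D_upper: "D \<le> E.unit_ball_vol * \<tau> ^ (2 * d)"
proof -
  have "real 1 * D \<le> E.unit_ball_vol * \<tau> ^ (2 * d)"
  by (rule volume_bound[OF covering_by_ball \<tau>_pos])
  then show ?thesis by simp
qed

lemma D_lower: "E.unit_ball_vol * (sqrt (real d) / 3) ^ (2 * d) \<le> D"
proof -
  \<comment> \<open>Any radius below half the minimal norm keeps the balls around lattice points
    disjoint. The 3 returns, squared, in the constant 18 = 2 * 9 of the choice of
    parameters.\<close>
  let ?r = "sqrt (real d) / 3"
  have r: "?r > 0" using d_pos by simp
  have "emeasure E.vol (E.cb ?r) \<le> of_nat 1 * emeasure E.vol R0"
  proof (rule L0.emeasure_le_multiple[OF R0 E.sets_cb])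
    fix v assume v: "v \<in> code_space K"
    let ?S = "{l \<in> emb ` (OK \<times> OK). v + l \<in> E.cb ?r}"
    have "l = l'" if "l \<in> ?S" "l' \<in> ?S" for l l'
    proof (rule ccontr)
      assume "l \<noteq> l'"
      obtain a b where ab: "a \<in> OK \<times> OK" "b \<in> OK \<times> OK" "l = emb a" "l' = emb b" using \<open>l \<in> ?S\<close> \<open>l' \<in> ?S\<close> by blast
      have vl: "v + l \<in> code_space K" "v + l' \<in> code_space K" "E.nrm (v + l) \<le> ?r" "E.nrm (v + l') \<le> ?r"
        using that unfolding E.cb_iff by blast+
      have "a - b \<in> OK \<times> OK" "a - b \<noteq> 0" using ab \<open>l \<noteq> l'\<close> by (auto simp: OK_diff)
      then have "sqrt (real d) \<le> E.nrm (emb (a - b))" by (rule nrm_emb_ge)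
      also have "emb (a - b) = (v + l) + (- (v + l'))" by (simp add: emb_diff ab)
      also have "E.nrm \<dots> \<le> E.nrm (v + l) + E.nrm (- (v + l'))"
        by (rule E.nrm_triangle[OF vl(1) E.V_closed(4)[OF vl(2)]])
      also have "\<dots> \<le> ?r + ?r" 
        unfolding E.nrm_minus[OF vl(2)] using vl(3,4) by (rule add_mono)
      finally show False using r by simp
    qed
    then obtain l where l: "?S \<subseteq> {l}" by blast
    then show "finite ?S \<and> card ?S \<le> 1"
      using finite_subset[OF l] card_mono[OF _ l] by simp
  qed
  then have "ennreal (E.unit_ball_vol * ?r ^ (2 * d)) \<le> ennreal D"
    using E.emeasure_cb[OF r] by (simp add: emeasure_R0 dim_code_space)
  then show ?thesis using D_nonneg by (simp add: ennreal_le_iff)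
qed

lemma D_pos: "D > 0"
  using D_lower E.unit_ball_vol_pos d_pos by (smt (verit) divide_pos_pos mult_pos_pos of_nat_0_less_iff real_sqrt_gt_zero zero_less_power)

text \<open>Shift the short vectors x by a lattice point a near v: v + x - a is within r + \<tau> of
  the origin. So each orbit meets the ball of radius r + \<tau> in at least \<open>card T\<close>
  points.\<close>

lemma point_count:
  assumes T: "finite T" "T \<subseteq> OK \<times> OK" "\<And>x. x \<in> T \<Longrightarrow> E.nrm (emb x) \<le> r" and r: "r > 0"
  shows "real (card T) * D \<le> E.unit_ball_vol * (r + \<tau>) ^ (2 * d)"
proof (rule volume_bound)
  fix v assume v: "v \<in> code_space K"
  obtain a where a: "a \<in> OK \<times> OK" "E.nrm (v - emb a) \<le> \<tau>" using covering_1[OF v] by blast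
  let ?S = "(\<lambda>x. emb (x - a)) ` T"
  have aV: "emb a \<in> code_space K" using a emb_in_code_space OK2_in_K2 by blast
  have inj: "inj_on (\<lambda>x. emb (x - a)) T"
  proof (rule inj_onI)
    fix x y assume xy: "x \<in> T" "y \<in> T" "emb (x - a) = emb (y - a)"
    then have "emb x = emb y" by (simp add: emb_diff)
    then show "x = y" using emb_inj[of x y] xy T(2) by blast
  qed
  have "v + emb (x - a) \<in> E.cb (r + \<tau>)" if x: "x \<in> T" for x
  proof -
    have xV: "emb x \<in> code_space K" using x T(2) emb_in_code_space OK2_in_K2 by blast
    have e: "v + emb (x - a) = emb x + (v - emb a)" by (simp add: emb_diff)
    have "E.nrm (emb x + (v - emb a)) \<le> E.nrm (emb x) + E.nrm (v - emb a)"
      by (intro E.nrm_triangle E.V_closed xV v aV)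
    then have "E.nrm (v + emb (x - a)) \<le> r + \<tau>" unfolding e using T(3)[OF x] a(2) by linarith
    moreover have "v + emb (x - a) \<in> code_space K"
      unfolding emb_diff by (intro E.V_closed v xV aV)
    ultimately show ?thesis by (simp add: E.cb_iff)
  qed
  moreover have "?S \<subseteq> emb ` (OK \<times> OK)" using T(2) a by (auto simp: OK_diff)
  ultimately show "\<exists>S\<subseteq>emb ` (OK \<times> OK). finite S \<and> card T \<le> card S \<and> (\<forall>l\<in>S. v + l \<in> E.cb (r + \<tau>))"
    using T(1) by (intro exI[of _ ?S]) (auto simp: card_image[OF inj])
qed (use r \<tau>_pos in simp)

end

section \<open>The prime ideal and its minimal norm\<close>

locale cyclotomic_prime = cyclotomic +
  fixes P :: "complex set" and B :: "complex set"
  assumes P_subset: "P \<subseteq> OK" and P_0: "0 \<in> P" and P_diff: "x \<in> P \<Longrightarrow> y \<in> P \<Longrightarrow> x - y \<in> P"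
    and P_mult: "a \<in> OK \<Longrightarrow> x \<in> P \<Longrightarrow> a * x \<in> P"
    and P_prime: "a \<in> OK \<Longrightarrow> b \<in> OK \<Longrightarrow> a * b \<in> P \<Longrightarrow> a \<in> P \<or> b \<in> P"
    and B_finite: "finite B" and B_subset: "B \<subseteq> OK"
    and B_reps: "x \<in> OK \<Longrightarrow> \<exists>!b. b \<in> B \<and> x - b \<in> P"
begin

text \<open>The norm of the ideal. The residue field is represented by the system \<open>B\<close>
  of representatives, which keeps the computations inside \<open>OK\<close>.\<close>

definition q :: nat where "q = card B"

lemma q_pos: "q > 0"
  using B_reps[OF OK_0] B_finite by (auto simp: q_def card_gt_0_iff)

lemma P_add: "x \<in> P \<Longrightarrow> y \<in> P \<Longrightarrow> x + y \<in> P"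
  using P_diff[of x "0 - y"] P_diff[of 0 y] P_0 by simp

lemma B_eqI: "b \<in> B \<Longrightarrow> c \<in> B \<Longrightarrow> b - c \<in> P \<Longrightarrow> b = c"
  using B_reps[of b] B_subset P_0 by (metis diff_self subsetD)

text \<open>Multiplication by \<open>x\<close> maps \<open>OK\<close> isomorphically onto an ideal inside \<open>P\<close>, so the index
  of \<open>x\<^sup>k OK\<close> is at least \<open>q\<^sup>k\<close>.\<close>

lemma incongruent_set:
  assumes x: "x \<in> P" "x \<noteq> 0"
  shows "\<exists>S\<subseteq>OK. finite S \<and> card S = q ^ k \<and> (\<forall>s\<in>S. \<forall>t\<in>S. \<forall>w\<in>OK. s - t = x ^ k * w \<longrightarrow> s = t)"
proof (induction k)
  case 0
  show ?case by (rule exI[of _ "{0}"]) (simp add: OK_0)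
next
  case (Suc k)
  then obtain S where S: "S \<subseteq> OK" "finite S" "card S = q ^ k"
    "\<And>s t w. s \<in> S \<Longrightarrow> t \<in> S \<Longrightarrow> w \<in> OK \<Longrightarrow> s - t = x ^ k * w \<Longrightarrow> s = t" by blast
  have xOK: "x \<in> OK" using x P_subset by blast
  \<comment> \<open>Expansions in base x with digits in \<open>B\<close>: two numbers congruent
    modulo x^(k+1) have last digits congruent modulo \<open>P\<close>, hence equal, and after
    cancelling x the induction hypothesis compares the rest.\<close>
  have key: "b = c \<and> s = t"
    if bc: "b \<in> B" "c \<in> B" "s \<in> S" "t \<in> S" "w \<in> OK" "(b + x * s) - (c + x * t) = x ^ Suc k * w" for b c s t w
  proof -
    have "s \<in> OK" "t \<in> OK" "x ^ k * w \<in> OK" using bc S xOK OK_mult OK_power by auto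
    then have "(x ^ k * w - (s - t)) * x \<in> P" using x by (intro P_mult OK_diff)
    moreover have "(x ^ k * w - (s - t)) * x = b - c" using bc(6) by (simp add: algebra_simps)
    ultimately have "b = c" using B_eqI bc by simp
    then have "x * (s - t) = x * (x ^ k * w)" using bc(6) by (simp add: algebra_simps)
    then have "s - t = x ^ k * w" using x(2) by simp
    then show ?thesis using S(4) bc \<open>b = c\<close> by blast
  qed
  have inj: "inj_on (\<lambda>(b, s). b + x * s) (B \<times> S)"
  proof (rule inj_onI)
    fix p p' assume p: "p \<in> B \<times> S" "p' \<in> B \<times> S" "(case p of (b, s) \<Rightarrow> b + x * s) = (case p' of (b, s) \<Rightarrow> b + x * s)"
    obtain b s c t where bs: "p = (b, s)" "p' = (c, t)" by (cases p, cases p')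
    have "b = c \<and> s = t" using p key[of b c s t 0] by (simp add: bs OK_0)
    then show "p = p'" by (simp add: bs)
  qed
  let ?T = "(\<lambda>(b, s). b + x * s) ` (B \<times> S)"
  have T1: "?T \<subseteq> OK"
  proof
    fix y assume "y \<in> ?T"
    then obtain b s where "b \<in> B" "s \<in> S" "y = b + x * s" by auto
    then show "y \<in> OK" using B_subset S(1) xOK by (auto intro: OK_add OK_mult)
  qed
  have T2: "finite ?T" using B_finite S by simp
  have T3: "card ?T = q ^ Suc k"
    using S by (simp add: card_image[OF inj] card_cartesian_product q_def)
  have T4: "s = t" if "s \<in> ?T" "t \<in> ?T" "w \<in> OK" "s - t = x ^ Suc k * w" for s t w
  proof -
    obtain b u where 1: "b \<in> B" "u \<in> S" "s = b + x * u" using \<open>s \<in> ?T\<close> by auto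
    obtain c v where 2: "c \<in> B" "v \<in> S" "t = c + x * v" using \<open>t \<in> ?T\<close> by auto
    have "b = c \<and> u = v" using key[OF 1(1) 2(1) 1(2) 2(2) that(3)] that(4) 1(3) 2(3) by simp
    then show ?thesis using 1 2 by simp
  qed
  show ?case by (intro exI[of _ ?T] conjI ballI impI T1 T2 T3) (rule T4; assumption)
qed

text \<open>Comparing volumes for \<open>x\<^sup>k OK\<close> gives \<open>q\<^bsup>2k\<^esup> \<le> C \<parallel>x\<parallel>\<^bsup>2dk\<^esup>\<close>; the constant disappears as
  \<open>k\<close> grows.\<close>

lemma sqnorm_prime_ge:
  assumes x: "x \<in> P" "x \<noteq> 0"
  shows "real q ^ 2 \<le> sqnorm x ^ d"
proof (rule ccontr)
  assume "\<not> ?thesis"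
  then have less: "sqnorm x ^ d < real q ^ 2" by simp
  have xOK: "x \<in> OK" using x P_subset by blast
  have sx: "sqnorm x > 0" using sqnorm_pos[OF xOK x(2)] .
  define C where "C = E.unit_ball_vol * (real d * real d / 2) ^ d"
  have bound: "(real q ^ 2) ^ k * D \<le> C * (sqnorm x ^ d) ^ k" for k
  proof -
    obtain S where S: "S \<subseteq> OK" "finite S" "card S = q ^ k"
      "\<And>s t w. s \<in> S \<Longrightarrow> t \<in> S \<Longrightarrow> w \<in> OK \<Longrightarrow> s - t = x ^ k * w \<Longrightarrow> s = t"
      using incongruent_set[OF x, of k] by blast
    define y where "y = x ^ k"
    have y: "y \<in> OK" "y \<noteq> 0" unfolding y_def using xOK x OK_power by auto
    define r where "r = sqrt (real d * sqnorm y / 2)"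
    have r: "r > 0" using d_pos sqnorm_pos[OF y] by (simp add: r_def)
    have "real (q ^ k * q ^ k) * D \<le> E.unit_ball_vol * r ^ (2 * d)"
    proof (rule volume_bound[OF _ r])
      fix v assume v: "v \<in> code_space K"
      have SOK: "s \<in> S \<times> S \<Longrightarrow> s \<in> OK \<times> OK" for s using S(1) by auto
      have "\<exists>a\<in>OK \<times> OK. E.nrm (v + emb s - emb (y * fst a, y * snd a)) \<le> r" if "s \<in> S \<times> S" for s
        unfolding r_def using covering[OF y, of "v + emb s"] v emb_in_code_space[OF OK2_in_K2[OF SOK[OF that]]] E.V_closed(2) by blast
      then obtain a where a: "\<And>s. s \<in> S \<times> S \<Longrightarrow> a s \<in> OK \<times> OK"
        "\<And>s. s \<in> S \<times> S \<Longrightarrow> E.nrm (v + emb s - emb (y * fst (a s), y * snd (a s))) \<le> r" by metis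
      \<comment> \<open>Each pair s is moved by a vector of x^k OK x OK so that v + s lands in the
        ball. Vectors from that sublattice preserve congruence classes, so the q^(2k) incongruent
        pairs stay distinct.\<close>
      define f where "f s = s - (y * fst (a s), y * snd (a s))" for s
      have yaOK: "(y * fst (a s), y * snd (a s)) \<in> OK \<times> OK" if "s \<in> S \<times> S" for s
        using a(1)[OF that] y by (auto simp: OK_mult)
      have fOK: "f s \<in> OK \<times> OK" if "s \<in> S \<times> S" for s
        using SOK[OF that] yaOK[OF that] by (auto simp: f_def OK_diff)
      have inj: "inj_on (\<lambda>s. emb (f s)) (S \<times> S)"
      proof (rule inj_onI)
        fix s t assume st: "s \<in> S \<times> S" "t \<in> S \<times> S" "emb (f s) = emb (f t)"
        then have "f s = f t" using emb_inj fOK by blast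
        then have eq: "fst s - fst t = x ^ k * (fst (a s) - fst (a t))" "snd s - snd t = x ^ k * (snd (a s) - snd (a t))"
          by (auto simp: f_def y_def prod_eq_iff algebra_simps)
        have "fst (a s) - fst (a t) \<in> OK" "snd (a s) - snd (a t) \<in> OK"
          using a(1)[OF st(1)] a(1)[OF st(2)] by (auto simp: mem_Times_iff intro: OK_diff)
        then show "s = t" using eq S(4) st by (auto simp: mem_Times_iff prod_eq_iff)
      qed
      have "v + emb (f s) \<in> E.cb r" if s: "s \<in> S \<times> S" for s
      proof -
        have e: "v + emb (f s) = v + emb s - emb (y * fst (a s), y * snd (a s))"
          by (simp add: f_def emb_diff)
        have "v + emb (f s) \<in> code_space K"
          using v emb_in_code_space[OF OK2_in_K2[OF fOK[OF s]]] by (rule E.V_closed(2))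
        then show ?thesis using a(2)[OF s] unfolding E.cb_iff e by blast
      qed
      moreover have "card ((\<lambda>s. emb (f s)) ` (S \<times> S)) = q ^ k * q ^ k"
        using S by (simp add: card_image[OF inj] card_cartesian_product)
      ultimately show "\<exists>T\<subseteq>emb ` (OK \<times> OK). finite T \<and> q ^ k * q ^ k \<le> card T \<and> (\<forall>l\<in>T. v + l \<in> E.cb r)"
        using fOK S(2) by (intro exI[of _ "(\<lambda>s. emb (f s)) ` (S \<times> S)"]) auto
    qed
    also have "r ^ (2 * d) = (real d * sqnorm y / 2) ^ d"
      using sqnorm_nonneg by (simp add: r_def power_mult)
    also have "(real d * sqnorm y / 2) ^ d \<le> (real d * (real d * sqnorm x ^ k) / 2) ^ d"
      using sqnorm_power_le[OF OK_in_K[OF xOK], of k] sqnorm_nonneg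
      by (intro power_mono divide_right_mono mult_left_mono) (auto simp: y_def)
    also have "\<dots> = (real d * real d / 2) ^ d * (sqnorm x ^ d) ^ k"
      by (simp add: power_mult_distrib power_divide mult.assoc mult.commute flip: power_mult)
    finally show ?thesis
      using E.unit_ball_vol_pos by (simp add: C_def power_mult_distrib power2_eq_square mult_left_mono mult.assoc)
  qed
  \<comment> \<open>The volume comparison bounds every power of \<rho> by C / D, in which k does not
    occur; this is impossible for \<rho> > 1.\<close>
  define \<rho> where "\<rho> = real q ^ 2 / sqnorm x ^ d"
  have "\<rho> > 1" using less sx by (simp add: \<rho>_def)
  then obtain k where k: "C / D < \<rho> ^ k" using real_arch_pow by blast
  have "\<rho> ^ k * D \<le> C"
    using bound[of k] sx by (simp add: \<rho>_def power_divide field_simps)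
  then show False using k D_pos by (simp add: field_simps)
qed

text \<open>The integral pairs reducing into the line spanned by (1, a). As a runs through
  \<open>B\<close> this yields q of the q + 1 lines, all but the one spanned by (0, 1).\<close>

definition line_lattice :: "complex \<Rightarrow> (complex \<times> complex) set" where
  "line_lattice a = {(x, y). x \<in> OK \<and> y \<in> OK \<and> y - a * x \<in> P}"

lemma lattice_in_line: "a \<in> OK \<Longrightarrow> lattice_in (code_space K) (code_form K) (emb ` line_lattice a)"
proof (rule lattice_in_emb)
  assume a: "a \<in> OK"
  show "0 \<in> line_lattice a" by (simp add: line_lattice_def zero_prod_def OK_0 P_0)
  fix x y assume xy: "x \<in> line_lattice a" "y \<in> line_lattice a"
  obtain x1 x2 y1 y2 where "x = (x1, x2)" "y = (y1, y2)" by (cases x, cases y)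
  moreover have "(x2 - a * x1) - (y2 - a * y1) \<in> P" if "x2 - a * x1 \<in> P" "y2 - a * y1 \<in> P"
    using that by (rule P_diff)
  ultimately show "x - y \<in> line_lattice a"
    using xy by (auto simp: line_lattice_def OK_diff algebra_simps)
qed (auto simp: line_lattice_def)

text \<open>The map (x, y) -> y - a x modulo \<open>P\<close> identifies the quotient of the
  lattices with the residue field, so the pairs (0, b) with b in \<open>B\<close> represent the
  cosets.\<close>

lemma line_lattice_covolume:
  assumes a: "a \<in> OK"
  shows "covolume (code_space K) (code_form K) (emb ` line_lattice a) = real q * D"
proof -
  interpret L: lattice_in "code_space K" "code_form K" "emb ` line_lattice a" by (rule lattice_in_line[OF a])
  obtain R where R: "fundamental_region (code_space K) (code_form K) (emb ` line_lattice a) R"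
    using L.fundamental_region_exists by blast
  let ?S = "(\<lambda>b. emb (0, b)) ` B"
  have inj: "inj_on (\<lambda>b. emb (0, b)) B"
    using B_subset OK_0 emb_inj by (auto simp: inj_on_def) (metis SigmaI emb_inj prod.inject subsetD)
  have "emeasure E.vol R = of_nat (card ?S) * emeasure E.vol R0"
  proof (rule L0.emeasure_fundamental_region_sublattice[OF R0 R])
    show "emb ` line_lattice a \<subseteq> emb ` (OK \<times> OK)" by (auto simp: line_lattice_def)
    show "x - y \<in> emb ` line_lattice a" if "x \<in> emb ` line_lattice a" "y \<in> emb ` line_lattice a" for x y
      using that by (rule L.L_diff)
    show "finite ?S" using B_finite by simp
    show "?S \<subseteq> emb ` (OK \<times> OK)" using B_subset OK_0 by auto
    fix l assume "l \<in> emb ` (OK \<times> OK)"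
    then obtain x y where xy: "l = emb (x, y)" "x \<in> OK" "y \<in> OK" by auto
    have iff: "l - emb (0, b) \<in> emb ` line_lattice a \<longleftrightarrow> y - a * x - b \<in> P" if b: "b \<in> B" for b
    proof -
      have bOK: "b \<in> OK" using b B_subset by blast
      have e: "l - emb (0, b) = emb (x, y - b)" by (simp add: xy flip: emb_diff)
      have "emb (x, y - b) \<in> emb ` line_lattice a \<longleftrightarrow> (x, y - b) \<in> line_lattice a"
      proof
        assume "emb (x, y - b) \<in> emb ` line_lattice a"
        then obtain p where p: "p \<in> line_lattice a" "emb (x, y - b) = emb p" by blast
        have "p \<in> OK \<times> OK" using p by (auto simp: line_lattice_def)
        then have "p = (x, y - b)" using emb_inj[of "(x, y - b)" p] p xy bOK by (auto simp: OK_diff)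
        then show "(x, y - b) \<in> line_lattice a" using p by simp
      qed simp
      then show ?thesis unfolding e using xy bOK by (simp add: line_lattice_def OK_diff algebra_simps)
    qed
    have "y - a * x \<in> OK" using xy a by (simp add: OK_diff OK_mult)
    then obtain b where b: "b \<in> B" "y - a * x - b \<in> P" "\<And>c. c \<in> B \<Longrightarrow> y - a * x - c \<in> P \<Longrightarrow> c = b"
      using B_reps by metis
    show "\<exists>!s. s \<in> ?S \<and> l - s \<in> emb ` line_lattice a"
    proof (rule ex1I[of _ "emb (0, b)"])
      show "emb (0, b) \<in> ?S \<and> l - emb (0, b) \<in> emb ` line_lattice a" using b iff by blast
      fix s assume "s \<in> ?S \<and> l - s \<in> emb ` line_lattice a"
      then obtain c where "c \<in> B" "s = emb (0, c)" "y - a * x - c \<in> P" using iff by blast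
      then show "s = emb (0, b)" using b(3) by blast
    qed
  qed
  then have "emeasure E.vol R = ennreal (real q * D)"
    by (simp add: card_image[OF inj] q_def emeasure_R0 ennreal_mult D_nonneg ennreal_of_nat_eq_real_of_nat)
  then have "measure E.vol R = real q * D" using D_nonneg by (simp add: measure_def)
  then show ?thesis using L.emeasure_covolume[OF R] by simp
qed

lemma nonzero_component_bound:
  assumes p: "p \<in> P \<times> P" "p \<noteq> 0" and r: "E.nrm (emb p) \<le> r" "r \<ge> 0"
  shows "real q ^ 2 \<le> r ^ (2 * d)"
proof -
  have pOK: "p \<in> OK \<times> OK" using p P_subset by auto
  have s: "sqnorm (fst p) + sqnorm (snd p) \<le> r ^ 2"
    using nrm_emb[OF OK2_in_K2[OF pOK]] power_mono[OF r(1), of 2] E.nrm_nonneg[OF emb_in_code_space[OF OK2_in_K2[OF pOK]]] by simp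
  obtain x where x: "x \<in> P" "x \<noteq> 0" "sqnorm x \<le> r ^ 2"
  proof (cases "fst p = 0")
    case True
    then show ?thesis using that[of "snd p"] p s sqnorm_nonneg[of "fst p"] by (auto simp: prod_eq_iff)
  next
    case False
    then show ?thesis using that[of "fst p"] p s sqnorm_nonneg[of "snd p"] by (auto simp: prod_eq_iff)
  qed
  have "real q ^ 2 \<le> sqnorm x ^ d" using sqnorm_prime_ge[OF x(1,2)] .
  also have "\<dots> \<le> (r ^ 2) ^ d" using x sqnorm_nonneg by (intro power_mono)
  finally show ?thesis by (simp add: power_mult)
qed

text \<open>If every \<open>line_lattice a\<close> had a nonzero vector of norm at most \<open>r\<close>, its multiples by the
  \<open>m\<close> roots of unity, for all \<open>q\<close> values of \<open>a\<close>, would be \<open>q m\<close> distinct vectors.\<close>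

lemma exists_line_without_short_vectors:
  assumes r: "r > 0" "r ^ (2 * d) < real q ^ 2"
    and vol: "E.unit_ball_vol * (r + \<tau>) ^ (2 * d) \<le> real m * real q * D"
  shows "\<exists>a\<in>B. \<forall>p\<in>line_lattice a. p \<noteq> 0 \<longrightarrow> r < E.nrm (emb p)"
proof (rule ccontr)
  assume "\<not> ?thesis"
  then have "\<forall>a\<in>B. \<exists>p\<in>line_lattice a. p \<noteq> 0 \<and> E.nrm (emb p) \<le> r" by (auto simp: not_less)
  then obtain p where p: "\<And>a. a \<in> B \<Longrightarrow> p a \<in> line_lattice a" "\<And>a. a \<in> B \<Longrightarrow> p a \<noteq> 0"
    "\<And>a. a \<in> B \<Longrightarrow> E.nrm (emb (p a)) \<le> r" by metis
  define f where "f = (\<lambda>(a, i). (fst (p a) * \<zeta> ^ i, snd (p a) * \<zeta> ^ i))"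
  have \<zeta>OK: "\<zeta> ^ i \<in> OK" for i by (simp add: OK_power OK_\<zeta>)
  have \<zeta>0: "\<zeta> ^ i \<noteq> 0" for i by (simp add: \<zeta>_def)
  have pOK: "fst (p a) \<in> OK" "snd (p a) \<in> OK" "snd (p a) - a * fst (p a) \<in> P" if "a \<in> B" for a
    using p(1)[OF that] by (auto simp: line_lattice_def)
  have fl: "f (a, i) \<in> line_lattice a" if a: "a \<in> B" for a i
  proof -
    have "\<zeta> ^ i * (snd (p a) - a * fst (p a)) \<in> P" using pOK[OF a] \<zeta>OK by (intro P_mult)
    then show ?thesis using pOK[OF a] \<zeta>OK by (auto simp: f_def line_lattice_def OK_mult algebra_simps)
  qed
  have fOK: "f (a, i) \<in> OK \<times> OK" if a: "a \<in> B" for a i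
    using fl[OF a, of i] by (cases "f (a, i)") (auto simp: line_lattice_def)
  have f0: "f (a, i) \<noteq> 0" if a: "a \<in> B" for a i
    using p(2)[OF a] \<zeta>0 by (auto simp: f_def prod_eq_iff)
  have fn: "E.nrm (emb (f (a, i))) \<le> r" if a: "a \<in> B" for a i
  proof -
    have "p a \<in> OK \<times> OK" using pOK[OF a] by (simp add: mem_Times_iff)
    then have "(E.nrm (emb (f (a, i))))\<^sup>2 = (E.nrm (emb (p a)))\<^sup>2"
      using nrm_emb[OF OK2_in_K2] fOK[OF a, of i] pOK[OF a] OK_in_K by (simp add: f_def sqnorm_\<zeta>_mult)
    then have "E.nrm (emb (f (a, i))) = E.nrm (emb (p a))"
      using \<open>p a \<in> OK \<times> OK\<close> fOK[OF a, of i] by (simp add: E.nrm_nonneg emb_in_code_space OK2_in_K2)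
    then show ?thesis using p(3)[OF a] by simp
  qed
  have inj: "inj_on f (B \<times> {..<m})"
  proof (rule inj_onI)
    fix u v assume uv: "u \<in> B \<times> {..<m}" "v \<in> B \<times> {..<m}" "f u = f v"
    obtain a i b j where e: "u = (a, i)" "v = (b, j)" by (cases u, cases v)
    then have ab: "a \<in> B" "b \<in> B" "i < m" "j < m" using uv by auto
    obtain x y where xy: "f (a, i) = (x, y)" by (cases "f (a, i)")
    have 1: "x \<in> OK" "y \<in> OK" "y - a * x \<in> P" using fl[OF ab(1), of i] by (auto simp: xy line_lattice_def)
    have fb: "f (b, j) = (x, y)" using uv(3) xy by (simp add: e)
    have 2: "y - b * x \<in> P" using fl[OF ab(2), of j] by (simp add: fb line_lattice_def)
    have aOK: "a \<in> OK" "b \<in> OK" using ab B_subset by auto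
    \<comment> \<open>A vector on two different lines has (a - b) x in \<open>P\<close>, so x and
      then y lie in \<open>P\<close>. Such a nonzero vector is longer than r by the minimal norm of
      \<open>P\<close>.\<close>
    have "a = b"
    proof (rule ccontr)
      assume "a \<noteq> b"
      then have "a - b \<notin> P" using B_eqI ab by blast
      moreover have "(a - b) * x \<in> P" using P_diff[OF 2 1(3)] by (simp add: algebra_simps)
      ultimately have xP: "x \<in> P" using P_prime[of "a - b" x] aOK 1 OK_diff by blast
      then have "a * x \<in> P" using P_mult aOK by blast
      then have "y \<in> P" using P_add[OF 1(3)] by fastforce
      then have "f (a, i) \<in> P \<times> P" using xP xy by simp
      then have "real q ^ 2 \<le> r ^ (2 * d)"
        using f0[OF ab(1)] fn[OF ab(1)] r by (intro nonzero_component_bound) auto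
      then show False using r by simp
    qed
    moreover have "i = j"
    proof -
      have "\<zeta> ^ i = \<zeta> ^ j"
        using uv(3) p(2)[OF ab(1)] \<open>a = b\<close> by (auto simp: e f_def prod_eq_iff)
      then show ?thesis using inj_onD[OF \<zeta>_power_inj] ab by simp
    qed
    ultimately show "u = v" by (simp add: e)
  qed
  \<comment> \<open>The zero vector makes the count q m + 1, which contradicts the volume bound even
    when that bound equals q m exactly.\<close>
  let ?T = "insert 0 (f ` (B \<times> {..<m}))"
  have "f ` (B \<times> {..<m}) \<subseteq> OK \<times> OK"
  proof
    fix w assume "w \<in> f ` (B \<times> {..<m})"
    then obtain a i where "a \<in> B" "w = f (a, i)" by blast
    then show "w \<in> OK \<times> OK" using fOK by simp
  qed
  then have T: "finite ?T" "?T \<subseteq> OK \<times> OK" using B_finite OK_0 by (simp_all add: zero_prod_def)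
  have "0 \<notin> f ` (B \<times> {..<m})" using f0 by force
  then have card: "card ?T = q * m + 1"
    using B_finite by (simp add: card_image[OF inj] card_cartesian_product q_def)
  have "real (card ?T) * D \<le> E.unit_ball_vol * (r + \<tau>) ^ (2 * d)"
  proof (rule point_count[OF T])
    fix x assume "x \<in> ?T"
    then show "E.nrm (emb x) \<le> r"
      using fn r E.nrm_eq_0_iff[OF E.V_closed(1)] by (auto simp: emb_0)
  qed (use r in simp)
  then have "real (q * m + 1) * D \<le> real m * real q * D" using vol unfolding card by linarith
  then show False using D_pos by (simp add: algebra_simps)
qed

lemma exists_dense_lattice:
  assumes r: "r > 0" "r ^ (2 * d) < real q ^ 2"
    and vol: "E.unit_ball_vol * (r + \<tau>) ^ (2 * d) \<le> real m * real q * D"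
  shows "\<exists>a\<in>B. E.unit_ball_vol * r ^ (2 * d) / (2 ^ (2 * d) * (real q * D))
    \<le> lattice_density (code_space K) (code_form K) (emb ` line_lattice a)"
proof -
  obtain a where a: "a \<in> B" "\<And>p. p \<in> line_lattice a \<Longrightarrow> p \<noteq> 0 \<Longrightarrow> r < E.nrm (emb p)"
    using exists_line_without_short_vectors[OF assms] by blast
  have aOK: "a \<in> OK" using a B_subset by blast
  let ?L = "emb ` line_lattice a"
  define \<mu>' where "\<mu>' = min_norm (code_form K) ?L"
  have "r \<le> \<mu>'"
    unfolding \<mu>'_def min_norm_def
  proof (rule cInf_greatest)
    \<comment> \<open>The greatest-lower-bound argument for \<open>Inf\<close> requires a nonempty
      set, so a nonzero lattice vector has to be exhibited.\<close>
    have "(1, a) \<in> line_lattice a" using aOK by (simp add: line_lattice_def OK_1 P_0)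
    moreover have "emb (1, a) \<noteq> 0"
    proof
      assume "emb (1, a) = 0"
      then have "emb (1, a) = emb 0" by (simp only: emb_0)
      then show False using emb_inj[of "(1, a)" 0] aOK OK_1 OK_0 by (simp add: zero_prod_def)
    qed
    ultimately show "(\<lambda>x. sqrt (code_form K x x)) ` (?L - {0}) \<noteq> {}" by blast
    fix x assume "x \<in> (\<lambda>x. sqrt (code_form K x x)) ` (?L - {0})"
    then obtain p where p: "p \<in> line_lattice a" "emb p \<noteq> 0" "x = E.nrm (emb p)"
      unfolding E.nrm_def by blast
    then have "p \<noteq> 0" using emb_0 by auto
    then show "r \<le> x" using a(2) p by (simp add: less_imp_le)
  qed
  then have "E.unit_ball_vol * r ^ (2 * d) \<le> E.unit_ball_vol * \<mu>' ^ (2 * d)"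
    using r E.unit_ball_vol_pos by (intro mult_left_mono power_mono) auto
  also have "\<dots> = measure E.vol (E.cb \<mu>')"
    using E.measure_cb[of \<mu>'] \<open>r \<le> \<mu>'\<close> r by (simp add: dim_code_space)
  finally have "E.unit_ball_vol * r ^ (2 * d) \<le> measure E.vol (E.cb \<mu>')" .
  then have "E.unit_ball_vol * r ^ (2 * d) / (2 ^ (2 * d) * (real q * D))
      \<le> lattice_density (code_space K) (code_form K) ?L"
    unfolding lattice_density_def dim_code_space line_lattice_covolume[OF aOK] \<mu>'_def[symmetric]
    using D_nonneg by (intro divide_right_mono) auto
  then show ?thesis using a by blast
qed

end

section \<open>Choice of the parameters\<close>

text \<open>The hypothesis \<open>Q1\<close> keeps the radius below the minimal norm of the prime
  ideal, and \<open>Q2\<close> makes 2 d \<tau> \<le> \<epsilon> s. Bernoulli's inequality then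
  gives ((s - \<tau>) / s)^(2d) \<ge> 1 - \<epsilon>.\<close>

lemma (in cyclotomic_prime) exists_lattice_density_ge:
  assumes \<epsilon>: "0 < \<epsilon>" "\<epsilon> \<le> 1" and d2: "d \<ge> 2" and m_le: "m \<le> 2 * d\<^sup>2"
    and Q1: "real d ^ 3 \<le> real q powr (1 / real d)"
    and Q2: "18 * real d ^ 3 \<le> \<epsilon>\<^sup>2 * real q powr (1 / real d)"
  shows "\<exists>a\<in>B. (1 - \<epsilon>) * real m / 2 ^ (2 * d)
    \<le> lattice_density (code_space K) (code_form K) (emb ` line_lattice a)"
proof -
  define V1 where "V1 = E.unit_ball_vol"
  have V1: "V1 > 0" using E.unit_ball_vol_pos by (simp add: V1_def)
  define Q where "Q = real q powr (1 / real d)"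
  have Q: "Q > 0" "Q ^ d = real q"
    using q_pos d_pos by (simp_all add: Q_def powr_realpow[symmetric] powr_powr)
  \<comment> \<open>The ball of radius s has volume m q D, the largest that
    \<open>exists_dense_lattice\<close> admits for r + \<tau>; hence r = s - \<tau> below.\<close>
  define s where "s = root (2 * d) (real m * real q * D / V1)"
  have pos: "real m * real q * D / V1 > 0" using m_pos q_pos D_pos V1 by simp
  have s: "s > 0" "s ^ (2 * d) = real m * real q * D / V1"
    using pos d_pos by (simp_all add: s_def)
  have s_eq: "V1 * s ^ (2 * d) = real m * real q * D" using s V1 by simp
  have s_lower: "sqrt (real d) / 3 * sqrt Q \<le> s"
  proof -
    have "(sqrt Q) ^ (2 * d) = real q" using Q by (simp add: power_mult)
    then have "(sqrt (real d) / 3 * sqrt Q) ^ (2 * d) = (sqrt (real d) / 3) ^ (2 * d) * real q"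
      by (simp only: power_mult_distrib)
    also have "\<dots> \<le> D / V1 * real q"
      using D_lower V1 by (intro mult_right_mono) (simp_all add: V1_def field_simps)
    also have "\<dots> = 1 * (real q * D / V1)" by simp
    also have "\<dots> \<le> real m * (real q * D / V1)"
      using m_pos D_pos V1 by (intro mult_right_mono) auto
    also have "\<dots> = s ^ (2 * d)" using s by simp
    finally have "(sqrt (real d) / 3 * sqrt Q) ^ (2 * d) \<le> s ^ (2 * d)" .
    moreover have "0 \<le> sqrt (real d) / 3 * sqrt Q" using Q by simp
    ultimately show ?thesis
      using power_mono_iff[of "sqrt (real d) / 3 * sqrt Q" s "2 * d"] s d_pos by (meson less_imp_le mult_pos_pos zero_less_numeral)
  qed
  have s_upper: "s ^ (2 * d) \<le> real q ^ 2"
  proof -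
    \<comment> \<open>Here d \<ge> 2 enters: m \<le> 2 d^2 \<le> (2d)^2 \<le> (2d)^d, and 2d times
      d^2 / 2 is the d^3 of \<open>Q1\<close>.\<close>
    have "real m * (real d * real d / 2) ^ d \<le> (2 * real d) ^ d * (real d * real d / 2) ^ d"
    proof (rule mult_right_mono)
      have "real m \<le> real (2 * d\<^sup>2)" using m_le by (rule of_nat_mono)
      also have "\<dots> \<le> (2 * real d) ^ 2" by (simp add: power2_eq_square)
      also have "\<dots> \<le> (2 * real d) ^ d" using d2 by (intro power_increasing) auto
      finally show "real m \<le> (2 * real d) ^ d" .
    qed simp
    also have "\<dots> = (2 * real d * (real d * real d / 2)) ^ d"
      by (rule power_mult_distrib[symmetric])
    also have "\<dots> = (real d ^ 3) ^ d" by (simp add: power3_eq_cube mult.assoc)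
    also have "\<dots> \<le> Q ^ d" using Q1 by (intro power_mono) (auto simp: Q_def)
    finally have mq: "real m * (real d * real d / 2) ^ d \<le> real q" using Q by simp
    have "s ^ (2 * d) = real m * real q * (D / V1)" using s by simp
    also have "\<dots> \<le> real m * real q * \<tau> ^ (2 * d)"
      using D_upper V1 by (intro mult_left_mono) (simp_all add: V1_def field_simps)
    also have "\<tau> ^ (2 * d) = (real d * real d / 2) ^ d"
      by (simp add: \<tau>_def power_mult power_divide power2_eq_square)
    also have "real m * real q * (real d * real d / 2) ^ d = real q * (real m * (real d * real d / 2) ^ d)" by simp
    also have "\<dots> \<le> real q * real q" using mq by (intro mult_left_mono) auto
    finally show ?thesis by (simp add: power2_eq_square)
  qed
  have \<tau>_small: "2 * real d * \<tau> \<le> \<epsilon> * s"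
  proof -
    have "(2 * real d * \<tau>)\<^sup>2 = real d / 9 * (18 * real d ^ 3)"
      by (simp add: \<tau>_def power_mult_distrib power_divide power2_eq_square power3_eq_cube)
    also have "\<dots> \<le> real d / 9 * (\<epsilon>\<^sup>2 * Q)"
      using Q2 by (intro mult_left_mono) (auto simp: Q_def)
    also have "\<dots> = (\<epsilon> * (sqrt (real d) / 3 * sqrt Q))\<^sup>2"
      using Q by (simp add: power_mult_distrib power_divide)
    finally have "2 * real d * \<tau> \<le> \<epsilon> * (sqrt (real d) / 3 * sqrt Q)"
      by (rule power2_le_imp_le) (use \<epsilon> Q in auto)
    also have "\<dots> \<le> \<epsilon> * s" using s_lower \<epsilon> by (intro mult_left_mono) auto
    finally show ?thesis .
  qed
  \<comment> \<open>A fixed ratio between s and \<tau> makes r positive and -\<tau> / s at least -1,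
    as Bernoulli's inequality demands.\<close>
  have "4 * \<tau> \<le> 2 * real d * \<tau>" using d2 \<tau>_pos by (intro mult_right_mono) auto
  also have "\<dots> \<le> 1 * s" using \<tau>_small \<epsilon> s by (meson mult_right_mono less_imp_le order_trans)
  finally have \<tau>s: "4 * \<tau> \<le> s" by simp
  define r where "r = s - \<tau>"
  have r: "r > 0" "r < s" using \<tau>s \<tau>_pos by (auto simp: r_def)
  have "r ^ (2 * d) < s ^ (2 * d)" using r d_pos by (intro power_strict_mono) auto
  then have r2: "r ^ (2 * d) < real q ^ 2" using s_upper by linarith
  have vol: "E.unit_ball_vol * (r + \<tau>) ^ (2 * d) \<le> real m * real q * D"
    using s_eq by (simp add: r_def V1_def)
  obtain a where a: "a \<in> B" "V1 * r ^ (2 * d) / (2 ^ (2 * d) * (real q * D))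
    \<le> lattice_density (code_space K) (code_form K) (emb ` line_lattice a)"
    using exists_dense_lattice[OF r(1) r2 vol] by (auto simp: V1_def)
  have "1 - \<epsilon> \<le> 1 + real (2 * d) * (- \<tau> / s)"
    using \<tau>_small s by (simp add: field_simps)
  also have "\<dots> \<le> (1 + (- \<tau> / s)) ^ (2 * d)"
    using \<tau>s \<tau>_pos s by (intro Bernoulli_inequality) (simp add: field_simps)
  also have "1 + (- \<tau> / s) = r / s" using s by (simp add: r_def field_simps)
  finally have "(1 - \<epsilon>) * real m / 2 ^ (2 * d) \<le> (r / s) ^ (2 * d) * real m / 2 ^ (2 * d)"
    by (intro divide_right_mono mult_right_mono) auto
  also have "\<dots> = V1 * r ^ (2 * d) * (real m / (2 ^ (2 * d) * (V1 * s ^ (2 * d))))"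
    using V1 s(1) by (simp add: power_divide)
  also have "\<dots> = V1 * r ^ (2 * d) / (2 ^ (2 * d) * (real q * D))"
    unfolding s_eq using m_pos by simp
  finally show ?thesis using a by force
qed

text \<open>Passage from the quotient ring to representatives. The code belonging to
  \<open>line_lattice a\<close> is the line through (1 + P, a + P): a pair is a multiple of that
  vector exactly when y - a x lies in \<open>P\<close>.\<close>

lemma cyclotomic_prime_of_primeideal:
  assumes m: "m > 0" and prime: "primeideal P (integers_ring (cyclotomic_field m))"
    and fin: "finite (carrier (integers_ring (cyclotomic_field m) Quot P))"
  obtains B where "cyclotomic_prime m P B"
    and "card B = card (carrier (integers_ring (cyclotomic_field m) Quot P))"
    and "\<And>a. a \<in> B \<Longrightarrow> cyclotomic.emb ` cyclotomic_prime.line_lattice m P a \<in> code_lattices (cyclotomic_field m) P"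
proof -
  define R where "R = integers_ring (cyclotomic_field m)"
  interpret I: primeideal P R using prime by (simp add: R_def)
  interpret cyclotomic m
    by (rule cyclotomic.intro) (use m I.ring_axioms in \<open>simp_all add: R_def\<close>)
  have Rs: "carrier R = OK" "mult R = (*)" "add R = (+)" "\<one>\<^bsub>R\<^esub> = 1" "\<zero>\<^bsub>R\<^esub> = 0"
    using carrier_integers_ring by (simp_all add: R_def K_def integers_ring_def)
  have P_OK: "P \<subseteq> OK" using I.a_subset Rs by simp
  have P0: "0 \<in> P" using I.zero_closed Rs by (metis I.additive_subgroup_axioms additive_subgroup.zero_closed)
  have Pmult: "a * x \<in> P" if "a \<in> OK" "x \<in> P" for a x
    using I.I_l_closed[of x a] that Rs by simp
  have Padd: "x + y \<in> P" if "x \<in> P" "y \<in> P" for x y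
    using additive_subgroup.a_closed[OF I.additive_subgroup_axioms, of x y] that Rs by simp
  have Pdiff: "x - y \<in> P" if "x \<in> P" "y \<in> P" for x y
    using Padd[of x "(-1) * y"] Pmult[of "-1" y] that OK_uminus[OF OK_1] by simp
  have Pprime: "a \<in> P \<or> b \<in> P" if "a \<in> OK" "b \<in> OK" "a * b \<in> P" for a b
    using I.I_prime[of a b] that Rs by simp
  have P1: "1 \<notin> P" using I.one_imp_carrier I.I_notcarr Rs by auto
  have cos: "P +>\<^bsub>R\<^esub> x = (\<lambda>h. h + x) ` P" for x
    using Rs by (auto simp: a_r_coset_def')
  have cos_eq: "P +>\<^bsub>R\<^esub> x = P +>\<^bsub>R\<^esub> y \<longleftrightarrow> x - y \<in> P" for x y
  proof
    assume "P +>\<^bsub>R\<^esub> x = P +>\<^bsub>R\<^esub> y"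
    moreover have "0 + x \<in> P +>\<^bsub>R\<^esub> x" unfolding cos using P0 by blast
    ultimately obtain h where "h \<in> P" "x = h + y" by (auto simp: cos)
    then show "x - y \<in> P" by simp
  next
    assume xy: "x - y \<in> P"
    have sub: "P +>\<^bsub>R\<^esub> x \<subseteq> P +>\<^bsub>R\<^esub> y" if "x - y \<in> P" for x y
    proof
      fix w assume "w \<in> P +>\<^bsub>R\<^esub> x"
      then obtain h where h: "h \<in> P" "w = h + x" by (auto simp: cos)
      then have "w = (h + (x - y)) + y" "h + (x - y) \<in> P" using Padd that by auto
      then show "w \<in> P +>\<^bsub>R\<^esub> y" unfolding cos by blast
    qed
    have "y - x \<in> P" using Pdiff[OF P0 xy] by simp
    then show "P +>\<^bsub>R\<^esub> x = P +>\<^bsub>R\<^esub> y" using sub xy by blast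
  qed
  have carQ: "carrier (R Quot P) = (\<lambda>x. P +>\<^bsub>R\<^esub> x) ` OK"
    using Rs by (auto simp: FactRing_def A_RCOSETS_def')
  define rep where "rep C = (SOME x. x \<in> OK \<and> C = P +>\<^bsub>R\<^esub> x)" for C
  have rep: "rep C \<in> OK \<and> C = P +>\<^bsub>R\<^esub> rep C" if "C \<in> carrier (R Quot P)" for C
    unfolding rep_def by (rule someI_ex) (use that carQ in blast)
  define B where "B = rep ` carrier (R Quot P)"
  have inj: "inj_on rep (carrier (R Quot P))" using rep by (metis inj_onI)
  have cardB: "card B = card (carrier (R Quot P))" unfolding B_def by (rule card_image[OF inj])
  interpret cyclotomic_prime m P B
  proof
    show "finite B" using fin by (simp add: B_def R_def)
    show "B \<subseteq> OK" using rep by (auto simp: B_def)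
    fix x assume x: "x \<in> OK"
    then have C: "P +>\<^bsub>R\<^esub> x \<in> carrier (R Quot P)" using carQ by blast
    show "\<exists>!b. b \<in> B \<and> x - b \<in> P"
    proof (rule ex1I[of _ "rep (P +>\<^bsub>R\<^esub> x)"])
      show "rep (P +>\<^bsub>R\<^esub> x) \<in> B \<and> x - rep (P +>\<^bsub>R\<^esub> x) \<in> P"
        using C rep[OF C] cos_eq by (auto simp: B_def)
      fix b assume b: "b \<in> B \<and> x - b \<in> P"
      then obtain C' where C': "C' \<in> carrier (R Quot P)" "b = rep C'" by (auto simp: B_def)
      have "P +>\<^bsub>R\<^esub> x = P +>\<^bsub>R\<^esub> b" using b cos_eq by blast
      also have "\<dots> = C'" using rep[OF C'(1)] C'(2) by simp
      finally show "b = rep (P +>\<^bsub>R\<^esub> x)" using C' by simp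
    qed
  qed (use P_OK P0 Pdiff Pmult Pprime in auto)
  have "emb ` line_lattice a \<in> code_lattices (cyclotomic_field m) P" if a: "a \<in> B" for a
  proof -
    have aOK: "a \<in> OK" using a B_subset by blast
    define v where "v = P +>\<^bsub>R\<^esub> 1"
    define w where "w = P +>\<^bsub>R\<^esub> a"
    have multQ: "(P +>\<^bsub>R\<^esub> x) \<otimes>\<^bsub>R Quot P\<^esub> (P +>\<^bsub>R\<^esub> y) = P +>\<^bsub>R\<^esub> (x * y)" if "x \<in> OK" "y \<in> OK" for x y
      using I.rcoset_mult_add[of x y] that Rs by (simp add: FactRing_def)
    have zeroQ: "\<zero>\<^bsub>R Quot P\<^esub> = P +>\<^bsub>R\<^esub> 0" by (simp add: FactRing_def cos)
    define C where "C = {(c \<otimes>\<^bsub>R Quot P\<^esub> v, c \<otimes>\<^bsub>R Quot P\<^esub> w) |c. c \<in> carrier (R Quot P)}"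
    have "v \<noteq> \<zero>\<^bsub>R Quot P\<^esub>" unfolding v_def zeroQ cos_eq using P1 by simp
    moreover have "v \<in> carrier (R Quot P)" "w \<in> carrier (R Quot P)"
      using aOK OK_1 carQ by (auto simp: v_def w_def)
    ultimately have C_lines: "C \<in> lines (R Quot P)"
      unfolding lines_def C_def by blast
    have C_iff: "(P +>\<^bsub>R\<^esub> x, P +>\<^bsub>R\<^esub> y) \<in> C \<longleftrightarrow> y - a * x \<in> P" if xy: "x \<in> OK" "y \<in> OK" for x y
    proof
      assume "(P +>\<^bsub>R\<^esub> x, P +>\<^bsub>R\<^esub> y) \<in> C"
      then obtain c where c: "c \<in> OK" "P +>\<^bsub>R\<^esub> x = P +>\<^bsub>R\<^esub> (c * 1)" "P +>\<^bsub>R\<^esub> y = P +>\<^bsub>R\<^esub> (c * a)"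
        using aOK OK_1 by (auto simp: C_def carQ v_def w_def multQ)
      then have "x - c \<in> P" "y - c * a \<in> P" by (simp_all add: cos_eq)
      then have "(y - c * a) - a * (x - c) \<in> P" using Pmult[OF aOK] Pdiff by blast
      then show "y - a * x \<in> P" by (simp add: algebra_simps)
    next
      assume "y - a * x \<in> P"
      then have "P +>\<^bsub>R\<^esub> y = P +>\<^bsub>R\<^esub> (x * a)" by (simp add: cos_eq mult.commute)
      then have "(P +>\<^bsub>R\<^esub> x, P +>\<^bsub>R\<^esub> y) = ((P +>\<^bsub>R\<^esub> x) \<otimes>\<^bsub>R Quot P\<^esub> v, (P +>\<^bsub>R\<^esub> x) \<otimes>\<^bsub>R Quot P\<^esub> w)"
        using xy aOK OK_1 by (simp add: v_def w_def multQ)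
      then show "(P +>\<^bsub>R\<^esub> x, P +>\<^bsub>R\<^esub> y) \<in> C" unfolding C_def using carQ xy by blast
    qed
    have "code_lattice (cyclotomic_field m) P C = {(tensor x 1, tensor y 1) |x y. x \<in> OK \<and> y \<in> OK \<and> (P +>\<^bsub>R\<^esub> x, P +>\<^bsub>R\<^esub> y) \<in> C}"
      using Rs by (simp add: code_lattice_def R_def[symmetric])
    also have "\<dots> = emb ` line_lattice a"
      using C_iff by (fastforce simp: line_lattice_def emb_def image_iff)
    finally show ?thesis using C_lines unfolding code_lattices_def R_def[symmetric] by blast
  qed
  then show thesis using that[of B] cyclotomic_prime_axioms cardB by (simp add: R_def)
qed

theorem corollary1:
  fixes P :: "nat \<Rightarrow> complex set" and q :: "nat \<Rightarrow> nat"
  assumes "\<And>m. m > 0 \<Longrightarrow> primeideal (P m) (integers_ring (cyclotomic_field m))"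
    and "\<And>m. m > 0 \<Longrightarrow> \<exists>p. prime p \<and> \<not> p dvd m \<and> lies_over (P m) p"
    and "\<And>m. m > 0 \<Longrightarrow> q m = card (carrier (integers_ring (cyclotomic_field m) Quot P m))"
    and "(\<lambda>m. real ((totient m)\<^sup>2 * m)) \<in> o(\<lambda>m. real (q m) powr (1 / real (totient m)))"
  shows "infinite {n. \<exists>m>0. n = 2 * totient m \<and>
           (\<exists>L \<in> code_lattices (cyclotomic_field m) (P m).
              lattice_density (code_space (cyclotomic_field m)) (code_form (cyclotomic_field m)) L
                \<ge> 0.89 * real n * ln (ln (real n)) / 2 ^ n)}"
proof -
  obtain \<epsilon>0 where \<epsilon>0: "\<epsilon>0 > 0" "\<And>M. \<exists>m\<ge>M. M \<le> totient m \<and> m \<le> 2 * (totient m)\<^sup>2 \<and>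
     0.89 * real (2 * totient m) * ln (ln (real (2 * totient m))) \<le> (1 - \<epsilon>0) * real m"
    using totient_frequently_small by blast
  define \<epsilon> where "\<epsilon> = min \<epsilon>0 1"
  have \<epsilon>: "0 < \<epsilon>" "\<epsilon> \<le> 1" "\<epsilon> \<le> \<epsilon>0" using \<epsilon>0 by (auto simp: \<epsilon>_def)
  \<comment> \<open>The little-o constant matching the second growth condition of
    \<open>exists_lattice_density_ge\<close>; as \<delta> \<le> 1 it also covers the first.\<close>
  define \<delta> where "\<delta> = \<epsilon>\<^sup>2 / 18"
  have \<delta>: "\<delta> > 0" "\<delta> \<le> 1" using \<epsilon> power_le_one[of \<epsilon> 2] by (auto simp: \<delta>_def)
  have "\<forall>\<^sub>F m in at_top. norm (real ((totient m)\<^sup>2 * m)) \<le> \<delta> * norm (real (q m) powr (1 / real (totient m)))"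
    using landau_o.smallD[OF assms(4) \<delta>(1)] .
  then obtain M0 where M0: "\<And>m. m \<ge> M0 \<Longrightarrow> real ((totient m)\<^sup>2 * m) \<le> \<delta> * real (q m) powr (1 / real (totient m))"
    by (auto simp: eventually_at_top_linorder)
  show ?thesis
    unfolding infinite_nat_iff_unbounded_le
  proof
    fix N :: nat
    \<comment> \<open>\<open>N\<close> makes the dimension large, \<open>M0\<close> puts m in the
      range of the little-o bound, and 2 ensures d \<ge> 2.\<close>
    obtain m where m: "m \<ge> N + M0 + 2" "N + M0 + 2 \<le> totient m" "m \<le> 2 * (totient m)\<^sup>2"
      "0.89 * real (2 * totient m) * ln (ln (real (2 * totient m))) \<le> (1 - \<epsilon>0) * real m"
      using \<epsilon>0(2) by blast
    have m0: "m > 0" using m by simp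
    define Q where "Q = real (q m) powr (1 / real (totient m))"
    have Q: "real (totient m) ^ 3 \<le> \<delta> * Q"
    proof -
      have "real (totient m) ^ 3 = real ((totient m)\<^sup>2 * totient m)"
        by (simp add: power2_eq_square power3_eq_cube)
      also have "\<dots> \<le> real ((totient m)\<^sup>2 * m)"
        using totient_le[of m] by (intro of_nat_mono mult_le_mono) auto
      also have "\<dots> \<le> \<delta> * Q" using M0[of m] m by (simp add: Q_def)
      finally show ?thesis .
    qed
    moreover have "real (totient m) ^ 3 > 0" using m0 by simp
    \<comment> \<open>Finiteness of the residue ring is drawn from the growth hypothesis: an
      infinite carrier has \<open>card\<close> 0, and 0 powr anything is 0, against the lower bound
      for \<delta> Q.\<close>
    ultimately have "Q > 0" using \<delta> by (smt (verit) mult_nonneg_nonpos)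
    then have "q m \<noteq> 0" by (auto simp: Q_def)
    then have fin: "finite (carrier (integers_ring (cyclotomic_field m) Quot P m))"
      using assms(3)[OF m0] card.infinite by force
    obtain B where B: "cyclotomic_prime m (P m) B"
      "card B = card (carrier (integers_ring (cyclotomic_field m) Quot P m))"
      "\<And>a. a \<in> B \<Longrightarrow> cyclotomic.emb ` cyclotomic_prime.line_lattice m (P m) a \<in> code_lattices (cyclotomic_field m) (P m)"
      using cyclotomic_prime_of_primeideal[OF m0 assms(1)[OF m0] fin] by blast
    interpret C: cyclotomic_prime m "P m" B by (rule B(1))
    have qB: "C.q = q m" using B(2) assms(3)[OF m0] by (simp add: C.q_def)
    have dm: "C.d = totient m" by (simp add: C.d_def)
    have "\<exists>a\<in>B. (1 - \<epsilon>) * real m / 2 ^ (2 * C.d)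
        \<le> lattice_density (code_space C.K) (code_form C.K) (C.emb ` C.line_lattice a)"
    proof (rule C.exists_lattice_density_ge[OF \<epsilon>(1,2)])
      show "2 \<le> C.d" "m \<le> 2 * C.d\<^sup>2" using m by (simp_all add: dm)
      have "\<delta> * Q \<le> 1 * Q" using \<delta> \<open>Q > 0\<close> by (intro mult_right_mono) auto
      then show "real C.d ^ 3 \<le> real C.q powr (1 / real C.d)" using Q by (simp add: dm qB Q_def)
      show "18 * real C.d ^ 3 \<le> \<epsilon>\<^sup>2 * real C.q powr (1 / real C.d)"
        using Q by (simp add: dm qB Q_def \<delta>_def)
    qed
    then obtain a where a: "a \<in> B" "(1 - \<epsilon>) * real m / 2 ^ (2 * totient m)
        \<le> lattice_density (code_space (cyclotomic_field m)) (code_form (cyclotomic_field m)) (C.emb ` C.line_lattice a)"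
      unfolding dm C.K_def by blast
    have "(1 - \<epsilon>0) * real m \<le> (1 - \<epsilon>) * real m" using \<epsilon> by (intro mult_right_mono) auto
    then have "0.89 * real (2 * totient m) * ln (ln (real (2 * totient m))) \<le> (1 - \<epsilon>) * real m"
      using m(4) by linarith
    then have "0.89 * real (2 * totient m) * ln (ln (real (2 * totient m))) / 2 ^ (2 * totient m)
        \<le> (1 - \<epsilon>) * real m / 2 ^ (2 * totient m)"
      by (rule divide_right_mono) simp
    also note a(2)
    finally have "\<exists>L \<in> code_lattices (cyclotomic_field m) (P m).
        lattice_density (code_space (cyclotomic_field m)) (code_form (cyclotomic_field m)) L
          \<ge> 0.89 * real (2 * totient m) * ln (ln (real (2 * totient m))) / 2 ^ (2 * totient m)"
      using B(3)[OF a(1)] by blast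
    then have "2 * totient m \<in> {n. \<exists>m>0. n = 2 * totient m \<and>
           (\<exists>L \<in> code_lattices (cyclotomic_field m) (P m).
              lattice_density (code_space (cyclotomic_field m)) (code_form (cyclotomic_field m)) L
                \<ge> 0.89 * real n * ln (ln (real n)) / 2 ^ n)}"
      using m0 by blast
    moreover have "N \<le> 2 * totient m" using m(2) by linarith
    ultimately show "\<exists>n\<ge>N. n \<in> {n. \<exists>m>0. n = 2 * totient m \<and>
           (\<exists>L \<in> code_lattices (cyclotomic_field m) (P m).
              lattice_density (code_space (cyclotomic_field m)) (code_form (cyclotomic_field m)) L
                \<ge> 0.89 * real n * ln (ln (real n)) / 2 ^ n)}"
      by blast
  qed
qed

end
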